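(* Let $D=G/V$ be the classifying space of polarized Hodge structures, let $D_1=G/K$ be the associated symmetric space and $\pi:D\to D_1$ the natural projection. Let $U\subset D$ be a horizontal slice, with complex structure $J$. Then $\pi|_U:U\to D_1$ is an immersion. Furthermore it is pluriharmonic, i.e. it restricts to a harmonic map on every holomorphic curve of $U$; in other words, for every vector field $X$ on $U$, $$\nabla_{\pi_*X}\,\pi_*X+\nabla_{\pi_*JX}\,\pi_*JX+\pi_*J[X,JX]=0,$$ where $\nabla$ is the Riemannian (Levi-Civita) connection of the $G$-invariant Riemannian metric on $D_1=G/K$.
   Context: Classifying space. Fix a weight $n\ge 1$, a free abelian group $H_{\mathbb Z}$ of finite rank, $H_{\mathbb R}=H_{\mathbb Z}\otimes\mathbb R$, $H=H_{\mathbb Z}\otimes\mathbb C$, a nondegenerate bilinear form $Q:H_{\mathbb Z}\times H_{\mathbb Z}\to\mathbb Z$, symmetric if $n$ is even and skew-symmetric if $n$ is odd (extended to $H$), and Hodge numbers $h^{r,s}$ ($r+s=n$). The classifying space $D$ is the set of all decompositions $H=\bigoplus_{r+s=n}H^{r,s}$ with $H^{r,s}=\overline{H^{s,r}}$, $\dim H^{r,s}=h^{r,s}$, such that $Q(H^{r,s},H^{r',s'})=0$ unless $r'=n-r,\ s'=n-s$, and $(\sqrt{-1})^{r-s}Q(\phi,\bar\phi)>0$ for $0\ne\phi\in H^{r,s}$; equivalently the set of filtrations $F^r=\bigoplus_{a\ge r}H^{a,n-a}$. $D$ is a complex manifold whose holomorphic tangent bundle $T(D)$ is a subbundle of $\bigoplus_r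 \mathrm{Hom}(F^r,H/F^r)$; $J$ denotes its complex structure. Groups. $G=\mathrm{Aut}(H_{\mathbb R},Q)$ (its identity component where needed for connectedness) acts transitively on $D$; fix a base point $\{H_0^{r,s}\}$, let $V$ be the stabilizer of all $H_0^{r,s}$ and $K$ the stabilizer of $H_0^+=H_0^{n,0}\oplus H_0^{n-2,2}\oplus\cdots$. Standing assumptions: $G$ is a semisimple Lie group of noncompact type without compact factors, $V$ is a connected compact subgroup, and $K\supset V$ is the maximal connected compact subgroup. So $D=G/V$, and $D_1=G/K$ is a Riemannian symmetric space. The natural projection $\pi:D\to D_1$ is $aV\mapsto aK$. The invariant metric on $D_1$ is, up to a positive constant, the $G$-invariant metric given at the base point by the Killing form restricted to $\mathfrak p$, where $\mathfrak g=\mathfrak f\oplus\mathfrak p$ is the Cartan decomposition with $\mathfrak f=\mathrm{Lie}(K)$. Horizontal slices. The horizontal bundle is $T_h(D)=\{\xi\in T(D):\xi F^r\subset F^{r-1},\ r=1,\dots,n\}$ (i.e. $\xi F^r\subset F^{r-1}/F^r$). A horizontal slice is a complex integral submanifold of the distribution $T_h(D)$, i.e. a complex submanifold of $D$ all of whose tangent spaces lie in $T_h(D)$. Here $\nabla_{\pi_*X}\pi_*Y$ denotes the covariant derivative along the map $\pi|_U$ of the vector field $\pi_*Y$ in direction $\pi_*X$. *)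

theory Defs
  imports "HOL-Analysis.Analysis"
begin

section \<open>Smooth maps, vector fields and connections on submanifolds of Euclidean spaces\<close>

text \<open>All manifolds below are subsets of Euclidean spaces, with the smooth structure induced by
  the ambient space. A map on such a subset is smooth if it extends locally to a smooth map on an
  open set of the ambient space.\<close>

primrec Ck_on :: "nat \<Rightarrow> 'a::euclidean_space set \<Rightarrow> ('a \<Rightarrow> 'b::euclidean_space) \<Rightarrow> bool" where
  "Ck_on 0 W f \<longleftrightarrow> continuous_on W f"
| "Ck_on (Suc k) W f \<longleftrightarrow>
     (\<exists>f'. (\<forall>x\<in>W. (f has_derivative f' x) (at x)) \<and> (\<forall>v. Ck_on k W (\<lambda>x. f' x v)))"

definition smooth_on :: "'a::euclidean_space set \<Rightarrow> ('a \<Rightarrow> 'b::euclidean_space) \<Rightarrow> bool" where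
  "smooth_on S f \<longleftrightarrow>
     (\<forall>p\<in>S. \<exists>W F. open W \<and> p \<in> W \<and> (\<forall>k. Ck_on k W F) \<and> (\<forall>x\<in>S \<inter> W. f x = F x))"

definition curve_through :: "'a::euclidean_space set \<Rightarrow> 'a \<Rightarrow> 'a \<Rightarrow> (real \<Rightarrow> 'a) \<Rightarrow> bool" where
  "curve_through S p v c \<longleftrightarrow> c 0 = p \<and> (\<forall>t. c t \<in> S) \<and> (c has_vector_derivative v) (at 0)"

text \<open>Curves are only required to be differentiable at the parameter 0; on a submanifold this gives
  the same velocity vectors as smooth curves.\<close>

definition tangent_space :: "'a::euclidean_space set \<Rightarrow> 'a \<Rightarrow> 'a set" where
  "tangent_space S p = {v. \<exists>c. curve_through S p v c}"

text \<open>The differential at \<open>p\<close> of a smooth map \<open>f\<close> on \<open>S\<close>, applied to a tangent vector \<open>v\<close> of \<open>S\<close>.\<close>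

definition differential ::
  "'a::euclidean_space set \<Rightarrow> ('a \<Rightarrow> 'b::euclidean_space) \<Rightarrow> 'a \<Rightarrow> 'a \<Rightarrow> 'b" where
  "differential S f p v =
     (THE a. \<forall>c. curve_through S p v c \<longrightarrow> ((\<lambda>t. f (c t)) has_vector_derivative a) (at 0))"

definition section_along ::
  "'a::euclidean_space set \<Rightarrow> 'b::euclidean_space set \<Rightarrow> ('a \<Rightarrow> 'b) \<Rightarrow> ('a \<Rightarrow> 'b) \<Rightarrow> bool" where
  "section_along S M f W \<longleftrightarrow> smooth_on S W \<and> (\<forall>p\<in>S. W p \<in> tangent_space M (f p))"

abbreviation vector_field :: "'a::euclidean_space set \<Rightarrow> ('a \<Rightarrow> 'a) \<Rightarrow> bool" where
  "vector_field S X \<equiv> section_along S S (\<lambda>p. p) X"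

text \<open>In the ambient coordinates, \<open>[X, Y] = dY(X) - dX(Y)\<close>, so that
  \<open>[X, Y] f = X (Y f) - Y (X f)\<close>.\<close>

definition lie_bracket ::
  "'a::euclidean_space set \<Rightarrow> ('a \<Rightarrow> 'a) \<Rightarrow> ('a \<Rightarrow> 'a) \<Rightarrow> 'a \<Rightarrow> 'a" where
  "lie_bracket S X Y p = differential S Y p (X p) - differential S X p (Y p)"

definition immersion ::
  "'a::euclidean_space set \<Rightarrow> 'b::euclidean_space set \<Rightarrow> ('a \<Rightarrow> 'b) \<Rightarrow> bool" where
  "immersion S M f \<longleftrightarrow> f ` S \<subseteq> M \<and> smooth_on S f \<and>
     (\<forall>p\<in>S. inj_on (differential S f p) (tangent_space S p))"

text \<open>\<open>nab p v W\<close> is the covariant derivative, in the direction of the tangent vector \<open>v\<close> of \<open>S\<close>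
  at \<open>p\<close>, of the section \<open>W\<close> of the pullback of the tangent bundle of \<open>M\<close> along \<open>f\<close>.\<close>

definition connection_along ::
  "'a::euclidean_space set \<Rightarrow> 'b::euclidean_space set \<Rightarrow> ('a \<Rightarrow> 'b) \<Rightarrow>
   ('a \<Rightarrow> 'a \<Rightarrow> ('a \<Rightarrow> 'b) \<Rightarrow> 'b) \<Rightarrow> bool" where
  "connection_along S M f nab \<longleftrightarrow>
     (\<forall>W. section_along S M f W \<longrightarrow>
        (\<forall>p\<in>S. \<forall>u\<in>tangent_space S p. \<forall>v\<in>tangent_space S p.
           nab p v W \<in> tangent_space M (f p) \<and>
           (\<forall>a b. nab p (a *\<^sub>R u + b *\<^sub>R v) W = a *\<^sub>R nab p u W + b *\<^sub>R nab p v W)) \<and>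
        (\<forall>X. vector_field S X \<longrightarrow> smooth_on S (\<lambda>p. nab p (X p) W))) \<and>
     (\<forall>W Z. section_along S M f W \<longrightarrow> section_along S M f Z \<longrightarrow>
        (\<forall>p\<in>S. \<forall>v\<in>tangent_space S p.
           nab p v (\<lambda>x. W x + Z x) = nab p v W + nab p v Z)) \<and>
     (\<forall>\<phi>::'a \<Rightarrow> real. \<forall>W. smooth_on S \<phi> \<longrightarrow> section_along S M f W \<longrightarrow>
        (\<forall>p\<in>S. \<forall>v\<in>tangent_space S p.
           nab p v (\<lambda>x. \<phi> x *\<^sub>R W x) = differential S \<phi> p v *\<^sub>R W p + \<phi> p *\<^sub>R nab p v W))"

definition levi_civita ::
  "'a::euclidean_space set \<Rightarrow> ('a \<Rightarrow> 'a \<Rightarrow> 'a \<Rightarrow> real) \<Rightarrow> ('a \<Rightarrow> 'a \<Rightarrow> ('a \<Rightarrow> 'a) \<Rightarrow> 'a) \<Rightarrow> bool" where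
  "levi_civita M g nab \<longleftrightarrow>
     connection_along M M (\<lambda>p. p) nab \<and>
     (\<forall>X Y. vector_field M X \<longrightarrow> vector_field M Y \<longrightarrow>
        (\<forall>p\<in>M. nab p (X p) Y - nab p (Y p) X = lie_bracket M X Y p)) \<and>
     (\<forall>Y Z. vector_field M Y \<longrightarrow> vector_field M Z \<longrightarrow>
        (\<forall>p\<in>M. \<forall>v\<in>tangent_space M p.
           differential M (\<lambda>x. g x (Y x) (Z x)) p v =
             g p (nab p v Y) (Z p) + g p (Y p) (nab p v Z)))"

text \<open>The covariant derivative along a smooth map \<open>f\<close> from \<open>S\<close> to \<open>M\<close> induced by the connection
  \<open>nab\<close> of \<open>M\<close>: the connection on the pullback bundle that satisfies the chain rule.\<close>

definition pullback_connection ::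
  "'a::euclidean_space set \<Rightarrow> 'b::euclidean_space set \<Rightarrow> ('a \<Rightarrow> 'b) \<Rightarrow>
   ('b \<Rightarrow> 'b \<Rightarrow> ('b \<Rightarrow> 'b) \<Rightarrow> 'b) \<Rightarrow> ('a \<Rightarrow> 'a \<Rightarrow> ('a \<Rightarrow> 'b) \<Rightarrow> 'b) \<Rightarrow> bool" where
  "pullback_connection S M f nab nabf \<longleftrightarrow>
     connection_along S M f nabf \<and>
     (\<forall>Y. vector_field M Y \<longrightarrow>
        (\<forall>p\<in>S. \<forall>v\<in>tangent_space S p. nabf p v (\<lambda>x. Y (f x)) = nab (f p) (differential S f p v) Y))"

text \<open>Harmonicity of a map on an open subset of the complex plane, i.e. of a map on a Riemann surface
  expressed in a holomorphic coordinate \<open>z = x + \<i> y\<close>. For any metric in the conformal class the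
  tension field is a positive multiple of \<open>\<nabla>\<^sub>x (\<partial>\<^sub>x f) + \<nabla>\<^sub>y (\<partial>\<^sub>y f)\<close>.\<close>

definition harmonic_on_curve ::
  "complex set \<Rightarrow> 'b::euclidean_space set \<Rightarrow> ('b \<Rightarrow> 'b \<Rightarrow> ('b \<Rightarrow> 'b) \<Rightarrow> 'b) \<Rightarrow> (complex \<Rightarrow> 'b) \<Rightarrow> bool" where
  "harmonic_on_curve \<Omega> M nab f \<longleftrightarrow>
     smooth_on \<Omega> f \<and> f ` \<Omega> \<subseteq> M \<and>
     (\<forall>nabf. pullback_connection \<Omega> M f nab nabf \<longrightarrow>
        (\<forall>z\<in>\<Omega>. nabf z 1 (\<lambda>w. differential \<Omega> f w 1) + nabf z \<i> (\<lambda>w. differential \<Omega> f w \<i>) = 0))"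


section \<open>Polarized Hodge structures\<close>

text \<open>The lattice is \<open>\<int>\<^sup>m\<close>, and the bilinear form is given by its integral Gram matrix \<open>Q\<close>; \<open>bil Q\<close>
  is its extension to integral, real and complex vectors.\<close>

definition bil :: "int^'m^'m \<Rightarrow> 'a::comm_ring_1^'m \<Rightarrow> 'a^'m \<Rightarrow> 'a" where
  "bil Q x y = (\<Sum>i\<in>UNIV. \<Sum>j\<in>UNIV. of_int (Q $ i $ j) * x $ i * y $ j)"

definition nondegenerate :: "int^'m^'m \<Rightarrow> bool" where
  "nondegenerate Q \<longleftrightarrow> (\<forall>x::int^'m. (\<forall>y::int^'m. bil Q x y = 0) \<longrightarrow> x = 0)"

definition conj_vec :: "complex^'m \<Rightarrow> complex^'m" where
  "conj_vec v = (\<chi> i. cnj (v $ i))"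

text \<open>\<open>Hd r\<close> plays the role of \<open>H\<^sup>r\<^sup>,\<^sup>n\<^sup>-\<^sup>r\<close> and \<open>h r\<close> that of its dimension, for \<open>r \<le> n\<close>.\<close>

definition polarized_hodge_structure ::
  "nat \<Rightarrow> int^'m^'m \<Rightarrow> (nat \<Rightarrow> nat) \<Rightarrow> (nat \<Rightarrow> (complex^'m) set) \<Rightarrow> bool" where
  "polarized_hodge_structure n Q h Hd \<longleftrightarrow>
     (\<forall>r\<le>n. vec.subspace (Hd r) \<and> vec.dim (Hd r) = h r \<and> Hd r = conj_vec ` Hd (n - r)) \<and>
     (\<forall>v. \<exists>!w. (\<forall>r\<le>n. w r \<in> Hd r) \<and> (\<forall>r>n. w r = 0) \<and> v = (\<Sum>r\<le>n. w r)) \<and>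
     (\<forall>r\<le>n. \<forall>r'\<le>n. r' \<noteq> n - r \<longrightarrow> (\<forall>x\<in>Hd r. \<forall>y\<in>Hd r'. bil Q x y = 0)) \<and>
     (\<forall>r\<le>n. \<forall>x\<in>Hd r. x \<noteq> 0 \<longrightarrow>
        \<i> powi (int r - int (n - r)) * bil Q x (conj_vec x) \<in> \<real> \<and>
        Re (\<i> powi (int r - int (n - r)) * bil Q x (conj_vec x)) > 0)"

text \<open>A decomposition is encoded by the endomorphism \<open>E\<close> of \<open>H\<close> that acts on \<open>H\<^sup>r\<^sup>,\<^sup>n\<^sup>-\<^sup>r\<close> as
  multiplication by \<open>r\<close>. This is a bijection between direct sum decompositions and such
  endomorphisms, and the projections onto the summands are polynomials in \<open>E\<close>; hence the set of
  these \<open>E\<close> carries the usual smooth structure of the classifying space.\<close>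

definition hcomp :: "complex^'m^'m \<Rightarrow> nat \<Rightarrow> (complex^'m) set" where
  "hcomp E r = {v. E *v v = of_nat r *s v}"

definition hodge_decompositions ::
  "nat \<Rightarrow> int^'m^'m \<Rightarrow> (nat \<Rightarrow> nat) \<Rightarrow> (complex^'m^'m) set" where
  "hodge_decompositions n Q h = {E. polarized_hodge_structure n Q h (hcomp E)}"

definition hsum :: "complex^'m^'m \<Rightarrow> nat set \<Rightarrow> (complex^'m) set" where
  "hsum E I = {\<Sum>r\<in>I. w r |w. \<forall>r\<in>I. w r \<in> hcomp E r}"

definition hfil :: "nat \<Rightarrow> complex^'m^'m \<Rightarrow> nat \<Rightarrow> (complex^'m) set" where
  "hfil n E r = hsum E {r..n}"

definition hplus :: "nat \<Rightarrow> complex^'m^'m \<Rightarrow> (complex^'m) set" where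
  "hplus n E = hsum E {r. r \<le> n \<and> even (n - r)}"

definition hminus :: "nat \<Rightarrow> complex^'m^'m \<Rightarrow> (complex^'m) set" where
  "hminus n E = hsum E {r. r \<le> n \<and> odd (n - r)}"


section \<open>Complex structure and horizontal bundle of the classifying space\<close>

text \<open>For a tangent vector \<open>A\<close> of \<open>D\<close> at \<open>E\<close> and \<open>v \<in> F\<^sup>r\<close>, this is the image of \<open>v\<close> under the
  component of \<open>A\<close> in \<open>Hom(F\<^sup>r, H/F\<^sup>r)\<close>, as a coset of \<open>F\<^sup>r\<close> in \<open>H\<close>: it consists of all \<open>w'(0)\<close>
  where \<open>w(t) \<in> F\<^sup>r(c(t))\<close>, \<open>w(0) = v\<close>, and \<open>c\<close> is a curve in \<open>D\<close> with velocity \<open>A\<close> at \<open>E\<close>.\<close>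

definition hom_component ::
  "nat \<Rightarrow> (complex^'m^'m) set \<Rightarrow> complex^'m^'m \<Rightarrow> complex^'m^'m \<Rightarrow> nat \<Rightarrow> complex^'m \<Rightarrow>
   (complex^'m) set" where
  "hom_component n D E A r v =
     {u. \<exists>c w. curve_through D E A c \<and> (\<forall>t. w t \<in> hfil n (c t) r) \<and> w 0 = v \<and>
               (w has_vector_derivative u) (at 0)}"

text \<open>Multiplication by \<open>\<i>\<close> on tangent vectors, seen as elements of the sum of the \<open>Hom(F\<^sup>r, H/F\<^sup>r)\<close>.\<close>

definition hodge_J ::
  "nat \<Rightarrow> (complex^'m^'m) set \<Rightarrow> complex^'m^'m \<Rightarrow> complex^'m^'m \<Rightarrow> complex^'m^'m" where
  "hodge_J n D E A =
     (THE B. B \<in> tangent_space D E \<and>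
        (\<forall>r\<le>n. \<forall>v\<in>hfil n E r.
           hom_component n D E B r v = (\<lambda>u. \<i> *s u) ` hom_component n D E A r v))"

definition horizontal_space ::
  "nat \<Rightarrow> (complex^'m^'m) set \<Rightarrow> complex^'m^'m \<Rightarrow> (complex^'m^'m) set" where
  "horizontal_space n D E =
     {A \<in> tangent_space D E. \<forall>r\<in>{1..n}. \<forall>v\<in>hfil n E r.
        hom_component n D E A r v \<subseteq> hfil n E (r - 1)}"

text \<open>\<open>S\<close> is a relatively open subset of a complex vector space with multiplication by \<open>\<i>\<close> given
  by \<open>I\<close>; holomorphic means smooth with complex linear differential.\<close>

definition holomorphic_into ::
  "nat \<Rightarrow> (complex^'m^'m) set \<Rightarrow> ('a::euclidean_space \<Rightarrow> 'a) \<Rightarrow> 'a set \<Rightarrow> ('a \<Rightarrow> complex^'m^'m) \<Rightarrow> bool" where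
  "holomorphic_into n D I S f \<longleftrightarrow>
     smooth_on S f \<and> f ` S \<subseteq> D \<and>
     (\<forall>z\<in>S. \<forall>v\<in>tangent_space S z.
        differential S f z (I v) = hodge_J n D (f z) (differential S f z v))"

definition mat_i :: "complex^'m^'m \<Rightarrow> complex^'m^'m" where
  "mat_i A = map_matrix ((*) \<i>) A"

text \<open>Complex submanifolds of \<open>D\<close>, by local holomorphic parametrizations with smooth inverse. The
  parameter domain is a relatively open subset of a complex subspace \<open>L\<close> of the space of all
  matrices; as \<open>D\<close> has complex dimension at most that of the latter, no dimension (in particular
  not 0) is excluded.\<close>

definition complex_submanifold ::
  "nat \<Rightarrow> (complex^'m^'m) set \<Rightarrow> (complex^'m^'m) set \<Rightarrow> bool" where
  "complex_submanifold n D U \<longleftrightarrow>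
     U \<subseteq> D \<and>
     (\<forall>p\<in>U. \<exists>W (L :: (complex^'m^'m) set) \<Omega> \<phi> \<psi>.
        open W \<and> p \<in> W \<and> subspace L \<and> mat_i ` L \<subseteq> L \<and> openin (top_of_set L) \<Omega> \<and>
        \<phi> ` \<Omega> = U \<inter> W \<and> (\<forall>z\<in>\<Omega>. \<psi> (\<phi> z) = z) \<and> smooth_on (U \<inter> W) \<psi> \<and>
        holomorphic_into n D mat_i \<Omega> \<phi>)"

definition horizontal_slice ::
  "nat \<Rightarrow> (complex^'m^'m) set \<Rightarrow> (complex^'m^'m) set \<Rightarrow> bool" where
  "horizontal_slice n D U \<longleftrightarrow>
     complex_submanifold n D U \<and> (\<forall>p\<in>U. tangent_space U p \<subseteq> horizontal_space n D p)"


section \<open>The group, its Lie algebra, and the symmetric space\<close>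

definition cplx_mat :: "real^'m^'m \<Rightarrow> complex^'m^'m" where
  "cplx_mat g = map_matrix complex_of_real g"

definition aut_real :: "int^'m^'m \<Rightarrow> (real^'m^'m) set" where
  "aut_real Q = {g. invertible g \<and> (\<forall>x y. bil Q (g *v x) (g *v y) = bil Q x y)}"

definition subgroup_of :: "(real^'m^'m) set \<Rightarrow> (real^'m^'m) set \<Rightarrow> bool" where
  "subgroup_of L G \<longleftrightarrow>
     L \<subseteq> G \<and> mat 1 \<in> L \<and> (\<forall>a\<in>L. \<forall>b\<in>L. a ** b \<in> L) \<and> (\<forall>a\<in>L. matrix_inv a \<in> L)"

definition maximal_connected_compact :: "(real^'m^'m) set \<Rightarrow> (real^'m^'m) set \<Rightarrow> bool" where
  "maximal_connected_compact K G \<longleftrightarrow>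
     subgroup_of K G \<and> connected K \<and> compact K \<and>
     (\<forall>L. subgroup_of L G \<and> connected L \<and> compact L \<and> K \<subseteq> L \<longrightarrow> L = K)"

text \<open>The action on endomorphisms of \<open>H\<close> by conjugation; on the endomorphisms encoding
  decompositions it is the action of \<open>G\<close> on decompositions, as \<open>hcomp (act g E) r = g (hcomp E r)\<close>.
  The classifying space \<open>D = G/V\<close> is the orbit of the base point. For \<open>G = aut_real Q\<close> this is all of
  \<open>hodge_decompositions n Q h\<close>; for the identity component, which is needed to have \<open>V\<close> and \<open>K\<close>
  connected if \<open>n\<close> is even, it is the component of the base point.\<close>

definition act :: "real^'m^'m \<Rightarrow> complex^'m^'m \<Rightarrow> complex^'m^'m" where
  "act g E = cplx_mat g ** E ** cplx_mat (matrix_inv g)"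

definition lie_algebra :: "(real^'m^'m) set \<Rightarrow> (real^'m^'m) set" where
  "lie_algebra G = tangent_space G (mat 1)"

definition commutator :: "'a::ring_1^'m^'m \<Rightarrow> 'a^'m^'m \<Rightarrow> 'a^'m^'m" where
  "commutator A B = A ** B - B ** A"

definition trace_on :: "'a::real_vector set \<Rightarrow> ('a \<Rightarrow> 'a) \<Rightarrow> real" where
  "trace_on S f =
     (let B = (SOME B. independent B \<and> span B = S) in \<Sum>b\<in>B. representation B (f b) b)"

definition killing_form :: "(real^'m^'m) set \<Rightarrow> real^'m^'m \<Rightarrow> real^'m^'m \<Rightarrow> real" where
  "killing_form \<gg> A B = trace_on \<gg> (\<lambda>Z. commutator A (commutator B Z))"

definition semisimple :: "(real^'m^'m) set \<Rightarrow> bool" where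
  "semisimple \<gg> \<longleftrightarrow> (\<forall>A\<in>\<gg>. (\<forall>B\<in>\<gg>. killing_form \<gg> A B = 0) \<longrightarrow> A = 0)"

definition lie_ideal :: "(real^'m^'m) set \<Rightarrow> (real^'m^'m) set \<Rightarrow> bool" where
  "lie_ideal \<aa> \<gg> \<longleftrightarrow> subspace \<aa> \<and> \<aa> \<subseteq> \<gg> \<and> (\<forall>A\<in>\<gg>. \<forall>B\<in>\<aa>. commutator A B \<in> \<aa>)"

text \<open>Compact factors of a semisimple Lie algebra are the nonzero ideals on which the Killing form
  is negative definite.\<close>

definition no_compact_factors :: "(real^'m^'m) set \<Rightarrow> bool" where
  "no_compact_factors \<gg> \<longleftrightarrow>
     \<not> (\<exists>\<aa>. lie_ideal \<aa> \<gg> \<and> \<aa> \<noteq> {0} \<and> (\<forall>A\<in>\<aa>. A \<noteq> 0 \<longrightarrow> killing_form \<gg> A A < 0))"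

text \<open>The complement of \<open>Lie(K)\<close> in the Cartan decomposition.\<close>

definition cartan_p :: "(real^'m^'m) set \<Rightarrow> (real^'m^'m) set \<Rightarrow> (real^'m^'m) set" where
  "cartan_p G K =
     {A \<in> lie_algebra G. \<forall>B\<in>lie_algebra K. killing_form (lie_algebra G) A B = 0}"

text \<open>The projection \<open>\<pi>\<close> from \<open>D\<close> to the symmetric space. The subspace \<open>H\<^sup>+\<close> is encoded by the
  projector onto \<open>H\<^sup>+\<close> along the sum \<open>H\<^sup>-\<close> of the other summands. Here \<open>H\<^sup>-\<close> is determined by
  \<open>H\<^sup>+\<close> (it is the \<open>Q\<close>-orthogonal complement for even \<open>n\<close>, the complex conjugate for odd \<open>n\<close>), so
  that the stabilizer of the projector at the base point is \<open>K\<close>, its orbit is \<open>G/K\<close>, and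
  \<open>hodge_proj n (act g E) = act g (hodge_proj n E)\<close> makes this the map \<open>a V \<mapsto> a K\<close>.\<close>

definition hodge_proj :: "nat \<Rightarrow> complex^'m^'m \<Rightarrow> complex^'m^'m" where
  "hodge_proj n E =
     (THE P. (\<forall>v\<in>hplus n E. P *v v = v) \<and> (\<forall>v\<in>hminus n E. P *v v = 0))"

text \<open>The \<open>G\<close>-invariant metric on the orbit \<open>M\<close> of \<open>x0\<close>, given at \<open>x0\<close> by a positive multiple of the
  Killing form. The element \<open>A\<close> of the Lie algebra induces the tangent vector
  \<open>[A, x0]\<close> at \<open>x0\<close>, the velocity at \<open>t = 0\<close> of \<open>exp(tA) x0 exp(-tA)\<close>.\<close>

definition invariant_metric ::
  "(real^'m^'m) set \<Rightarrow> (real^'m^'m) set \<Rightarrow> (complex^'m^'m) set \<Rightarrow> complex^'m^'m \<Rightarrow>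
   (complex^'m^'m \<Rightarrow> complex^'m^'m \<Rightarrow> complex^'m^'m \<Rightarrow> real) \<Rightarrow> bool" where
  "invariant_metric G K M x0 met \<longleftrightarrow>
     (\<exists>c>0. \<forall>A\<in>cartan_p G K. \<forall>B\<in>cartan_p G K.
        met x0 (commutator (cplx_mat A) x0) (commutator (cplx_mat B) x0) =
          c * killing_form (lie_algebra G) A B) \<and>
     (\<forall>g\<in>G. \<forall>p\<in>M. \<forall>X\<in>tangent_space M p. \<forall>Y\<in>tangent_space M p.
        met (act g p) (act g X) (act g Y) = met p X Y)"

end

theory Submission
  imports Defs
begin

text \<open>Let \<open>P\<close> be the projector encoding \<open>\<pi>(E)\<close>. As \<open>D\<^sub>1\<close> is a symmetric space of idempotents, its
  Levi-Civita connection is the flat connection of the matrix space followed by the projection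
  \<open>Z \<mapsto> [[Z, P], P]\<close> onto the tangent space at \<open>P\<close>. A horizontal tangent vector \<open>X\<close> at \<open>E\<close> shifts the
  Hodge grading by \<open>\<plusminus> 1\<close>; hence \<open>J X = \<i> [X, E]\<close> and \<open>d\<pi>(X) = [[X, E], P] = -\<i> [J X, P]\<close>, which
  gives injectivity. Differentiating \<open>d\<pi>(X) = -\<i> [J X, P]\<close> along \<open>X\<close> and \<open>d\<pi>(J X) = \<i> [X, P]\<close> along
  \<open>J X\<close>, the terms \<open>[J X, [J X, P]]\<close> and \<open>[X, [X, P]]\<close> commute with \<open>P\<close> and are killed by the
  projection, and what remains is \<open>-\<i> [Z, P] = - d\<pi>(J Z)\<close> with \<open>Z = [X, J X]\<close>.\<close>

section \<open>Calculus on subsets of Euclidean spaces\<close>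

text \<open>The hypotheses on \<open>levi_civita\<close> and \<open>pullback_connection\<close>
  speak only of fields defined on the whole space, so the computations need global frames. The
  fields \<open>x \<mapsto> [A, x]\<close> with \<open>A\<close> in the Lie algebra are global and
  span every tangent space of \<open>D1\<close>; sections along a map are global combinations of
  them. The metric at \<open>P\<close> is the Killing form transported by
  \<open>X \<mapsto> [X, P]\<close>, and the projected flat connection respects it because diagonal
  and off-diagonal elements are Killing-orthogonal. \<open>J\<close>, the Hom components and d pi
  are given by descriptions over curves and are computed in blocks of the spectral projections of
  \<open>E\<close>. If \<open>E\<close> moves with velocity \<open>A\<close>, then w(E) moves with
  block (s, t) equal to that of \<open>A\<close> times (w s - w t) / (s - t), for s different from
  t. For adjacent degrees s - t is 1 or -1, so dividing by it is multiplying by it: this turns all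
  formulas for horizontal vectors into commutators with \<open>E\<close>. Reality and compatibility
  with the form are tracked by the two signs of \<open>has_type\<close>; subtracting the centres n/2
  and 1/2 gives \<open>E\<close> and \<open>P\<close> definite signs.\<close>

lemma Ck_on_cong:
  assumes "open W" "\<And>x. x \<in> W \<Longrightarrow> f x = g x" "Ck_on k W f"
  shows "Ck_on k W g"
  using assms
proof (cases k)
  case 0
  then show ?thesis using assms by (auto cong: continuous_on_cong)
next
  case (Suc j)
  then obtain f' where f': "\<forall>x\<in>W. (f has_derivative f' x) (at x)" "\<forall>v. Ck_on j W (\<lambda>x. f' x v)"
    using assms by auto
  have "\<forall>x\<in>W. (g has_derivative f' x) (at x)"
    using f'(1) assms(1,2) has_derivative_transform_within_open by blast
  then show ?thesis using f'(2) Suc by auto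
qed

lemma Ck_on_subset: "Ck_on k W f \<Longrightarrow> V \<subseteq> W \<Longrightarrow> Ck_on k V f"
proof (induction k arbitrary: f)
  case 0
  then show ?case by (auto intro: continuous_on_subset)
next
  case (Suc k)
  then show ?case by simp (meson subsetD)
qed

lemma Ck_on_Suc_imp: "Ck_on (Suc k) W f \<Longrightarrow> Ck_on k W f"
proof (induction k arbitrary: f)
  case 0
  then show ?case
    by (auto intro!: continuous_at_imp_continuous_on dest: has_derivative_continuous)
next
  case (Suc k)
  then show ?case by (metis Ck_on.simps(2))
qed

lemma Ck_on_linear_comp:
  assumes "bounded_linear h"
  shows "Ck_on k W f \<Longrightarrow> Ck_on k W (\<lambda>x. h (f x))"
proof (induction k arbitrary: f)
  case 0
  then show ?case using assms by (auto intro: bounded_linear.continuous_on)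
next
  case (Suc k)
  then obtain f' where "\<forall>x\<in>W. (f has_derivative f' x) (at x)" "\<forall>v. Ck_on k W (\<lambda>x. f' x v)" by auto
  then show ?case
    using Suc.IH by (auto intro!: bounded_linear.has_derivative[OF assms] exI[of _ "\<lambda>x v. h (f' x v)"])
qed

lemma Ck_on_const: "Ck_on k W (\<lambda>x. c)"
  by (induction k arbitrary: c) (auto intro!: exI[of _ "\<lambda>x v. 0"])

lemma Ck_on_id: "Ck_on k W (\<lambda>x. x)"
  by (cases k) (auto intro!: exI[of _ "\<lambda>x v. v"] Ck_on_const)

lemma Ck_on_add: "Ck_on k W f \<Longrightarrow> Ck_on k W g \<Longrightarrow> Ck_on k W (\<lambda>x. f x + g x)"
proof (induction k arbitrary: f g)
  case 0
  then show ?case by (auto intro: continuous_on_add)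
next
  case (Suc k)
  then obtain f' g' where "\<forall>x\<in>W. (f has_derivative f' x) (at x)" "\<forall>v. Ck_on k W (\<lambda>x. f' x v)"
    "\<forall>x\<in>W. (g has_derivative g' x) (at x)" "\<forall>v. Ck_on k W (\<lambda>x. g' x v)" by auto
  then show ?case
    using Suc.IH by (auto intro!: exI[of _ "\<lambda>x v. f' x v + g' x v"] has_derivative_add)
qed

lemma Ck_on_bilinear:
  assumes "bounded_bilinear h"
  shows "Ck_on k W f \<Longrightarrow> Ck_on k W g \<Longrightarrow> Ck_on k W (\<lambda>x. h (f x) (g x))"
proof (induction k arbitrary: f g)
  case 0
  then show ?case using assms by (auto intro: bounded_bilinear.continuous_on)
next
  case (Suc k)
  then obtain f' g' where *: "\<forall>x\<in>W. (f has_derivative f' x) (at x)" "\<forall>v. Ck_on k W (\<lambda>x. f' x v)"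
    "\<forall>x\<in>W. (g has_derivative g' x) (at x)" "\<forall>v. Ck_on k W (\<lambda>x. g' x v)" by auto
  \<comment> \<open>The product rule keeps one factor undifferentiated, so the induction also needs
    the factors themselves at order \<open>k\<close>.\<close>
  have "Ck_on k W f" "Ck_on k W g" using Suc.prems Ck_on_Suc_imp by blast+
  with * show ?case
    using Suc.IH
    by (auto intro!: bounded_bilinear.FDERIV[OF assms] exI[of _ "\<lambda>x v. h (f x) (g' x v) + h (f' x v) (g x)"] Ck_on_add)
qed

text \<open>\<open>Ck_on\<close> may supply a different derivative for every order. Derivatives at
  points of the open set \<open>W\<close> are unique, so all of them agree there with the Frechet
  derivative, and one \<open>F'\<close> serves every order.\<close>

lemma Ck_on_derivative:
  fixes F :: "'a::euclidean_space \<Rightarrow> 'b::euclidean_space"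
  assumes "open W" "\<And>k. Ck_on k W F"
  obtains F' where "\<And>x. x \<in> W \<Longrightarrow> (F has_derivative F' x) (at x)" "\<And>k v. Ck_on k W (\<lambda>x. F' x v)"
proof -
  define F' where "F' x = frechet_derivative F (at x)" for x
  have "(F has_derivative F' x) (at x)" if "x \<in> W" for x
    using assms(2)[of 1] that frechet_derivative_works unfolding F'_def differentiable_def by auto
  moreover have "Ck_on k W (\<lambda>x. F' x v)" for k v
  proof -
    from assms(2)[of "Suc k"] obtain G' where G': "\<forall>x\<in>W. (F has_derivative G' x) (at x)"
      "\<forall>v. Ck_on k W (\<lambda>x. G' x v)" by auto
    have "G' x = F' x" if "x \<in> W" for x
      using G'(1) that frechet_derivative_at by (auto simp: F'_def)
    then show ?thesis using Ck_on_cong[OF assms(1) _ G'(2)[rule_format]] by simp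
  qed
  ultimately show thesis using that by blast
qed

section \<open>Smooth maps on arbitrary subsets and their differentials\<close>

lemma smooth_on_bilinear:
  assumes "bounded_bilinear h" "smooth_on S f" "smooth_on S g"
  shows "smooth_on S (\<lambda>x. h (f x) (g x))"
  unfolding smooth_on_def
proof
  fix p assume "p \<in> S"
  then obtain W F V G where "open W" "p \<in> W" "\<forall>k. Ck_on k W F" "\<forall>x\<in>S \<inter> W. f x = F x"
     "open V" "p \<in> V" "\<forall>k. Ck_on k V G" "\<forall>x\<in>S \<inter> V. g x = G x"
    using assms(2,3) unfolding smooth_on_def by meson
  then show "\<exists>W F. open W \<and> p \<in> W \<and> (\<forall>k. Ck_on k W F) \<and> (\<forall>x\<in>S \<inter> W. h (f x) (g x) = F x)"
    by (intro exI[of _ "W \<inter> V"] exI[of _ "\<lambda>x. h (F x) (G x)"])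
      (auto intro!: Ck_on_bilinear[OF assms(1)] intro: Ck_on_subset)
qed

lemma smooth_on_linear_comp:
  assumes "bounded_linear h" "smooth_on S f"
  shows "smooth_on S (\<lambda>x. h (f x))"
  using assms(2) Ck_on_linear_comp[OF assms(1)] unfolding smooth_on_def by metis

lemma smooth_on_const: "smooth_on S (\<lambda>x. c)"
  unfolding smooth_on_def using Ck_on_const open_UNIV by blast

lemma smooth_on_id: "smooth_on S (\<lambda>x. x)"
  unfolding smooth_on_def using Ck_on_id open_UNIV by blast

lemma smooth_on_add:
  assumes "smooth_on S f" "smooth_on S g"
  shows "smooth_on S (\<lambda>x. f x + g x)"
  unfolding smooth_on_def
proof
  fix p assume "p \<in> S"
  then obtain W F V G where "open W" "p \<in> W" "\<forall>k. Ck_on k W F" "\<forall>x\<in>S \<inter> W. f x = F x"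
     "open V" "p \<in> V" "\<forall>k. Ck_on k V G" "\<forall>x\<in>S \<inter> V. g x = G x"
    using assms unfolding smooth_on_def by meson
  then show "\<exists>W F. open W \<and> p \<in> W \<and> (\<forall>k. Ck_on k W F) \<and> (\<forall>x\<in>S \<inter> W. f x + g x = F x)"
    by (intro exI[of _ "W \<inter> V"] exI[of _ "\<lambda>x. F x + G x"])
      (auto intro!: Ck_on_add intro: Ck_on_subset)
qed

lemma smooth_on_diff:
  "smooth_on S f \<Longrightarrow> smooth_on S g \<Longrightarrow> smooth_on S (\<lambda>x. f x - g x)"
  using smooth_on_add[of S f "\<lambda>x. - g x"]
    smooth_on_linear_comp[OF bounded_linear_minus[OF bounded_linear_ident], of S g] by simp

lemma smooth_on_sum: "(\<And>i. i \<in> I \<Longrightarrow> smooth_on S (f i)) \<Longrightarrow> smooth_on S (\<lambda>x. \<Sum>i\<in>I. f i x)"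
  by (induction I rule: infinite_finite_induct) (auto intro: smooth_on_const smooth_on_add)

lemma smooth_on_cong: "(\<And>x. x \<in> S \<Longrightarrow> f x = g x) \<Longrightarrow> smooth_on S f \<Longrightarrow> smooth_on S g"
  unfolding smooth_on_def by (metis IntD1)

text \<open>\<open>differential\<close> is a definite description over all curves, which pins down a
  value only if some curve has velocity \<open>v\<close>. Membership in \<open>tangent_space\<close>
  provides one, and uniqueness of derivatives does the rest.\<close>

lemma differential_eqI:
  assumes "v \<in> tangent_space S p"
    "\<And>c. curve_through S p v c \<Longrightarrow> ((\<lambda>t. f (c t)) has_vector_derivative a) (at 0)"
  shows "differential S f p v = a"
  unfolding differential_def
proof (rule the_equality)
  show "\<forall>c. curve_through S p v c \<longrightarrow> ((\<lambda>t. f (c t)) has_vector_derivative a) (at 0)"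
    using assms(2) by blast
  fix b assume b: "\<forall>c. curve_through S p v c \<longrightarrow> ((\<lambda>t. f (c t)) has_vector_derivative b) (at 0)"
  obtain c where "curve_through S p v c" using assms(1) by (auto simp: tangent_space_def)
  then show "b = a" using b assms(2) vector_derivative_unique_at by blast
qed

lemma curve_eventually_in:
  assumes "(c has_vector_derivative v) (at (0::real))" "open N" "c 0 \<in> N"
  shows "\<forall>\<^sub>F t in at 0. c t \<in> N"
proof -
  have "isCont c 0" using assms(1) has_vector_derivative_continuous by blast
  then show ?thesis using assms(2,3) topological_tendstoD unfolding isCont_def by blast
qed

lemma has_vector_derivative_eventually:
  assumes "(f has_vector_derivative v) (at x)" "\<forall>\<^sub>F t in at x. f t = g t" "f x = g x"
  shows "(g has_vector_derivative v) (at x)"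
  using has_derivative_transform_eventually[OF assms(1)[unfolded has_vector_derivative_def] assms(2,3)]
  by (simp add: has_vector_derivative_def)

lemma vector_derivative_compose:
  assumes "(c has_vector_derivative v) (at t)" "(F has_derivative F') (at (c t))"
  shows "((\<lambda>t. F (c t)) has_vector_derivative F' v) (at t)"
  using vector_derivative_diff_chain_within[of c v t UNIV F F'] assms has_derivative_at_withinI
  by (fastforce simp: o_def)

lemma smooth_on_local_extension:
  assumes "smooth_on S f" "p \<in> S"
  obtains W F F' where "open W" "p \<in> W" "\<And>x. x \<in> S \<inter> W \<Longrightarrow> f x = F x"
    "\<And>x. x \<in> W \<Longrightarrow> (F has_derivative F' x) (at x)" "\<And>k v. Ck_on k W (\<lambda>x. F' x v)"
    "continuous_on W F"
proof -
  obtain W F where W: "open W" "p \<in> W" "\<forall>k. Ck_on k W F" "\<forall>x\<in>S \<inter> W. f x = F x"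
    using assms unfolding smooth_on_def by meson
  obtain F' where "\<And>x. x \<in> W \<Longrightarrow> (F has_derivative F' x) (at x)" "\<And>k v. Ck_on k W (\<lambda>x. F' x v)"
    using Ck_on_derivative[OF W(1) W(3)[rule_format]] by metis
  moreover have "continuous_on W F" using W(3)[rule_format, of 0] by simp
  ultimately show thesis using that[of W F F'] W by blast
qed

lemma differential_local_extension:
  assumes "open W" "p \<in> S" "p \<in> W" "\<And>x. x \<in> S \<inter> W \<Longrightarrow> f x = F x" "(F has_derivative F') (at p)"
    "curve_through S p v c"
  shows "((\<lambda>t. f (c t)) has_vector_derivative F' v) (at 0)"
proof -
  have c: "c 0 = p" "\<And>t. c t \<in> S" "(c has_vector_derivative v) (at 0)"
    using assms(6) by (auto simp: curve_through_def)
  have "((\<lambda>t. F (c t)) has_vector_derivative F' v) (at 0)"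
    using vector_derivative_compose[OF c(3)] assms(5) c(1) by simp
  moreover have "\<forall>\<^sub>F t in at 0. c t \<in> W"
    using curve_eventually_in[OF c(3) assms(1)] assms(3) c(1) by simp
  then have "\<forall>\<^sub>F t in at 0. F (c t) = f (c t)"
    by eventually_elim (use assms(4) c(2) in auto)
  moreover have "F (c 0) = f (c 0)" using assms(2-4) c(1) by auto
  ultimately show ?thesis by (rule has_vector_derivative_eventually)
qed

text \<open>The derivative of a local extension, applied to \<open>v\<close>, gives the same value
  for every curve with velocity \<open>v\<close>; hence the description in
  \<open>differential\<close> is satisfied.\<close>

lemma differential_curve:
  assumes f: "smooth_on S f" and c: "curve_through S p v c"
  shows "((\<lambda>t. f (c t)) has_vector_derivative differential S f p v) (at 0)"
proof -
  have p: "p \<in> S" using c by (auto simp: curve_through_def)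
  obtain W F F' where W: "open W" "p \<in> W" "\<And>x. x \<in> S \<inter> W \<Longrightarrow> f x = F x"
    "\<And>x. x \<in> W \<Longrightarrow> (F has_derivative F' x) (at x)"
    using smooth_on_local_extension[OF f p] by metis
  have der: "((\<lambda>t. f (d t)) has_vector_derivative F' p w) (at 0)" if "curve_through S p w d" for w d
    by (rule differential_local_extension[OF W(1) p W(2) _ W(4)[OF W(2)] that]) (rule W(3))
  have "differential S f p v = F' p v"
    using c der by (intro differential_eqI) (auto simp: tangent_space_def)
  then show ?thesis using der[OF c] by simp
qed

lemma differential_tangent:
  assumes "smooth_on S f" "f ` S \<subseteq> M" "v \<in> tangent_space S p"
  shows "differential S f p v \<in> tangent_space M (f p)"
proof -
  obtain c where c: "curve_through S p v c" using assms(3) by (auto simp: tangent_space_def)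
  have "curve_through M (f p) (differential S f p v) (\<lambda>t. f (c t))"
    using c assms(2) differential_curve[OF assms(1) c] by (auto simp: curve_through_def)
  then show ?thesis by (auto simp: tangent_space_def)
qed

text \<open>\<open>curve_through\<close> asks for membership at every parameter. Replacing
  \<open>c t\<close> by \<open>p\<close> wherever the curve has left \<open>S\<close> keeps the
  derivative at 0, the only place where differentiability is required.\<close>

lemma tangent_spaceI:
  assumes "(c has_vector_derivative v) (at 0)" "c 0 = p" "p \<in> S" "\<forall>\<^sub>F t in at 0. c t \<in> S"
  shows "v \<in> tangent_space S p"
proof -
  define d where "d t = (if c t \<in> S then c t else p)" for t
  have "\<forall>\<^sub>F t in at 0. c t = d t"
    using assms(4) by eventually_elim (simp add: d_def)
  then have "(d has_vector_derivative v) (at 0)"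
    using assms(1,2,3) unfolding has_vector_derivative_def
    by (intro has_derivative_transform_eventually[of c _ 0 UNIV d]) (auto simp: d_def)
  then have "curve_through S p v d"
    using assms(2,3) by (auto simp: curve_through_def d_def)
  then show ?thesis by (auto simp: tangent_space_def)
qed

lemma tangent_space_open:
  assumes "open S" "p \<in> S"
  shows "tangent_space S p = UNIV"
proof -
  have "v \<in> tangent_space S p" for v
  proof (rule tangent_spaceI[of "\<lambda>t. p + t *\<^sub>R v"])
    show "((\<lambda>t. p + t *\<^sub>R v) has_vector_derivative v) (at 0)"
      by (auto intro!: derivative_eq_intros)
    have "(\<lambda>t. p + t *\<^sub>R v) \<midarrow>0\<rightarrow> p + 0 *\<^sub>R v" by (intro tendsto_intros)
    then show "\<forall>\<^sub>F t in at 0. p + t *\<^sub>R v \<in> S" using assms topological_tendstoD by fastforce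
  qed (use assms in auto)
  then show ?thesis by auto
qed

text \<open>The second difference of \<open>F\<close> over a small parallelogram is symmetric in
  \<open>u\<close> and \<open>v\<close>. Two mean value steps identify it with
  \<open>h\<^sup>2\<close> times a mixed derivative at a nearby point, in either order, and
  continuity at \<open>p\<close> lets the parallelogram shrink.\<close>

lemma second_derivative_symmetric_real:
  fixes F :: "'a::euclidean_space \<Rightarrow> real"
  assumes W: "open W" "p \<in> W"
    and F': "\<And>x. x \<in> W \<Longrightarrow> (F has_derivative F' x) (at x)"
    and F'': "\<And>v x. x \<in> W \<Longrightarrow> ((\<lambda>x. F' x v) has_derivative F'' v x) (at x)"
    and cont: "\<And>u v. continuous_on W (\<lambda>x. F'' v x u)"
  shows "F'' v p u = F'' u p v"
proof -
  have main: "\<exists>x. dist x p \<le> h * (norm u + norm v) \<and>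
      F (p + h *\<^sub>R u + h *\<^sub>R v) - F (p + h *\<^sub>R u) - F (p + h *\<^sub>R v) + F p = h\<^sup>2 * F'' u x v"
    if h: "0 < h" "cball p (h * (norm u + norm v)) \<subseteq> W" for h u v
  proof -
    have inW: "p + s *\<^sub>R u + t *\<^sub>R v \<in> cball p (h * (norm u + norm v))" if "0 \<le> s" "s \<le> h" "0 \<le> t" "t \<le> h" for s t
    proof -
      have "norm (s *\<^sub>R u + t *\<^sub>R v) \<le> s * norm u + t * norm v"
        using norm_triangle_ineq[of "s *\<^sub>R u" "t *\<^sub>R v"] that by simp
      also have "\<dots> \<le> h * norm u + h * norm v" using that by (intro add_mono mult_right_mono) auto
      finally have "dist p (p + s *\<^sub>R u + t *\<^sub>R v) \<le> h * (norm u + norm v)"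
        using norm_minus_cancel[of "s *\<^sub>R u + t *\<^sub>R v"] by (simp add: dist_norm algebra_simps)
      then show ?thesis by simp
    qed
    \<comment> \<open>The increment of \<open>F\<close> in direction \<open>v\<close>, as a function
      of the parameter in direction \<open>u\<close>; the second mean value step, applied to
      \<open>?k\<close>, then brings out a derivative in direction \<open>v\<close>.\<close>
    let ?g = "\<lambda>s. F (p + s *\<^sub>R u + h *\<^sub>R v) - F (p + s *\<^sub>R u)"
    have "\<exists>z>0. z < h \<and> ?g h - ?g 0 = (h - 0) * (F' (p + z *\<^sub>R u + h *\<^sub>R v) u - F' (p + z *\<^sub>R u) u)"
    proof (rule MVT2[OF h(1)])
      fix s assume s: "0 \<le> s" "s \<le> h"
      have 1: "p + s *\<^sub>R u + h *\<^sub>R v \<in> W" "p + s *\<^sub>R u \<in> W"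
        using inW[of s h] inW[of s 0] s h by auto
      have "((\<lambda>s. F (p + s *\<^sub>R u + h *\<^sub>R v)) has_derivative (\<lambda>t. F' (p + s *\<^sub>R u + h *\<^sub>R v) (t *\<^sub>R u))) (at s)"
        by (rule has_derivative_compose[where f = "\<lambda>s. p + s *\<^sub>R u + h *\<^sub>R v" and g = F, OF _ F'[OF 1(1)]])
          (auto intro!: derivative_eq_intros)
      moreover have "((\<lambda>s. F (p + s *\<^sub>R u)) has_derivative (\<lambda>t. F' (p + s *\<^sub>R u) (t *\<^sub>R u))) (at s)"
        by (rule has_derivative_compose[where f = "\<lambda>s. p + s *\<^sub>R u" and g = F, OF _ F'[OF 1(2)]])
          (auto intro!: derivative_eq_intros)
      ultimately have "(?g has_derivative (\<lambda>t. F' (p + s *\<^sub>R u + h *\<^sub>R v) (t *\<^sub>R u) - F' (p + s *\<^sub>R u) (t *\<^sub>R u))) (at s)"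
        by (rule has_derivative_diff)
      moreover have "(\<lambda>t. F' (p + s *\<^sub>R u + h *\<^sub>R v) (t *\<^sub>R u) - F' (p + s *\<^sub>R u) (t *\<^sub>R u)) =
         (*) (F' (p + s *\<^sub>R u + h *\<^sub>R v) u - F' (p + s *\<^sub>R u) u)"
        using linear_scale[OF has_derivative_linear[OF F'[OF 1(1)]]] linear_scale[OF has_derivative_linear[OF F'[OF 1(2)]]]
        by (auto simp: algebra_simps)
      ultimately show "(?g has_real_derivative F' (p + s *\<^sub>R u + h *\<^sub>R v) u - F' (p + s *\<^sub>R u) u) (at s)"
        by (simp add: has_field_derivative_def)
    qed
    then obtain z where z: "0 < z" "z < h"
      "?g h - ?g 0 = h * (F' (p + z *\<^sub>R u + h *\<^sub>R v) u - F' (p + z *\<^sub>R u) u)" by auto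
    let ?k = "\<lambda>t. F' (p + z *\<^sub>R u + t *\<^sub>R v) u"
    have "\<exists>y>0. y < h \<and> ?k h - ?k 0 = (h - 0) * F'' u (p + z *\<^sub>R u + y *\<^sub>R v) v"
    proof (rule MVT2[OF h(1)])
      fix t assume t: "0 \<le> t" "t \<le> h"
      have 1: "p + z *\<^sub>R u + t *\<^sub>R v \<in> W"
        using inW[of z t] z t h by auto
      have "(?k has_derivative (\<lambda>r. F'' u (p + z *\<^sub>R u + t *\<^sub>R v) (r *\<^sub>R v))) (at t)"
        by (rule has_derivative_compose[where f = "\<lambda>t. p + z *\<^sub>R u + t *\<^sub>R v" and g = "\<lambda>x. F' x u", OF _ F''[OF 1]])
          (auto intro!: derivative_eq_intros)
      moreover have "(\<lambda>r. F'' u (p + z *\<^sub>R u + t *\<^sub>R v) (r *\<^sub>R v)) = (*) (F'' u (p + z *\<^sub>R u + t *\<^sub>R v) v)"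
        using linear_scale[OF has_derivative_linear[OF F''[OF 1]]] by (auto simp: algebra_simps)
      ultimately show "(?k has_real_derivative F'' u (p + z *\<^sub>R u + t *\<^sub>R v) v) (at t)"
        by (simp add: has_field_derivative_def)
    qed
    then obtain y where y: "0 < y" "y < h" "?k h - ?k 0 = h * F'' u (p + z *\<^sub>R u + y *\<^sub>R v) v" by auto
    have "dist (p + z *\<^sub>R u + y *\<^sub>R v) p \<le> h * (norm u + norm v)"
      using inW[of z y] z y by (auto simp: dist_commute)
    moreover have "F (p + h *\<^sub>R u + h *\<^sub>R v) - F (p + h *\<^sub>R u) - F (p + h *\<^sub>R v) + F p = h\<^sup>2 * F'' u (p + z *\<^sub>R u + y *\<^sub>R v) v"
      using z(3) y(3) by (simp add: power2_eq_square algebra_simps)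
    ultimately show ?thesis by blast
  qed
  have "\<bar>F'' v p u - F'' u p v\<bar> \<le> e" if "e > 0" for e
  proof -
    have c: "isCont (\<lambda>x. F'' v x u) p" "isCont (\<lambda>x. F'' u x v) p"
      using cont W continuous_on_eq_continuous_at by blast+
    obtain d1 where d1: "d1 > 0" "\<And>x. dist x p < d1 \<Longrightarrow> \<bar>F'' v x u - F'' v p u\<bar> < e/2"
      using c(1) \<open>e > 0\<close> unfolding continuous_at_eps_delta dist_real_def by (metis half_gt_zero)
    obtain d2 where d2: "d2 > 0" "\<And>x. dist x p < d2 \<Longrightarrow> \<bar>F'' u x v - F'' u p v\<bar> < e/2"
      using c(2) \<open>e > 0\<close> unfolding continuous_at_eps_delta dist_real_def by (metis half_gt_zero)
    obtain d3 where d3: "d3 > 0" "cball p d3 \<subseteq> W" using W open_contains_cball by blast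
    define d where "d = Min {d1, d2, d3}"
    have d: "d > 0" "d \<le> d1" "d \<le> d2" "d \<le> d3" using d1 d2 d3 by (auto simp: d_def)
    \<comment> \<open>The summand 1 keeps \<open>N\<close> positive even for
      \<open>u = v = 0\<close>; the factor 2 in \<open>h\<close> gives a parallelogram of size at
      most \<open>d / 2\<close>, strictly inside radius \<open>d\<close>.\<close>
    define N where "N = norm u + norm v + 1"
    define h where "h = d / (2 * N)"
    have N: "N > 0" unfolding N_def using norm_ge_zero[of u] norm_ge_zero[of v] by linarith
    have h: "h > 0" using d N by (simp add: h_def)
    have "h * (norm u + norm v) \<le> h * N" using h by (intro mult_left_mono) (auto simp: N_def)
    also have "\<dots> < d" using d N by (simp add: h_def)
    finally have hd: "h * (norm u + norm v) < d" .
    then have "cball p (h * (norm u + norm v)) \<subseteq> W" using d d3 by fastforce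
    from main[OF h this] obtain x where x: "dist x p \<le> h * (norm u + norm v)"
      "F (p + h *\<^sub>R u + h *\<^sub>R v) - F (p + h *\<^sub>R u) - F (p + h *\<^sub>R v) + F p = h\<^sup>2 * F'' u x v" by blast
    have "cball p (h * (norm v + norm u)) \<subseteq> W" using hd d d3 by (fastforce simp: add.commute)
    from main[OF h this] obtain y where y: "dist y p \<le> h * (norm v + norm u)"
      "F (p + h *\<^sub>R v + h *\<^sub>R u) - F (p + h *\<^sub>R v) - F (p + h *\<^sub>R u) + F p = h\<^sup>2 * F'' v y u" by blast
    have "h\<^sup>2 * F'' v y u = h\<^sup>2 * F'' u x v"
      using x(2) y(2) unfolding add.assoc add.commute[of "h *\<^sub>R v"] by linarith
    then have "F'' v y u = F'' u x v" using h by simp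
    moreover have "\<bar>F'' v y u - F'' v p u\<bar> < e/2" using y(1) hd d by (intro d1(2)) (simp add: add.commute)
    moreover have "\<bar>F'' u x v - F'' u p v\<bar> < e/2" using x(1) hd d by (intro d2(2)) simp
    ultimately show ?thesis by linarith
  qed
  then have "\<bar>F'' v p u - F'' u p v\<bar> \<le> 0" by (rule field_le_epsilon) (simp add: algebra_simps)
  then show ?thesis by simp
qed

lemma second_derivative_symmetric:
  fixes F :: "'a::euclidean_space \<Rightarrow> 'b::euclidean_space"
  assumes "open W" "p \<in> W"
    and F': "\<And>x. x \<in> W \<Longrightarrow> (F has_derivative F' x) (at x)"
    and F'': "\<And>v x. x \<in> W \<Longrightarrow> ((\<lambda>x. F' x v) has_derivative F'' v x) (at x)"
    and cont: "\<And>u v. continuous_on W (\<lambda>x. F'' v x u)"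
  shows "F'' v p u = F'' u p v"
proof (rule euclidean_eqI)
  fix b :: 'b assume "b \<in> Basis"
  show "F'' v p u \<bullet> b = F'' u p v \<bullet> b"
  proof (rule second_derivative_symmetric_real[OF assms(1,2)])
    fix x assume "x \<in> W"
    then show "((\<lambda>x. F x \<bullet> b) has_derivative (\<lambda>v. F' x v \<bullet> b)) (at x)"
      by (intro has_derivative_inner_left F')
  next
    fix v x assume "x \<in> W"
    then show "((\<lambda>x. F' x v \<bullet> b) has_derivative (\<lambda>u. F'' v x u \<bullet> b)) (at x)"
      by (intro has_derivative_inner_left F'')
  next
    fix u v
    show "continuous_on W (\<lambda>x. F'' v x u \<bullet> b)"
      by (intro continuous_intros cont)
  qed
qed

text \<open>The symmetric form \<open>H\<close> below is the second derivative of \<open>F\<close> at \<open>p\<close>.\<close>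

lemma derivative_along_curve:
  fixes F :: "'a::euclidean_space \<Rightarrow> 'b::euclidean_space"
  assumes W: "open W" "p \<in> W"
    and F': "\<And>x. x \<in> W \<Longrightarrow> (F has_derivative F' x) (at x)"
    and sm: "\<And>k v. Ck_on k W (\<lambda>x. F' x v)"
  obtains H where "\<And>u v. H u v = H v u"
    "\<And>c V u v. c 0 = p \<Longrightarrow> (c has_vector_derivative u) (at 0) \<Longrightarrow> (V has_vector_derivative v) (at (0::real)) \<Longrightarrow>
      ((\<lambda>t. F' (c t) (V t)) has_vector_derivative F' p v + H (V 0) u) (at 0)"
proof -
  have "\<forall>v. \<exists>F''. (\<forall>x\<in>W. ((\<lambda>x. F' x v) has_derivative F'' x) (at x)) \<and> (\<forall>u. continuous_on W (\<lambda>x. F'' x u))"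
    using sm[of "Suc 0"] by simp
  then obtain F'' where F'': "\<And>v x. x \<in> W \<Longrightarrow> ((\<lambda>x. F' x v) has_derivative F'' v x) (at x)"
     "\<And>u v. continuous_on W (\<lambda>x. F'' v x u)"
    by metis
  define H where "H v u = F'' v p u" for v u
  have "((\<lambda>t. F' (c t) (V t)) has_vector_derivative F' p v + H (V 0) u) (at 0)"
    if c: "c 0 = p" "(c has_vector_derivative u) (at 0)" and V: "(V has_vector_derivative v) (at (0::real))" for c V u v
  proof -
    \<comment> \<open>Expanding in a basis leaves only the finitely many functions
      \<open>x \<mapsto> F' x b\<close> with fixed \<open>b\<close> to be differentiated along the
      curve.\<close>
    have lin: "F' x w = (\<Sum>b\<in>Basis. (w \<bullet> b) *\<^sub>R F' x b)" if "x \<in> W" for x w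
    proof -
      have l: "linear (F' x)" using has_derivative_linear[OF F'[OF that]] .
      have "F' x (\<Sum>b\<in>Basis. (w \<bullet> b) *\<^sub>R b) = (\<Sum>b\<in>Basis. (w \<bullet> b) *\<^sub>R F' x b)"
        by (simp add: linear_sum[OF l] linear_scale[OF l])
      then show ?thesis by (simp add: euclidean_representation)
    qed
    \<comment> \<open>\<open>F''\<close> is evidently linear only in the direction of
      differentiation, whereas the slot expanded here is the fixed vector; symmetry exchanges the
      two.\<close>
    have lin2: "H w z = (\<Sum>b\<in>Basis. (w \<bullet> b) *\<^sub>R H b z)" for w z
    proof -
      have "F'' z p w = (\<Sum>b\<in>Basis. (w \<bullet> b) *\<^sub>R F'' z p b)"
      proof -
        have l: "linear (F'' z p)" using has_derivative_linear[OF F''(1)[OF W(2)]] .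
        have "F'' z p (\<Sum>b\<in>Basis. (w \<bullet> b) *\<^sub>R b) = (\<Sum>b\<in>Basis. (w \<bullet> b) *\<^sub>R F'' z p b)"
          by (simp add: linear_sum[OF l] linear_scale[OF l])
        then show ?thesis by (simp add: euclidean_representation)
      qed
      then show ?thesis
        using second_derivative_symmetric[OF W F' F''] by (simp add: H_def)
    qed
    have d: "((\<lambda>t. F' (c t) b) has_vector_derivative H b u) (at 0)" for b
      using vector_derivative_diff_chain_within[of c u 0 UNIV "\<lambda>x. F' x b" "F'' b p"] c F''(1)[OF W(2), of b] has_derivative_at_withinI
      by (fastforce simp: o_def H_def)
    have D: "((\<lambda>t. \<Sum>b\<in>Basis. (V t \<bullet> b) *\<^sub>R F' (c t) b) has_vector_derivative
        (\<Sum>b\<in>Basis. (V 0 \<bullet> b) *\<^sub>R H b u + (v \<bullet> b) *\<^sub>R F' (c 0) b)) (at 0)"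
    proof (intro has_vector_derivative_sum has_vector_derivative_scaleR d)
      fix b :: 'a
      show "((\<lambda>t. V t \<bullet> b) has_field_derivative v \<bullet> b) (at 0)"
        using bounded_linear.has_vector_derivative[OF bounded_linear_inner_left V, of b]
        by (simp add: has_real_derivative_iff_has_vector_derivative)
    qed
    have D2: "(\<Sum>b\<in>Basis. (V 0 \<bullet> b) *\<^sub>R H b u + (v \<bullet> b) *\<^sub>R F' (c 0) b) = F' p v + H (V 0) u"
      using lin[OF W(2), of v] lin2[of "V 0" u] c by (simp add: sum.distrib)
    have ev: "\<forall>\<^sub>F t in at 0. (\<Sum>b\<in>Basis. (V t \<bullet> b) *\<^sub>R F' (c t) b) = F' (c t) (V t)"
    proof -
      have "isCont c 0" using c(2) has_vector_derivative_continuous by blast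
      then have "c \<midarrow>0\<rightarrow> p" using c(1) isCont_def by metis
      then have "\<forall>\<^sub>F t in at 0. c t \<in> W" using W topological_tendstoD by blast
      then show ?thesis by eventually_elim (use lin in auto)
    qed
    have at0: "(\<Sum>b\<in>Basis. (V 0 \<bullet> b) *\<^sub>R F' (c 0) b) = F' (c 0) (V 0)"
      using lin[OF W(2), of "V 0"] c(1) by simp
    show ?thesis
      using has_derivative_transform_eventually[OF D[unfolded D2 has_vector_derivative_def] ev] at0
      by (simp add: has_vector_derivative_def)
  qed
  moreover have "H u v = H v u" for u v
    using second_derivative_symmetric[OF W F' F''] by (simp add: H_def)
  ultimately show thesis using that by blast
qed

section \<open>Matrix products and commutators\<close>

lemma matrix_mult_add_left: "(A + B) ** C = A ** C + B ** (C::'a::ring_1^'n^'n)"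
  and matrix_mult_add_right: "A ** (B + C) = A ** B + A ** (C::'a::ring_1^'n^'n)"
  and matrix_mult_diff_left: "(A - B) ** C = A ** C - B ** (C::'a::ring_1^'n^'n)"
  and matrix_mult_diff_right: "A ** (B - C) = A ** B - A ** (C::'a::ring_1^'n^'n)"
  and matrix_mult_uminus_left: "(- A) ** C = - (A ** (C::'a::ring_1^'n^'n))"
  and matrix_mult_uminus_right: "A ** (- C) = - (A ** (C::'a::ring_1^'n^'n))"
  for A B C :: "'a::ring_1^'n^'n"
  by (simp_all add: vec_eq_iff matrix_matrix_mult_def algebra_simps sum.distrib sum_subtractf sum_negf)

lemma matrix_mult_scaleR_left: "(k *\<^sub>R A) ** C = k *\<^sub>R (A ** C)"
  and matrix_mult_scaleR_right: "A ** (k *\<^sub>R C) = k *\<^sub>R (A ** C)"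
  for A C :: "'a::real_algebra_1^'n^'n"
  by (simp_all add: vec_eq_iff matrix_matrix_mult_def scaleR_sum_right)

lemma matrix_mult_sum_left: "(\<Sum>i\<in>I. f i) ** C = (\<Sum>i\<in>I. f i ** C)"
  and matrix_mult_sum_right: "C ** (\<Sum>i\<in>I. f i) = (\<Sum>i\<in>I. C ** f i)"
  for C :: "'a::ring_1^'n^'n"
  by (induction I rule: infinite_finite_induct) (simp_all add: matrix_mult_add_left matrix_mult_add_right)

lemmas matrix_mult_distribs = matrix_mult_add_left matrix_mult_add_right matrix_mult_diff_left
  matrix_mult_diff_right matrix_mult_uminus_left matrix_mult_uminus_right
  matrix_mult_scaleR_left matrix_mult_scaleR_right

lemma bounded_bilinear_matrix_mult:
  "bounded_bilinear (\<lambda>A :: 'a::{real_algebra_1,euclidean_space}^'n^'n. \<lambda>B :: 'a^'n^'n. A ** B)"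
proof -
  have "bilinear (\<lambda>A :: 'a^'n^'n. \<lambda>B :: 'a^'n^'n. A ** B)"
    by (auto simp: bilinear_def linear_iff matrix_mult_distribs)
  then show ?thesis using bilinear_conv_bounded_bilinear by blast
qed

lemma commutator_add_left: "commutator (A + B) C = commutator A C + commutator B C"
  and commutator_add_right: "commutator A (B + C) = commutator A B + commutator A C"
  and commutator_diff_left: "commutator (A - B) C = commutator A C - commutator B C"
  and commutator_diff_right: "commutator A (B - C) = commutator A B - commutator A C"
  and commutator_uminus_left: "commutator (- A) C = - commutator A C"
  and commutator_uminus_right: "commutator A (- C) = - commutator A C"
  for A B C :: "'a::ring_1^'n^'n"
  by (simp_all add: commutator_def matrix_mult_add_left matrix_mult_add_right matrix_mult_diff_left
      matrix_mult_diff_right matrix_mult_uminus_left matrix_mult_uminus_right algebra_simps)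

lemma commutator_scaleR_left: "commutator (k *\<^sub>R A) C = k *\<^sub>R commutator A C"
  and commutator_scaleR_right: "commutator A (k *\<^sub>R C) = k *\<^sub>R commutator A C"
  for A C :: "'a::real_algebra_1^'n^'n"
  by (simp_all add: commutator_def matrix_mult_distribs scaleR_diff_right)

lemma commutator_sum_left: "commutator (\<Sum>i\<in>I. f i) C = (\<Sum>i\<in>I. commutator (f i) C)"
  for C :: "'a::ring_1^'n^'n"
  by (simp add: commutator_def matrix_mult_sum_left matrix_mult_sum_right sum_subtractf)

lemma commutator_zero_left [simp]: "commutator 0 A = 0"
  and commutator_zero_right [simp]: "commutator A 0 = 0"
  for A :: "'a::ring_1^'n^'n"
  by (simp_all add: commutator_def)

lemma commutator_jacobi:
  "commutator A (commutator B C) - commutator B (commutator A C) = commutator (commutator A B) C"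
  for A B C :: "'a::ring_1^'n^'n"
  by (simp add: commutator_def matrix_mult_diff_left matrix_mult_diff_right matrix_mul_assoc)

lemma bounded_bilinear_commutator:
  "bounded_bilinear (\<lambda>A :: 'a::{real_algebra_1,euclidean_space}^'n^'n. \<lambda>B :: 'a^'n^'n. commutator A B)"
proof -
  have "bilinear (\<lambda>A :: 'a^'n^'n. \<lambda>B :: 'a^'n^'n. commutator A B)"
    by (auto simp: bilinear_def linear_iff commutator_add_left commutator_add_right
        commutator_scaleR_left commutator_scaleR_right)
  then show ?thesis using bilinear_conv_bounded_bilinear by blast
qed

lemma linear_commutator: "linear (commutator (A :: 'a::real_algebra_1^'n^'n))"
  by (auto simp: linear_iff commutator_add_right commutator_scaleR_right)

section \<open>Traces and the Killing form\<close>

text \<open>The basis chosen inside \<open>trace_on\<close> depends on \<open>S\<close> alone, so a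
  single basis computes the traces of all maps and they can be compared in coordinates.\<close>

lemma trace_on_basis:
  fixes S :: "'a::euclidean_space set"
  assumes "subspace S"
  obtains B where "finite B" "independent B" "span B = S"
    "\<And>f. trace_on S f = (\<Sum>b\<in>B. representation B (f b) b)"
proof -
  define B where "B = (SOME B. independent B \<and> span B = S)"
  have "\<exists>B. independent B \<and> span B = S"
    using basis_exists[of S] assms by (metis span_subspace)
  then have B: "independent B" "span B = S"
    using someI_ex[of "\<lambda>B. independent B \<and> span B = S"] unfolding B_def by auto
  moreover have "finite B" using B(1) independent_imp_finite by blast
  moreover have "trace_on S f = (\<Sum>b\<in>B. representation B (f b) b)" for f
    by (simp add: trace_on_def B_def Let_def)
  ultimately show thesis using that by blast
qed

lemma trace_on_cong: "subspace S \<Longrightarrow> (\<And>x. x \<in> S \<Longrightarrow> f x = g x) \<Longrightarrow> trace_on S f = trace_on S g"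
  for S :: "'a::euclidean_space set"
  by (rule trace_on_basis[of S]) (auto intro!: sum.cong simp: span_base)

lemma trace_on_add:
  fixes S :: "'a::euclidean_space set"
  assumes "subspace S" "f ` S \<subseteq> S" "g ` S \<subseteq> S"
  shows "trace_on S (\<lambda>x. f x + g x) = trace_on S f + trace_on S g"
proof -
  obtain B where B: "finite B" "independent B" "span B = S"
    "\<And>f. trace_on S f = (\<Sum>b\<in>B. representation B (f b) b)" using trace_on_basis[OF assms(1)] by blast
  have "f b \<in> span B" "g b \<in> span B" if "b \<in> B" for b
    using that assms B(3) span_base[of b B] by auto
  then show ?thesis
    unfolding B(4) by (simp add: representation_add[OF B(2)] sum.distrib)
qed

lemma trace_on_scaleR:
  fixes S :: "'a::euclidean_space set"
  assumes "subspace S" "f ` S \<subseteq> S"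
  shows "trace_on S (\<lambda>x. k *\<^sub>R f x) = k * trace_on S f"
proof -
  obtain B where B: "finite B" "independent B" "span B = S"
    "\<And>f. trace_on S f = (\<Sum>b\<in>B. representation B (f b) b)" using trace_on_basis[OF assms(1)] by blast
  have "f b \<in> span B" if "b \<in> B" for b
    using that assms B(3) span_base[of b B] by auto
  then show ?thesis
    unfolding B(4) by (simp add: representation_scale[OF B(2)] sum_distrib_left)
qed

lemma trace_on_commute:
  fixes S :: "'a::euclidean_space set"
  assumes "subspace S" "linear f" "linear g" "f ` S \<subseteq> S" "g ` S \<subseteq> S"
  shows "trace_on S (\<lambda>x. f (g x)) = trace_on S (\<lambda>x. g (f x))"
proof -
  obtain B where B: "finite B" "independent B" "span B = S"
    "\<And>f. trace_on S f = (\<Sum>b\<in>B. representation B (f b) b)" using trace_on_basis[OF assms(1)] by blast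
  have expand: "representation B (f (g b)) b = (\<Sum>c\<in>B. representation B (g b) c * representation B (f c) b)"
    if f: "linear f" "f ` S \<subseteq> S" and g: "g ` S \<subseteq> S" and "b \<in> B" for f g b
  proof -
    have S: "g b \<in> span B" and fS: "\<And>c. c \<in> B \<Longrightarrow> f c \<in> span B"
      using g f(2) \<open>b \<in> B\<close> B(3) span_base by blast+
    have "f (g b) = f (\<Sum>c\<in>B. representation B (g b) c *\<^sub>R c)"
      using sum_representation_eq[OF B(2) S B(1)] by simp
    also have "\<dots> = (\<Sum>c\<in>B. representation B (g b) c *\<^sub>R f c)"
      by (simp add: linear_sum[OF f(1)] linear_scale[OF f(1)])
    finally show ?thesis
      using fS by (simp add: representation_sum[OF B(2)] representation_scale[OF B(2)] span_scale)
  qed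
  show ?thesis
    unfolding B(4) using assms
    by (simp add: expand) (subst sum.swap, simp add: mult.commute)
qed

locale lie_subalgebra =
  fixes \<gg> :: "(real^'m^'m) set"
  assumes subspace: "subspace \<gg>"
    and closed: "A \<in> \<gg> \<Longrightarrow> B \<in> \<gg> \<Longrightarrow> commutator A B \<in> \<gg>"
begin

lemma killing_form_commute:
  assumes "A \<in> \<gg>" "B \<in> \<gg>"
  shows "killing_form \<gg> A B = killing_form \<gg> B A"
  unfolding killing_form_def
  using trace_on_commute[OF subspace linear_commutator linear_commutator, of A B] closed assms by auto

lemma killing_form_add:
  assumes "A \<in> \<gg>" "B \<in> \<gg>" "C \<in> \<gg>"
  shows "killing_form \<gg> (A + B) C = killing_form \<gg> A C + killing_form \<gg> B C"
  unfolding killing_form_def commutator_add_left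
  using closed assms by (intro trace_on_add[OF subspace]) auto

lemma killing_form_scaleR:
  assumes "A \<in> \<gg>" "C \<in> \<gg>"
  shows "killing_form \<gg> (k *\<^sub>R A) C = k * killing_form \<gg> A C"
  unfolding killing_form_def commutator_scaleR_left
  using closed assms by (intro trace_on_scaleR[OF subspace]) auto

text \<open>On the subalgebra, ad of \<phi> A is the conjugate of ad of \<open>A\<close> by \<phi>,
  and traces are invariant under conjugation. It is applied to the involution of the symmetric space
  and to the adjoint action of the group.\<close>

lemma killing_form_automorphism:
  assumes \<phi>: "linear \<phi>" "\<phi> ` \<gg> \<subseteq> \<gg>" and \<psi>: "linear \<psi>" "\<psi> ` \<gg> \<subseteq> \<gg>"
    and inv: "\<And>Z. Z \<in> \<gg> \<Longrightarrow> \<phi> (\<psi> Z) = Z" "\<And>Z. Z \<in> \<gg> \<Longrightarrow> \<psi> (\<phi> Z) = Z"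
    and hom: "\<And>X Y. X \<in> \<gg> \<Longrightarrow> Y \<in> \<gg> \<Longrightarrow> \<phi> (commutator X Y) = commutator (\<phi> X) (\<phi> Y)"
    and AB: "A \<in> \<gg>" "B \<in> \<gg>"
  shows "killing_form \<gg> (\<phi> A) (\<phi> B) = killing_form \<gg> A B"
proof -
  let ?f = "\<lambda>Z. commutator A (commutator B Z)"
  have f: "linear ?f"
    using linear_compose[OF linear_commutator[of B] linear_commutator[of A]] by (simp add: o_def)
  have fS: "?f ` \<gg> \<subseteq> \<gg>" using closed AB by auto
  have "killing_form \<gg> (\<phi> A) (\<phi> B) = trace_on \<gg> (\<lambda>Z. \<phi> (?f (\<psi> Z)))"
    unfolding killing_form_def
  proof (rule trace_on_cong[OF subspace])
    fix Z assume Z: "Z \<in> \<gg>"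
    then have \<psi>Z: "\<psi> Z \<in> \<gg>" using \<psi> by auto
    show "commutator (\<phi> A) (commutator (\<phi> B) Z) = \<phi> (?f (\<psi> Z))"
      using hom[OF AB(1) closed[OF AB(2) \<psi>Z]] hom[OF AB(2) \<psi>Z] inv(1)[OF Z] by simp
  qed
  also have "\<dots> = trace_on \<gg> (\<lambda>Z. ?f (\<psi> (\<phi> Z)))"
    using trace_on_commute[OF subspace \<phi>(1) linear_compose[OF \<psi>(1) f] \<phi>(2)] fS \<psi>(2) by (auto simp: o_def)
  also have "\<dots> = trace_on \<gg> ?f"
    by (rule trace_on_cong[OF subspace]) (simp add: inv)
  finally show ?thesis by (simp add: killing_form_def)
qed

end

section \<open>Complex matrices\<close>

definition cscale :: "complex \<Rightarrow> complex^'m^'m \<Rightarrow> complex^'m^'m" where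
  "cscale c A = map_matrix ((*) c) A"

definition conj_mat :: "complex^'m^'m \<Rightarrow> complex^'m^'m" where
  "conj_mat A = map_matrix cnj A"

definition re_mat :: "complex^'m^'m \<Rightarrow> real^'m^'m" where
  "re_mat A = map_matrix Re A"

definition gram :: "int^'m^'m \<Rightarrow> 'a::comm_ring_1^'m^'m" where
  "gram Q = map_matrix of_int Q"

lemma cscale_simps:
  "cscale c A ** B = cscale c (A ** B)" "A ** cscale c B = cscale c (A ** B)"
  "cscale c (A + B) = cscale c A + cscale c B" "cscale c (A - B) = cscale c A - cscale c B"
  "cscale c (- A) = - cscale c A"
  "cscale c (cscale d A) = cscale (c * d) A" "cscale 1 A = A" "cscale c 0 = 0"
  "cscale (- c) A = - cscale c A"
  "k *\<^sub>R cscale c A = cscale c (k *\<^sub>R A)"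
  by (simp_all add: vec_eq_iff cscale_def matrix_matrix_mult_def sum_distrib_left algebra_simps)

lemma cscale_commutator:
  "commutator (cscale c A) B = cscale c (commutator A B)"
  "commutator A (cscale c B) = cscale c (commutator A B)"
  by (simp_all add: commutator_def cscale_simps)

lemma linear_cscale: "linear (cscale c)"
  by (simp add: linear_iff cscale_simps)

lemma cscale_mult_vec: "cscale c A *v v = c *s (A *v v)"
  by (simp add: vec_eq_iff cscale_def matrix_vector_mult_def sum_distrib_left mult.assoc)

lemma transpose_simps:
  "transpose (A + B) = transpose A + transpose B" "transpose (A - B) = transpose A - transpose B"
  "transpose (- A) = - transpose A" "transpose 0 = 0"
  for A B :: "'a::ring_1^'m^'m"
  by (simp_all add: vec_eq_iff transpose_def)

lemma transpose_cscale: "transpose (cscale c A) = cscale c (transpose A)"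
  by (simp add: vec_eq_iff transpose_def cscale_def)

lemma transpose_sum: "transpose (\<Sum>i\<in>I. f i) = (\<Sum>i\<in>I. transpose (f i))"
  for f :: "'i \<Rightarrow> 'a::ring_1^'m^'m"
  by (simp add: vec_eq_iff transpose_def sum_component)

lemma conj_mat_simps:
  "conj_mat (A ** B) = conj_mat A ** conj_mat B" "conj_mat (A + B) = conj_mat A + conj_mat B"
  "conj_mat (A - B) = conj_mat A - conj_mat B" "conj_mat (- A) = - conj_mat A"
  "conj_mat (cscale c A) = cscale (cnj c) (conj_mat A)" "conj_mat (conj_mat A) = A"
  "conj_mat (mat 1) = mat 1" "conj_mat 0 = 0" "conj_mat (cplx_mat X) = cplx_mat X"
  "conj_mat (k *\<^sub>R A) = k *\<^sub>R conj_mat A"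
  by (simp_all add: vec_eq_iff conj_mat_def cscale_def matrix_matrix_mult_def cplx_mat_def mat_def)

lemma linear_conj_mat: "linear conj_mat"
  by (simp add: linear_iff conj_mat_simps)

lemma cplx_mat_simps:
  "cplx_mat (X ** Y) = cplx_mat X ** cplx_mat Y" "cplx_mat (X + Y) = cplx_mat X + cplx_mat Y"
  "cplx_mat (X - Y) = cplx_mat X - cplx_mat Y" "cplx_mat (- X) = - cplx_mat X"
  "cplx_mat (mat 1) = mat 1" "cplx_mat 0 = 0" "cplx_mat (k *\<^sub>R X) = k *\<^sub>R cplx_mat X"
  "cplx_mat (transpose X) = transpose (cplx_mat X)" "cplx_mat (gram Q) = gram Q"
  by (simp_all add: vec_eq_iff cplx_mat_def matrix_matrix_mult_def mat_def transpose_def gram_def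
      scaleR_conv_of_real[where 'a = complex])

lemma cplx_mat_commutator: "cplx_mat (commutator X Y) = commutator (cplx_mat X) (cplx_mat Y)"
  by (simp add: commutator_def cplx_mat_simps)

lemma cplx_mat_inject [simp]: "cplx_mat X = cplx_mat Y \<longleftrightarrow> X = Y"
  by (simp add: vec_eq_iff cplx_mat_def)

lemma linear_cplx_mat: "linear cplx_mat"
  unfolding linear_iff by (simp add: cplx_mat_simps)

lemma re_cplx_mat [simp]: "re_mat (cplx_mat X) = X"
  by (simp add: vec_eq_iff cplx_mat_def re_mat_def)

lemma cplx_re_mat: "conj_mat A = A \<Longrightarrow> cplx_mat (re_mat A) = A"
  by (simp add: vec_eq_iff cplx_mat_def re_mat_def conj_mat_def complex_eq_iff)

lemma linear_re_mat: "linear re_mat"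
  by (simp add: linear_iff vec_eq_iff re_mat_def)

lemma conj_vec_mult: "conj_vec (A *v v) = conj_mat A *v conj_vec v"
  by (simp add: vec_eq_iff conj_vec_def conj_mat_def matrix_vector_mult_def)

lemma conj_vec_conj_vec [simp]: "conj_vec (conj_vec v) = v"
  by (simp add: vec_eq_iff conj_vec_def)

text \<open>A bilinear form with an arbitrary matrix, so that operators acting on either argument
  can be absorbed into it and statements about \<open>bil Q\<close> become matrix
  identities.\<close>

definition bilin :: "'a::comm_ring_1^'m^'m \<Rightarrow> 'a^'m \<Rightarrow> 'a^'m \<Rightarrow> 'a" where
  "bilin M x y = (\<Sum>i\<in>UNIV. x $ i * (M *v y) $ i)"

lemma bil_eq_bilin: "bil Q x y = bilin (gram Q) x y"
  by (simp add: bil_def bilin_def gram_def matrix_vector_mult_def sum_distrib_left mult_ac)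

lemma bilin_mult_right: "bilin M x (B *v y) = bilin (M ** B) x y"
  by (simp add: bilin_def matrix_vector_mul_assoc)

lemma bilin_transpose: "bilin M x y = bilin (transpose M) y x"
proof -
  have "bilin M x y = (\<Sum>i\<in>UNIV. \<Sum>j\<in>UNIV. x $ i * M $ i $ j * y $ j)"
    by (simp add: bilin_def matrix_vector_mult_def sum_distrib_left mult.assoc)
  also have "\<dots> = (\<Sum>j\<in>UNIV. \<Sum>i\<in>UNIV. x $ i * M $ i $ j * y $ j)" by (rule sum.swap)
  also have "\<dots> = bilin (transpose M) y x"
    by (simp add: bilin_def matrix_vector_mult_def transpose_def sum_distrib_left mult_ac)
  finally show ?thesis .
qed

lemma bilin_mult_left: "bilin M (A *v x) y = bilin (transpose A ** M) x y"
  by (metis bilin_transpose bilin_mult_right matrix_transpose_mul transpose_transpose)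

lemma bilin_eqI: "(\<And>x y. bilin M x y = bilin N x y) \<Longrightarrow> M = N"
proof -
  assume *: "\<And>x y. bilin M x y = bilin N x y"
  have "bilin A (axis i 1) (axis j 1) = A $ i $ j" for A :: "'a^'b^'b" and i j
    by (simp add: bilin_def matrix_vector_mult_def axis_def if_distrib if_distribR cong: if_cong)
  then show ?thesis using * by (metis vec_eq_iff)
qed

lemma bilin_add:
  "bilin M (x + x') y = bilin M x y + bilin M x' y" "bilin M x (y + y') = bilin M x y + bilin M x y'"
  "bilin M (c *s x) y = c * bilin M x y" "bilin M x (c *s y) = c * bilin M x y"
  by (simp_all add: bilin_def algebra_simps sum.distrib sum_distrib_left matrix_vector_mult_def)

lemma bilin_sum:
  "bilin M (\<Sum>i\<in>I. f i) y = (\<Sum>i\<in>I. bilin M (f i) y)" "bilin M y (\<Sum>i\<in>I. f i) = (\<Sum>i\<in>I. bilin M y (f i))"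
  by (induction I rule: infinite_finite_induct) (simp_all add: bilin_add, simp_all add: bilin_def)

section \<open>The isometry group and its Lie algebra\<close>

lemma matrix_inv_eqI:
  fixes A B :: "'a::field^'n^'n"
  assumes "A ** B = mat 1"
  shows "matrix_inv A = B"
proof -
  have BA: "B ** A = mat 1" using assms matrix_left_right_inverse by blast
  have "A ** matrix_inv A = mat 1 \<and> matrix_inv A ** A = mat 1"
    unfolding matrix_inv_def using assms BA by (rule_tac someI[of _ B]) auto
  then show ?thesis
    by (metis BA matrix_mul_assoc matrix_mul_lid matrix_mul_rid)
qed

lemma matrix_inv_inverse:
  fixes A :: "'a::field^'n^'n"
  assumes "invertible A"
  shows "A ** matrix_inv A = mat 1" "matrix_inv A ** A = mat 1"
  using assms matrix_inv_eqI unfolding invertible_def by metis+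

lemma continuous_on_det:
  fixes M :: "'a::topological_space \<Rightarrow> real^'n^'n"
  assumes "continuous_on T M"
  shows "continuous_on T (\<lambda>t. det (M t))"
  unfolding det_def by (intro continuous_intros assms)

text \<open>By Cramer's rule the entries of the inverse are quotients of determinants.\<close>

lemma continuous_on_matrix_inv:
  fixes M :: "'a::topological_space \<Rightarrow> real^'n^'n"
  assumes "continuous_on T M" "\<And>t. t \<in> T \<Longrightarrow> det (M t) \<noteq> 0"
  shows "continuous_on T (\<lambda>t. matrix_inv (M t))"
proof -
  let ?N = "\<lambda>t. \<chi> k j. det (\<chi> i l. if l = k then axis j 1 $ i else M t $ i $ l) / det (M t)"
  have eq: "matrix_inv (M t) = ?N t" if "t \<in> T" for t
  proof -
    have inv: "M t ** matrix_inv (M t) = mat 1"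
      using assms(2)[OF that] matrix_inv_inverse invertible_det_nz by blast
    have "matrix_inv (M t) $ k $ j = ?N t $ k $ j" for k j
    proof -
      have "M t *v (matrix_inv (M t) *v axis j 1) = axis j 1"
        by (simp add: matrix_vector_mul_assoc inv)
      then have "matrix_inv (M t) *v axis j 1 =
          (\<chi> k. det (\<chi> i l. if l = k then axis j 1 $ i else M t $ i $ l) / det (M t))"
        using cramer[OF assms(2)[OF that]] by blast
      then show ?thesis
        by (simp add: vec_eq_iff matrix_vector_mult_basis column_def)
    qed
    then show ?thesis unfolding vec_eq_iff by blast
  qed
  have "continuous_on T ?N"
  proof (intro continuous_on_vec_lambda continuous_on_divide continuous_on_det assms)
    fix k j :: 'n
    show "continuous_on T (\<lambda>t. if l = k then axis j 1 $ i else M t $ i $ l)" for i l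
      by (cases "l = k") (auto intro!: continuous_intros assms)
  qed (use assms(2) in auto)
  then show ?thesis using eq by (simp cong: continuous_on_cong)
qed

lemma aut_real_iff: "g \<in> aut_real Q \<longleftrightarrow> invertible g \<and> transpose g ** gram Q ** g = gram Q"
proof -
  have "(\<forall>x y :: real^'a. bil Q (g *v x) (g *v y) = bil Q x y) \<longleftrightarrow> transpose g ** gram Q ** g = gram Q"
    by (auto simp: bil_eq_bilin bilin_mult_right bilin_mult_left matrix_mul_assoc
        intro!: bilin_eqI)
  then show ?thesis by (simp add: aut_real_def)
qed

lemma aut_real_mult:
  assumes "a \<in> aut_real Q" "b \<in> aut_real Q" shows "a ** b \<in> aut_real Q"
proof -
  have "transpose (a ** b) ** gram Q ** (a ** b) = transpose b ** (transpose a ** gram Q ** a) ** b"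
    by (simp add: matrix_transpose_mul matrix_mul_assoc)
  then show ?thesis using assms invertible_mult by (auto simp: aut_real_iff)
qed

text \<open>The orthogonal or symplectic Lie algebra of the form: the linearization at 1 of
  \<open>transpose g ** gram Q ** g = gram Q\<close>.\<close>

definition isometry_algebra :: "int^'m^'m \<Rightarrow> (real^'m^'m) set" where
  "isometry_algebra Q = {A. transpose A ** gram Q = - (gram Q ** A)}"

text \<open>The Cayley transform \<open>(1 - t A / 2)\<^sup>-\<^sup>1 (1 + t A / 2)\<close> serves as a substitute for \<open>exp (t A)\<close>.\<close>

lemma cayley_curve:
  fixes Q :: "int^'m^'m"
  assumes A: "A \<in> isometry_algebra Q"
  obtains c e where "e > 0" "c 0 = mat 1" "(c has_vector_derivative A) (at 0)"
    "continuous_on {-e<..<e} c" "\<And>t. \<bar>t\<bar> < e \<Longrightarrow> c t \<in> aut_real Q"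
    "\<And>t. \<bar>t\<bar> < e \<Longrightarrow> c t ** c (- t) = mat 1"
proof -
  define L :: "real \<Rightarrow> real^'m^'m" where "L t = mat 1 - t *\<^sub>R ((1/2) *\<^sub>R A)" for t
  have contL: "continuous_on T L" for T unfolding L_def by (intro continuous_intros)
  have "open {t. det (L t) \<noteq> 0}"
    by (intro open_Collect_neq continuous_on_det contL continuous_on_const)
  moreover have "0 \<in> {t. det (L t) \<noteq> 0}" by (simp add: L_def)
  ultimately obtain e where e: "e > 0" "ball 0 e \<subseteq> {t. det (L t) \<noteq> 0}"
    using openE by blast
  then have det: "det (L t) \<noteq> 0" if "\<bar>t\<bar> < e" for t
    using that e(2) by (auto simp: subset_iff)
  define N where "N t = matrix_inv (L t)" for t
  define c where "c t = N t ** L (- t)" for t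
  have N: "L t ** N t = mat 1" "N t ** L t = mat 1" if "\<bar>t\<bar> < e" for t
    using det[OF that] matrix_inv_inverse invertible_det_nz unfolding N_def by blast+
  have comm: "L s ** L t = L t ** L s" for s t
    by (simp add: L_def matrix_mult_distribs algebra_simps)
  have c2: "c t = L (- t) ** N t" if "\<bar>t\<bar> < e" for t
  proof -
    have "N t ** L (- t) = N t ** L (- t) ** (L t ** N t)" by (simp add: N[OF that])
    also have "\<dots> = N t ** (L (- t) ** L t) ** N t" by (simp add: matrix_mul_assoc)
    also have "\<dots> = (N t ** L t) ** L (- t) ** N t" by (simp add: comm[of "- t" t] matrix_mul_assoc)
    finally show ?thesis by (simp add: N[OF that] c_def)
  qed
  have contN: "continuous_on {-e<..<e} N"
    unfolding N_def by (rule continuous_on_matrix_inv[OF contL]) (use det in auto)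
  have contLm: "continuous_on T (\<lambda>t. L (- t))" for T unfolding L_def by (intro continuous_intros)
  have contc: "continuous_on {-e<..<e} c"
    unfolding c_def by (rule bounded_bilinear.continuous_on[OF bounded_bilinear_matrix_mult contN contLm])
  have c0: "c 0 = mat 1" using N[of 0] e by (simp add: c_def L_def)
  have deriv: "(c has_vector_derivative A) (at 0)"
  proof -
    \<comment> \<open>With this exact formula the difference quotient at 0 is
      \<open>N t ** A\<close>, so continuity of \<open>N\<close> suffices for the
      derivative.\<close>
    have eq: "c t = mat 1 + t *\<^sub>R (N t ** A)" if "\<bar>t\<bar> < e" for t
    proof -
      have "L (- t) = L t + t *\<^sub>R A" by (simp add: L_def algebra_simps flip: scaleR_left_distrib)
      then show ?thesis using N[OF that] by (simp add: c_def matrix_mult_distribs)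
    qed
    have N0: "N 0 = mat 1" using N[of 0] e by (simp add: L_def)
    have "N \<midarrow>0\<rightarrow> N 0"
      using contN e continuous_on_eq_continuous_at[of "{-e<..<e}" N] by (auto simp: isCont_def)
    then have "(\<lambda>t. N t ** A) \<midarrow>0\<rightarrow> N 0 ** A"
      by (rule bounded_bilinear.tendsto[OF bounded_bilinear_matrix_mult _ tendsto_const])
    then have lim: "(\<lambda>t. N t ** A) \<midarrow>0\<rightarrow> A" by (simp add: N0)
    have "(\<lambda>t. norm (N t ** A - A)) \<midarrow>0\<rightarrow> 0"
      using tendsto_norm[OF tendsto_diff[OF lim tendsto_const[of A]]] by simp
    then have "(\<lambda>t. norm (c t - c 0 - (t - 0) *\<^sub>R A) / norm (t - 0)) \<midarrow>0\<rightarrow> 0"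
    proof (rule Lim_transform_eventually)
      have "\<forall>\<^sub>F t in at (0::real). t \<noteq> 0 \<and> \<bar>t\<bar> < e"
        using e by (auto simp: eventually_at intro!: exI[of _ e])
      then show "\<forall>\<^sub>F t in at 0. norm (N t ** A - A) = norm (c t - c 0 - (t - 0) *\<^sub>R A) / norm (t - 0)"
        by eventually_elim (simp add: eq c0 flip: scaleR_diff_right)
    qed
    then show ?thesis
      by (simp add: has_vector_derivative_def has_derivative_iff_norm bounded_linear_scaleR_left)
  qed
  have inv: "c t ** c (- t) = mat 1" if "\<bar>t\<bar> < e" for t
  proof -
    have "c t ** c (- t) = N t ** (L (- t) ** N (- t)) ** L t" by (simp add: c_def matrix_mul_assoc)
    then show ?thesis using N[of "- t"] N[of t] that by simp
  qed
  have "c t \<in> aut_real Q" if t: "\<bar>t\<bar> < e" for t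
  proof -
    \<comment> \<open>Since \<open>A\<close> is skew for the form, moving \<open>L s\<close> across
      \<open>gram Q\<close> turns it into \<open>L (- s)\<close>; numerator and denominator of the
      Cayley transform then cancel.\<close>
    have LQ: "transpose (L s) ** gram Q = gram Q ** L (- s)" for s
      using A by (simp add: isometry_algebra_def L_def transpose_simps transpose_scalar matrix_mult_distribs)
    have "transpose (c t) ** gram Q ** c t = transpose (N t) ** (transpose (L (- t)) ** gram Q) ** c t"
      by (simp add: c2[OF t] matrix_transpose_mul matrix_mul_assoc)
    also have "\<dots> = transpose (N t) ** gram Q ** (L t ** N t) ** L (- t)"
      by (simp add: LQ c_def matrix_mul_assoc)
    also have "\<dots> = transpose (N t) ** (gram Q ** L (- t))" by (simp add: N[OF t] matrix_mul_assoc)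
    also have "\<dots> = transpose (L t ** N t) ** gram Q"
      by (simp add: matrix_transpose_mul matrix_mul_assoc flip: LQ)
    finally have "transpose (c t) ** gram Q ** c t = gram Q" by (simp add: N[OF t])
    moreover have "invertible (c t)" using inv[OF t] invertible_def matrix_left_right_inverse by blast
    ultimately show ?thesis by (simp add: aut_real_iff)
  qed
  then show thesis using that[of e c] e c0 deriv contc inv by blast
qed

section \<open>The isometry group or its identity component, and its Lie algebra\<close>

definition isometry_group :: "int^'m^'m \<Rightarrow> (real^'m^'m) set \<Rightarrow> bool" where
  "isometry_group Q G \<longleftrightarrow> G = aut_real Q \<or> G = connected_component_set (aut_real Q) (mat 1)"

lemma isometry_group_subset: "isometry_group Q G \<Longrightarrow> g \<in> G \<Longrightarrow> g \<in> aut_real Q"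
  using connected_component_in by (fastforce simp: isometry_group_def)

lemma mat_1_aut_real: "mat 1 \<in> aut_real Q"
  by (auto simp: aut_real_iff invertible_def intro: exI[of _ "mat 1"])

lemma mat_1_isometry_group: "isometry_group Q G \<Longrightarrow> mat 1 \<in> G"
  using mat_1_aut_real by (auto simp: isometry_group_def)

text \<open>The Cayley curve, continued by 1 outside its interval. For the identity component, the
  arc \<open>c s ** g\<close> is connected and passes through \<open>g\<close>, so it stays in the
  component. Left multiplication of a general \<open>g\<close> is what later moves arbitrary points
  along an orbit.\<close>

lemma isometry_group_curve:
  fixes Q :: "int^'m^'m"
  assumes G: "isometry_group Q G" and A: "A \<in> isometry_algebra Q"
  obtains c where "c 0 = mat 1" "(c has_vector_derivative A) (at (0::real))"
    "\<And>t. c t ** c (- t) = mat 1" "\<And>t g. g \<in> G \<Longrightarrow> c t ** g \<in> G"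
proof -
  obtain c e where c: "e > 0" "c 0 = mat 1" "(c has_vector_derivative A) (at 0)"
    "continuous_on {-e<..<e} c" "\<And>t. \<bar>t\<bar> < e \<Longrightarrow> c t \<in> aut_real Q"
    "\<And>t. \<bar>t\<bar> < e \<Longrightarrow> c t ** c (- t) = mat 1" using cayley_curve[OF A] by metis
  define d where "d t = (if \<bar>t\<bar> < e then c t else mat 1)" for t
  have in_G: "c t ** g \<in> G" if t: "\<bar>t\<bar> < e" and g: "g \<in> G" for t g
  proof (cases "G = aut_real Q")
    case True
    then show ?thesis using aut_real_mult c(5)[OF t] g by blast
  next
    case False
    then have G': "G = connected_component_set (aut_real Q) (mat 1)"
      using G by (simp add: isometry_group_def)
    then have comp: "connected_component (aut_real Q) (mat 1) g" using g by simp
    let ?S = "(\<lambda>s. c s ** g) ` {-e<..<e}"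
    have "connected ?S"
      by (intro connected_continuous_image bounded_bilinear.continuous_on[OF bounded_bilinear_matrix_mult]
          c(4) continuous_on_const) simp
    moreover have "g \<in> ?S" using c(1,2) by (intro image_eqI[of _ _ 0]) auto
    moreover have "c t ** g \<in> ?S" using t by (intro image_eqI[of _ _ t]) auto
    moreover have "?S \<subseteq> aut_real Q"
      using c(5) aut_real_mult connected_component_in[OF comp] by force
    ultimately have "connected_component (aut_real Q) g (c t ** g)"
      unfolding connected_component_def by blast
    then show ?thesis using connected_component_trans[OF comp] G' by simp
  qed
  have "\<forall>\<^sub>F t in at (0::real). \<bar>t\<bar> < e"
    using c(1) by (auto simp: eventually_at intro!: exI[of _ e])
  then have "\<forall>\<^sub>F t in at 0. c t = d t" by eventually_elim (simp add: d_def)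
  then have "(d has_vector_derivative A) (at 0)"
    using has_derivative_transform_eventually[OF c(3)[unfolded has_vector_derivative_def], of d] c(1)
    by (simp add: has_vector_derivative_def d_def)
  moreover have "d 0 = mat 1" using c(1,2) by (simp add: d_def)
  moreover have "d t ** d (- t) = mat 1" for t using c(6) by (simp add: d_def)
  moreover have "d t ** g \<in> G" if "g \<in> G" for t g using in_G that by (simp add: d_def)
  ultimately show thesis using that by blast
qed

text \<open>One inclusion differentiates the isometry equation, the other is the Cayley curve; since
  that curve stays in the identity component, both choices of \<open>G\<close> have the same Lie
  algebra.\<close>

lemma lie_algebra_isometry_group:
  fixes Q :: "int^'m^'m"
  assumes G: "isometry_group Q G"
  shows "lie_algebra G = isometry_algebra Q"
proof (intro set_eqI iffI)
  fix A assume "A \<in> lie_algebra G"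
  then obtain c where c: "c 0 = mat 1" "\<And>t. c t \<in> G" "(c has_vector_derivative A) (at 0)"
    by (auto simp: lie_algebra_def tangent_space_def curve_through_def)
  have eq: "transpose (c t) ** gram Q ** c t = gram Q" for t
    using isometry_group_subset[OF G c(2)] by (simp add: aut_real_iff)
  have "linear (transpose :: real^'m^'m \<Rightarrow> real^'m^'m)"
    by (simp add: linear_iff transpose_simps transpose_scalar)
  then have tr: "bounded_linear (transpose :: real^'m^'m \<Rightarrow> real^'m^'m)"
    by (rule linear_conv_bounded_linear[THEN iffD1])
  have 1: "((\<lambda>t. transpose (c t)) has_vector_derivative transpose A) (at 0)"
    by (rule bounded_linear.has_vector_derivative[OF tr c(3)])
  have 2: "((\<lambda>t. transpose (c t) ** gram Q) has_vector_derivative transpose A ** gram Q) (at 0)"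
    by (rule bounded_linear.has_vector_derivative[OF bounded_bilinear.bounded_linear_left[OF bounded_bilinear_matrix_mult] 1])
  have "((\<lambda>t. transpose (c t) ** gram Q ** c t) has_vector_derivative
      transpose (c 0) ** gram Q ** A + transpose A ** gram Q ** c 0) (at 0)"
    by (rule bounded_bilinear.has_vector_derivative[OF bounded_bilinear_matrix_mult 2 c(3)])
  moreover have "((\<lambda>t. transpose (c t) ** gram Q ** c t) has_vector_derivative 0) (at 0)"
    by (simp add: eq)
  ultimately have "transpose (c 0) ** gram Q ** A + transpose A ** gram Q ** c 0 = 0"
    by (rule vector_derivative_unique_at)
  then show "A \<in> isometry_algebra Q"
    by (simp add: c(1) isometry_algebra_def eq_neg_iff_add_eq_0 add.commute)
next
  fix A assume "A \<in> isometry_algebra Q"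
  then obtain c where c: "c 0 = mat 1" "(c has_vector_derivative A) (at (0::real))"
    "\<And>t. c t ** c (- t) = mat 1" "\<And>t g. g \<in> G \<Longrightarrow> c t ** g \<in> G"
    using isometry_group_curve[OF G] by metis
  have "c t \<in> G" for t using c(4)[OF mat_1_isometry_group[OF G], of t] by simp
  then show "A \<in> lie_algebra G"
    using c by (auto simp: lie_algebra_def tangent_space_def curve_through_def)
qed

lemma lie_subalgebra_isometry_algebra: "lie_subalgebra (isometry_algebra Q)"
proof
  show "subspace (isometry_algebra Q)"
    by (simp add: subspace_def isometry_algebra_def transpose_simps transpose_scalar matrix_mult_distribs)
  fix A B assume AB: "A \<in> isometry_algebra Q" "B \<in> isometry_algebra Q"
  have *: "transpose (X ** Y) ** gram Q = gram Q ** Y ** X"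
    if "X \<in> isometry_algebra Q" "Y \<in> isometry_algebra Q" for X Y
  proof -
    have X: "transpose X ** gram Q = - (gram Q ** X)" "transpose Y ** gram Q = - (gram Q ** Y)"
      using that by (auto simp: isometry_algebra_def)
    have "transpose (X ** Y) ** gram Q = transpose Y ** (transpose X ** gram Q)"
      by (simp add: matrix_transpose_mul matrix_mul_assoc)
    also have "\<dots> = - (transpose Y ** gram Q) ** X"
      by (simp add: X(1) matrix_mult_distribs matrix_mul_assoc)
    finally show ?thesis by (simp add: X(2) matrix_mult_distribs)
  qed
  show "commutator A B \<in> isometry_algebra Q"
    using *[OF AB] *[OF AB(2) AB(1)]
    by (simp add: isometry_algebra_def commutator_def transpose_simps matrix_mult_distribs matrix_mul_assoc)
qed

section \<open>The conjugation action and its orbits\<close>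

lemma act_mult:
  assumes "invertible a" "invertible b"
  shows "act (a ** b) E = act a (act b E)"
proof -
  have "(a ** b) ** (matrix_inv b ** matrix_inv a) = a ** (b ** matrix_inv b) ** matrix_inv a"
    by (simp add: matrix_mul_assoc)
  then have "matrix_inv (a ** b) = matrix_inv b ** matrix_inv a"
    using assms by (intro matrix_inv_eqI) (simp add: matrix_inv_inverse)
  then show ?thesis by (simp add: act_def cplx_mat_simps matrix_mul_assoc)
qed

lemma cplx_mat_inv:
  assumes "invertible g"
  shows "cplx_mat g ** cplx_mat (matrix_inv g) = mat 1" "cplx_mat (matrix_inv g) ** cplx_mat g = mat 1"
  using assms by (simp_all add: matrix_inv_inverse cplx_mat_simps flip: cplx_mat_simps(1))

lemma act_simps:
  "act g (A + B) = act g A + act g B" "act g (A - B) = act g A - act g B" "act g (- A) = - act g A"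
  "act g (k *\<^sub>R A) = k *\<^sub>R act g A" "act g 0 = 0" "act g (cscale c A) = cscale c (act g A)"
  by (simp_all add: act_def matrix_mult_distribs cscale_simps)

lemma act_mult_right:
  assumes "invertible g"
  shows "act g (A ** B) = act g A ** act g B"
proof -
  have "act g A ** act g B = cplx_mat g ** A ** (cplx_mat (matrix_inv g) ** cplx_mat g) ** B ** cplx_mat (matrix_inv g)"
    by (simp add: act_def matrix_mul_assoc)
  then show ?thesis using assms by (simp add: cplx_mat_inv act_def matrix_mul_assoc)
qed

lemma act_mat_1: "invertible g \<Longrightarrow> act g (mat 1) = mat 1"
  by (simp add: act_def cplx_mat_inv)

lemma act_commutator: "invertible g \<Longrightarrow> act g (commutator A B) = commutator (act g A) (act g B)"
  by (simp add: commutator_def act_simps act_mult_right)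

lemma conj_mat_act: "conj_mat (act g A) = act g (conj_mat A)"
  by (simp add: act_def conj_mat_simps)

lemma act_inverse:
  assumes "invertible g"
  shows "act g (act (matrix_inv g) A) = A" "act (matrix_inv g) (act g A) = A"
proof -
  have inv: "matrix_inv (matrix_inv g) = g" using assms by (intro matrix_inv_eqI) (simp add: matrix_inv_inverse)
  have "act g (act (matrix_inv g) A) =
     (cplx_mat g ** cplx_mat (matrix_inv g)) ** A ** (cplx_mat g ** cplx_mat (matrix_inv g))"
    by (simp add: act_def inv matrix_mul_assoc)
  then show "act g (act (matrix_inv g) A) = A" using assms by (simp add: cplx_mat_inv)
  have "act (matrix_inv g) (act g A) =
     (cplx_mat (matrix_inv g) ** cplx_mat g) ** A ** (cplx_mat (matrix_inv g) ** cplx_mat g)"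
    by (simp add: act_def inv matrix_mul_assoc)
  then show "act (matrix_inv g) (act g A) = A" using assms by (simp add: cplx_mat_inv)
qed

text \<open>The infinitesimal action: the inverse of \<open>c t\<close> is \<open>c (- t)\<close>,
  so the product rule applied to \<open>c t\<close>, \<open>E\<close>, \<open>c (- t)\<close> yields
  the commutator without differentiating matrix inversion.\<close>

lemma commutator_in_tangent_space_orbit:
  fixes Q :: "int^'m^'m"
  assumes G: "isometry_group Q G" and A: "A \<in> isometry_algebra Q" and E: "E \<in> (\<lambda>g. act g E0) ` G"
  shows "commutator (cplx_mat A) E \<in> tangent_space ((\<lambda>g. act g E0) ` G) E"
proof -
  obtain g where g: "g \<in> G" "E = act g E0" using E by blast
  obtain c where c: "c 0 = mat 1" "(c has_vector_derivative A) (at (0::real))"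
    "\<And>t. c t ** c (- t) = mat 1" "\<And>t g. g \<in> G \<Longrightarrow> c t ** g \<in> G"
    using isometry_group_curve[OF G A] by metis
  have inv: "invertible (c t)" for t
    using c(3) invertible_def matrix_left_right_inverse by blast
  have inv_g: "invertible g" using isometry_group_subset[OF G g(1)] by (simp add: aut_real_iff)
  have bl: "bounded_linear cplx_mat" using linear_cplx_mat by (rule linear_conv_bounded_linear[THEN iffD1])
  have act: "act (c t) E = cplx_mat (c t) ** E ** cplx_mat (c (- t))" for t
    by (simp add: act_def matrix_inv_eqI[OF c(3)])
  have d1: "((\<lambda>t. cplx_mat (c t)) has_vector_derivative cplx_mat A) (at 0)"
    by (rule bounded_linear.has_vector_derivative[OF bl c(2)])
  have "((\<lambda>t. c (- t)) has_vector_derivative (- 1) *\<^sub>R A) (at 0)"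
    using vector_diff_chain_at[of uminus "- 1" 0 c A] c(2)
      has_vector_derivative_minus[OF has_vector_derivative_id[of "at 0"]]
    by (simp add: o_def)
  then have "((\<lambda>t. cplx_mat (c (- t))) has_vector_derivative cplx_mat ((- 1) *\<^sub>R A)) (at 0)"
    by (rule bounded_linear.has_vector_derivative[OF bl])
  then have d2: "((\<lambda>t. cplx_mat (c (- t))) has_vector_derivative - cplx_mat A) (at 0)"
    by (simp add: cplx_mat_simps)
  have d3: "((\<lambda>t. cplx_mat (c t) ** E) has_vector_derivative cplx_mat A ** E) (at 0)"
    by (rule bounded_linear.has_vector_derivative[OF bounded_bilinear.bounded_linear_left[OF bounded_bilinear_matrix_mult] d1])
  have "((\<lambda>t. act (c t) E) has_vector_derivative
     cplx_mat (c 0) ** E ** (- cplx_mat A) + cplx_mat A ** E ** cplx_mat (c (- 0))) (at 0)"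
    unfolding act by (rule bounded_bilinear.has_vector_derivative[OF bounded_bilinear_matrix_mult d3 d2])
  then have "((\<lambda>t. act (c t) E) has_vector_derivative commutator (cplx_mat A) E) (at 0)"
    by (simp add: c(1) cplx_mat_simps commutator_def matrix_mult_distribs)
  moreover have "act (c t) E \<in> (\<lambda>g. act g E0) ` G" for t
    using c(4)[OF g(1)] by (auto simp: g(2) act_mult[OF inv inv_g, symmetric])
  moreover have "act (c 0) E = E" using act[of 0] by (simp add: c(1) cplx_mat_simps)
  ultimately show ?thesis by (auto simp: tangent_space_def curve_through_def)
qed

section \<open>Symmetry types\<close>

text \<open>Elements of the Lie algebra have type \<open>(1, -1)\<close>, tangent vectors of \<open>D\<close> have type
  \<open>(-1, -1)\<close>, and tangent vectors of \<open>D\<^sub>1\<close> have type \<open>((-1)\<^sup>n, (-1)\<^sup>n)\<close>.\<close>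

definition has_type :: "int^'m^'m \<Rightarrow> real \<Rightarrow> real \<Rightarrow> complex^'m^'m \<Rightarrow> bool" where
  "has_type Q e d M \<longleftrightarrow> conj_mat M = e *\<^sub>R M \<and> transpose M ** gram Q = d *\<^sub>R (gram Q ** M)"

lemma has_type_add: "has_type Q e d A \<Longrightarrow> has_type Q e d B \<Longrightarrow> has_type Q e d (A + B)"
  and has_type_diff: "has_type Q e d A \<Longrightarrow> has_type Q e d B \<Longrightarrow> has_type Q e d (A - B)"
  and has_type_scaleR: "has_type Q e d A \<Longrightarrow> has_type Q e d (k *\<^sub>R A)"
  and has_type_cscale_i: "has_type Q e d A \<Longrightarrow> has_type Q (- e) d (cscale \<i> A)"
  by (simp_all add: has_type_def conj_mat_simps transpose_simps transpose_scalar transpose_cscale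
      matrix_mult_distribs cscale_simps algebra_simps scaleR_diff_right)

lemma has_type_transpose_mult:
  assumes "has_type Q e d A" "has_type Q e' d' B"
  shows "transpose (A ** B) ** gram Q = (d * d') *\<^sub>R (gram Q ** B ** A)"
proof -
  have "transpose (A ** B) ** gram Q = transpose B ** (transpose A ** gram Q)"
    by (simp add: matrix_transpose_mul matrix_mul_assoc)
  also have "\<dots> = d *\<^sub>R (transpose B ** gram Q ** A)"
    using assms by (simp add: has_type_def matrix_mult_distribs matrix_mul_assoc)
  finally show ?thesis using assms by (simp add: has_type_def matrix_mult_distribs)
qed

text \<open>Transposition reverses both products of the commutator, which costs the extra sign in
  the second entry of the type.\<close>

lemma has_type_commutator:
  assumes "has_type Q e d A" "has_type Q e' d' B"
  shows "has_type Q (e * e') (- (d * d')) (commutator A B)"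
  using has_type_transpose_mult[OF assms] has_type_transpose_mult[OF assms(2,1)] assms
  by (simp add: has_type_def commutator_def conj_mat_simps transpose_simps matrix_mult_distribs
      matrix_mul_assoc scaleR_diff_right mult.commute)

lemma has_type_isometry_algebra: "A \<in> isometry_algebra Q \<longleftrightarrow> has_type Q 1 (- 1) (cplx_mat A)"
proof -
  have "has_type Q 1 (- 1) (cplx_mat A) \<longleftrightarrow> cplx_mat (transpose A ** gram Q) = cplx_mat (- (gram Q ** A))"
    by (simp only: has_type_def cplx_mat_simps conj_mat_simps) simp
  then show ?thesis by (simp add: isometry_algebra_def)
qed

lemma has_type_re_mat:
  assumes "has_type Q 1 (- 1) M"
  shows "cplx_mat (re_mat M) = M" "re_mat M \<in> isometry_algebra Q"
  using assms cplx_re_mat[of M] by (simp_all add: has_type_isometry_algebra) (simp_all add: has_type_def)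

lemma has_type_act:
  assumes g: "g \<in> aut_real Q" and M: "has_type Q e d M"
  shows "has_type Q e d (act g M)"
proof -
  let ?g = "cplx_mat g" and ?h = "cplx_mat (matrix_inv g)" and ?Q = "gram Q :: complex^'a^'a"
  have inv: "?g ** ?h = mat 1" "?h ** ?g = mat 1"
    using g by (simp_all add: aut_real_iff cplx_mat_inv)
  have tinv: "transpose ?h ** transpose ?g = mat 1"
    using inv(1) by (metis matrix_transpose_mul transpose_mat)
  have "cplx_mat (transpose g ** gram Q ** g) = gram Q"
    using g by (simp add: aut_real_iff cplx_mat_simps)
  then have Q: "transpose ?g ** ?Q ** ?g = ?Q" by (simp add: cplx_mat_simps)
  have 1: "transpose ?g ** ?Q = ?Q ** ?h"
    by (metis Q inv(1) matrix_mul_assoc matrix_mul_rid)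
  have 2: "transpose ?h ** ?Q = ?Q ** ?g"
    by (metis Q tinv matrix_mul_assoc matrix_mul_lid)
  have "transpose (act g M) ** ?Q = transpose ?h ** transpose M ** (transpose ?g ** ?Q)"
    by (simp add: act_def matrix_transpose_mul matrix_mul_assoc)
  also have "\<dots> = transpose ?h ** (transpose M ** ?Q) ** ?h" by (simp add: 1 matrix_mul_assoc)
  also have "\<dots> = d *\<^sub>R ((transpose ?h ** ?Q) ** M ** ?h)"
    using M by (simp add: has_type_def matrix_mult_distribs matrix_mul_assoc)
  also have "\<dots> = d *\<^sub>R (?Q ** act g M)" by (simp add: 2 act_def matrix_mul_assoc)
  finally show ?thesis using M by (simp add: has_type_def conj_mat_act act_simps)
qed

text \<open>A type is a linear condition, hence inherited by velocities. The constant
  \<open>k\<close> will be n/2 times the identity on \<open>D\<close> and 1/2 times the identity on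
  \<open>D1\<close>: only the shifted points have a type.\<close>

lemma has_type_derivative:
  assumes c: "(c has_vector_derivative v) (at (0::real))" and t: "\<And>t. has_type Q e d (c t - k)"
  shows "has_type Q e d v"
proof -
  have der: "((\<lambda>t. c t - k) has_vector_derivative v) (at 0)"
    using has_vector_derivative_diff[OF c has_vector_derivative_const] by simp
  have lin: "linear (\<lambda>M :: complex^'a^'a. conj_mat M - e *\<^sub>R M)"
    "linear (\<lambda>M :: complex^'a^'a. transpose M ** gram Q - d *\<^sub>R (gram Q ** M))"
    by (simp_all add: linear_iff conj_mat_simps transpose_simps transpose_scalar matrix_mult_distribs algebra_simps)
  have L: "L v = 0" if "linear L" "\<And>t. L (c t - k) = 0" for L :: "complex^'a^'a \<Rightarrow> complex^'a^'a"
  proof -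
    have "((\<lambda>t. L (c t - k)) has_vector_derivative L v) (at 0)"
      using that(1) linear_conv_bounded_linear bounded_linear.has_vector_derivative[OF _ der] by blast
    then have "((\<lambda>t. 0) has_vector_derivative L v) (at 0)" using that(2) by simp
    then show ?thesis using vector_derivative_unique_at has_vector_derivative_const by blast
  qed
  have "conj_mat v - e *\<^sub>R v = 0"
    by (rule L[OF lin(1)]) (use t in \<open>simp add: has_type_def\<close>)
  moreover have "transpose v ** gram Q - d *\<^sub>R (gram Q ** v) = 0"
    by (rule L[OF lin(2)]) (use t in \<open>simp add: has_type_def\<close>)
  ultimately show ?thesis by (simp add: has_type_def)
qed

section \<open>Spectral projections of Hodge decompositions\<close>

text \<open>The algebraic part of a polarized Hodge structure: the eigenspaces of \<open>E\<close>
  for 0, ..., n span, and both complex conjugation and the adjoint for the form send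
  \<open>E\<close> to \<open>n - E\<close>. Centring at n/2 turns these two reflections into
  signs.\<close>

definition hodge_operator :: "nat \<Rightarrow> int^'m^'m \<Rightarrow> complex^'m^'m \<Rightarrow> bool" where
  "hodge_operator n Q E \<longleftrightarrow>
     (\<forall>v. \<exists>w. (\<forall>r\<le>n. w r \<in> hcomp E r) \<and> v = (\<Sum>r\<le>n. w r)) \<and>
     has_type Q (- 1) (- 1) (E - (real n / 2) *\<^sub>R mat 1)"

text \<open>The Lagrange interpolation polynomial that is 1 at the node \<open>r\<close> and 0 at
  the other listed nodes, evaluated at the matrix \<open>E\<close>.\<close>

primrec lagrange_product :: "nat \<Rightarrow> complex^'m^'m \<Rightarrow> nat list \<Rightarrow> complex^'m^'m" where
  "lagrange_product r E [] = mat 1"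
| "lagrange_product r E (s # ss) =
     (if s = r then mat 1 else (1 / (real r - real s)) *\<^sub>R (E - real s *\<^sub>R mat 1)) ** lagrange_product r E ss"

text \<open>As polynomials in \<open>E\<close>, the spectral projections depend smoothly on \<open>E\<close>.\<close>

definition spectral_proj :: "nat \<Rightarrow> complex^'m^'m \<Rightarrow> nat \<Rightarrow> complex^'m^'m" where
  "spectral_proj n E r = lagrange_product r E [0..<Suc n]"

text \<open>Functional calculus: this is w(E). Indicator functions give the projectors onto the
  filtration steps and onto \<open>H^+\<close>, and \<open>w = real\<close> gives back
  \<open>E\<close>.\<close>

definition spectral_sum :: "nat \<Rightarrow> complex^'m^'m \<Rightarrow> (nat \<Rightarrow> real) \<Rightarrow> complex^'m^'m" where
  "spectral_sum n E w = (\<Sum>r\<le>n. w r *\<^sub>R spectral_proj n E r)"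

lemma scaleR_mult_vec: "(k *\<^sub>R A) *v v = k *\<^sub>R (A *v v)"
  and mult_vec_scaleR: "A *v (k *\<^sub>R v) = k *\<^sub>R (A *v v)"
  and mult_vec_scale: "A *v (c *s v) = c *s (A *v v)"
  for A :: "complex^'m^'m"
  by (simp_all add: vec_eq_iff matrix_vector_mult_def scaleR_sum_right sum_distrib_left mult_ac)

lemma sum_mult_vec: "(\<Sum>i\<in>I. f i) *v v = (\<Sum>i\<in>I. f i *v v)"
  and mult_vec_sum: "A *v (\<Sum>i\<in>I. g i) = (\<Sum>i\<in>I. A *v g i)"
  for A :: "complex^'m^'m"
  by (induction I rule: infinite_finite_induct) (simp_all add: algebra_simps)

lemma bounded_bilinear_matrix_vector_mult:
  "bounded_bilinear (\<lambda>(M::complex^'m^'m) v. M *v v)"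
proof -
  have "bilinear (\<lambda>(M::complex^'m^'m) v. M *v v)"
    by (auto simp: bilinear_def linear_iff algebra_simps scaleR_mult_vec mult_vec_scaleR)
  then show ?thesis using bilinear_conv_bounded_bilinear by blast
qed

lemma lagrange_product_eigenvector:
  assumes "v \<in> hcomp E t"
  shows "lagrange_product r E ss *v v =
    (\<Prod>s\<leftarrow>ss. if s = r then 1 else (real t - real s) / (real r - real s)) *\<^sub>R v"
proof (induction ss)
  case (Cons s ss)
  have "E *v v = real t *\<^sub>R v"
    using assms by (simp add: hcomp_def vec_eq_iff scaleR_conv_of_real[where 'a = complex])
  then show ?case
    using Cons by (simp add: scaleR_mult_vec mult_vec_scaleR matrix_vector_mult_diff_rdistrib
        flip: matrix_vector_mul_assoc scaleR_diff_left)
qed simp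

lemma spectral_proj_eigenvector:
  assumes "v \<in> hcomp E t" "t \<le> n"
  shows "spectral_proj n E r *v v = (if r = t then v else 0)"
proof (cases "r = t")
  case True
  have *: "(\<Prod>s\<leftarrow>ss. if s = t then 1 else (real t - real s) / (real t - real s)) = 1" for ss
    by (induction ss) auto
  show ?thesis
    unfolding spectral_proj_def lagrange_product_eigenvector[OF assms(1)] True * by simp
next
  case False
  have "(\<Prod>s\<leftarrow>[0..<Suc n]. if s = r then 1 else (real t - real s) / (real r - real s)) = 0"
    using False assms(2) by (auto simp: prod_list_zero_iff simp del: upt_Suc intro!: image_eqI[of _ _ t])
  with False show ?thesis
    unfolding spectral_proj_def lagrange_product_eigenvector[OF assms(1)] by simp
qed

lemma hodge_operator_eqI:
  fixes A B :: "complex^'m^'m"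
  assumes "hodge_operator n Q E" "\<And>t v. t \<le> n \<Longrightarrow> v \<in> hcomp E t \<Longrightarrow> A *v v = B *v v"
  shows "A = B"
  unfolding matrix_eq
proof
  fix v
  obtain w where "\<forall>r\<le>n. w r \<in> hcomp E r" "v = (\<Sum>r\<le>n. w r)"
    using assms(1) unfolding hodge_operator_def by metis
  then show "A *v v = B *v v" using assms(2) by (simp only: mult_vec_sum) (rule sum.cong, auto)
qed

lemma spectral_proj_in_hcomp:
  assumes "hodge_operator n Q E" "r \<le> n"
  shows "spectral_proj n E r *v v \<in> hcomp E r"
proof -
  obtain w where "\<forall>r\<le>n. w r \<in> hcomp E r" "v = (\<Sum>r\<le>n. w r)"
    using assms(1) unfolding hodge_operator_def by metis
  then have "spectral_proj n E r *v v = (\<Sum>i\<le>n. if i = r then w i else 0)"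
    by (simp only: mult_vec_sum) (rule sum.cong, auto simp: spectral_proj_eigenvector)
  then show ?thesis
    using assms(2) \<open>\<forall>r\<le>n. w r \<in> hcomp E r\<close> by simp
qed

lemma spectral_proj_mult:
  assumes "hodge_operator n Q E" "r \<le> n" "s \<le> n"
  shows "spectral_proj n E r ** spectral_proj n E s = (if r = s then spectral_proj n E r else 0)"
  by (rule hodge_operator_eqI[OF assms(1)])
    (simp add: spectral_proj_eigenvector flip: matrix_vector_mul_assoc)

lemma sum_spectral_proj:
  assumes "hodge_operator n Q E"
  shows "(\<Sum>r\<le>n. spectral_proj n E r) = mat 1"
  by (rule hodge_operator_eqI[OF assms]) (simp add: sum_mult_vec spectral_proj_eigenvector)

lemma operator_spectral_proj:
  assumes "hodge_operator n Q E" "r \<le> n"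
  shows "E ** spectral_proj n E r = real r *\<^sub>R spectral_proj n E r"
    "spectral_proj n E r ** E = real r *\<^sub>R spectral_proj n E r"
proof -
  have *: "E *v v = real t *\<^sub>R v" if "v \<in> hcomp E t" for v t
    using that by (simp add: hcomp_def vec_eq_iff scaleR_conv_of_real[where 'a = complex])
  show "E ** spectral_proj n E r = real r *\<^sub>R spectral_proj n E r"
    by (rule hodge_operator_eqI[OF assms(1)])
      (simp add: spectral_proj_eigenvector scaleR_mult_vec * flip: matrix_vector_mul_assoc)
  show "spectral_proj n E r ** E = real r *\<^sub>R spectral_proj n E r"
    by (rule hodge_operator_eqI[OF assms(1)])
      (simp add: spectral_proj_eigenvector scaleR_mult_vec mult_vec_scaleR * flip: matrix_vector_mul_assoc)
qed

text \<open>The spectral projections sum to 1, so a matrix is the sum of its blocks. Block (s, t) is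
  the part mapping degree \<open>t\<close> to degree \<open>s\<close>; most identities below are
  verified by comparing the scalars in front of each block.\<close>

lemma matrix_block_eqI:
  assumes "hodge_operator n Q E"
    "\<And>s t. s \<le> n \<Longrightarrow> t \<le> n \<Longrightarrow>
       spectral_proj n E s ** A ** spectral_proj n E t = spectral_proj n E s ** B ** spectral_proj n E t"
  shows "A = B"
proof -
  have *: "M = (\<Sum>s\<le>n. \<Sum>t\<le>n. spectral_proj n E s ** M ** spectral_proj n E t)" for M
  proof -
    have "(\<Sum>s\<le>n. \<Sum>t\<le>n. spectral_proj n E s ** M ** spectral_proj n E t) =
      (\<Sum>s\<le>n. spectral_proj n E s) ** M ** (\<Sum>t\<le>n. spectral_proj n E t)"
      by (simp add: matrix_mult_sum_left matrix_mult_sum_right) (rule sum.swap)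
    then show ?thesis by (simp add: sum_spectral_proj[OF assms(1)])
  qed
  show ?thesis by (subst *[of A], subst *[of B]) (simp add: assms(2))
qed

lemma spectral_proj_sum:
  assumes "hodge_operator n Q E" "s \<le> n"
  shows "spectral_proj n E s ** spectral_sum n E w = w s *\<^sub>R spectral_proj n E s"
    "spectral_sum n E w ** spectral_proj n E s = w s *\<^sub>R spectral_proj n E s"
  using assms
  by (simp_all add: spectral_sum_def matrix_mult_sum_left matrix_mult_sum_right matrix_mult_distribs
      spectral_proj_mult[OF assms(1)] if_distrib if_distribR cong: if_cong)

lemma spectral_sum_mult:
  assumes "hodge_operator n Q E"
  shows "spectral_sum n E w ** spectral_sum n E w' = spectral_sum n E (\<lambda>r. w r * w' r)"
proof -
  have "spectral_sum n E w ** X = (\<Sum>r\<le>n. w r *\<^sub>R (spectral_proj n E r ** X))"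
    for X :: "complex^'a^'a"
    unfolding spectral_sum_def by (simp add: matrix_mult_sum_left matrix_mult_scaleR_left)
  then show ?thesis
    by (simp add: spectral_proj_sum[OF assms]) (simp add: spectral_sum_def)
qed

lemma spectral_sum_operator:
  assumes "hodge_operator n Q E"
  shows "spectral_sum n E real = E"
proof -
  have "E = (\<Sum>r\<le>n. E ** spectral_proj n E r)"
    by (simp add: sum_spectral_proj[OF assms] flip: matrix_mult_sum_right)
  then show ?thesis by (simp add: spectral_sum_def operator_spectral_proj[OF assms])
qed

lemma scaleR_half_double: "(r / 2) *\<^sub>R x + (r / 2) *\<^sub>R x = r *\<^sub>R x" for x :: "'b::real_vector"
  by (simp flip: scaleR_left_distrib)

lemma conj_mat_operator:
  assumes "hodge_operator n Q E"
  shows "conj_mat E = real n *\<^sub>R mat 1 - E"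
proof -
  let ?h = "(real n / 2) *\<^sub>R mat 1 :: complex^'a^'a"
  have "conj_mat E - ?h = ?h - E"
    using assms by (simp add: hodge_operator_def has_type_def conj_mat_simps)
  then have "conj_mat E = (?h + ?h) - E" by (simp add: diff_eq_eq)
  then show ?thesis by (simp only: scaleR_half_double)
qed

lemma transpose_operator:
  assumes "hodge_operator n Q E"
  shows "transpose E ** gram Q = real n *\<^sub>R gram Q - gram Q ** E"
proof -
  let ?h = "(real n / 2) *\<^sub>R gram Q :: complex^'a^'a"
  have "transpose E ** gram Q - ?h = ?h - gram Q ** E"
    using assms by (simp add: hodge_operator_def has_type_def transpose_simps transpose_scalar matrix_mult_distribs)
  then have "transpose E ** gram Q = (?h + ?h) - gram Q ** E"
    by (simp add: diff_eq_eq)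
  then show ?thesis by (simp only: scaleR_half_double)
qed

text \<open>Conjugation turns \<open>E\<close> into \<open>n - E\<close>, so the conjugate of
  projection \<open>r\<close> takes values in degree \<open>n - r\<close>. Inserting a resolution of
  the identity on the left, and then completing the sum over conjugates, leaves the projection of
  degree \<open>n - r\<close>.\<close>

lemma conj_spectral_proj:
  assumes E: "hodge_operator n Q E" and r: "r \<le> n"
  shows "conj_mat (spectral_proj n E r) = spectral_proj n E (n - r)"
proof -
  let ?P = "spectral_proj n E"
  have C: "E ** conj_mat (?P s) = real (n - s) *\<^sub>R conj_mat (?P s)" if "s \<le> n" for s
  proof -
    have "conj_mat (E ** ?P s) = conj_mat (real s *\<^sub>R ?P s)" using operator_spectral_proj(1)[OF E that] by simp
    then have "real n *\<^sub>R conj_mat (?P s) - E ** conj_mat (?P s) = real s *\<^sub>R conj_mat (?P s)"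
      by (simp add: conj_mat_simps conj_mat_operator[OF E] matrix_mult_distribs)
    then show ?thesis using that by (simp add: of_nat_diff algebra_simps)
  qed
  have zero: "?P s ** conj_mat (?P t) = 0" if st: "s \<le> n" "t \<le> n" "s \<noteq> n - t" for s t
  proof -
    have "?P s ** E ** conj_mat (?P t) = ?P s ** (E ** conj_mat (?P t))" by (simp add: matrix_mul_assoc)
    then have "real s *\<^sub>R (?P s ** conj_mat (?P t)) = real (n - t) *\<^sub>R (?P s ** conj_mat (?P t))"
      using st by (simp add: C operator_spectral_proj(2)[OF E] matrix_mult_distribs)
    then show ?thesis using st(3) by simp
  qed
  have "conj_mat (?P r) = (\<Sum>s\<le>n. ?P s) ** conj_mat (?P r)" by (simp add: sum_spectral_proj[OF E])
  also have "\<dots> = (\<Sum>s\<le>n. if s = n - r then ?P s ** conj_mat (?P r) else 0)"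
    unfolding matrix_mult_sum_left using zero r by (intro sum.cong) auto
  also have "\<dots> = ?P (n - r) ** conj_mat (?P r)" by simp
  also have "\<dots> = (\<Sum>t\<le>n. if t = r then ?P (n - r) ** conj_mat (?P t) else 0)" using r by simp
  also have "\<dots> = (\<Sum>t\<le>n. ?P (n - r) ** conj_mat (?P t))"
    using zero[of "n - r"] r by (intro sum.cong) (auto simp: eq_diff_iff)
  also have "\<dots> = ?P (n - r) ** conj_mat (\<Sum>t\<le>n. ?P t)"
    by (simp add: matrix_mult_sum_right linear_sum[OF linear_conj_mat])
  finally show ?thesis by (simp add: sum_spectral_proj[OF E] conj_mat_simps)
qed

text \<open>The orthogonality of \<open>H^r\<close> and \<open>H^s\<close> for s different from n -
  r, as a matrix identity; the argument is that for conjugation with the adjoint of \<open>E\<close>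
  in place of its conjugate.\<close>

lemma transpose_spectral_proj:
  assumes E: "hodge_operator n Q E" and r: "r \<le> n"
  shows "transpose (spectral_proj n E r) ** gram Q = gram Q ** spectral_proj n E (n - r)"
proof -
  let ?P = "spectral_proj n E" and ?Q = "gram Q :: complex^'a^'a"
  have zero: "transpose (?P s) ** ?Q ** ?P t = 0" if st: "s \<le> n" "t \<le> n" "s \<noteq> n - t" for s t
  proof -
    have "transpose (?P s) ** transpose E = real s *\<^sub>R transpose (?P s)"
      using operator_spectral_proj(1)[OF E st(1)] by (metis matrix_transpose_mul transpose_scalar)
    then have "real s *\<^sub>R (transpose (?P s) ** ?Q ** ?P t) = transpose (?P s) ** (transpose E ** ?Q) ** ?P t"
      by (simp add: matrix_mult_distribs matrix_mul_assoc)
    also have "\<dots> = real n *\<^sub>R (transpose (?P s) ** ?Q ** ?P t) - transpose (?P s) ** ?Q ** (E ** ?P t)"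
      by (simp add: transpose_operator[OF E] matrix_mult_distribs matrix_mul_assoc)
    also have "\<dots> = real (n - t) *\<^sub>R (transpose (?P s) ** ?Q ** ?P t)"
      using st by (simp add: operator_spectral_proj(1)[OF E] matrix_mult_distribs of_nat_diff algebra_simps)
    finally show ?thesis using st(3) by simp
  qed
  have "transpose (?P r) ** ?Q = transpose (?P r) ** ?Q ** (\<Sum>t\<le>n. ?P t)" by (simp add: sum_spectral_proj[OF E])
  also have "\<dots> = (\<Sum>t\<le>n. if t = n - r then transpose (?P r) ** ?Q ** ?P t else 0)"
    unfolding matrix_mult_sum_right using zero[OF r] r by (intro sum.cong) (auto simp: le_diff_conv2)
  also have "\<dots> = transpose (?P r) ** ?Q ** ?P (n - r)" by simp
  also have "\<dots> = (\<Sum>s\<le>n. if s = r then transpose (?P s) ** ?Q ** ?P (n - r) else 0)" using r by simp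
  also have "\<dots> = (\<Sum>s\<le>n. transpose (?P s) ** ?Q ** ?P (n - r))"
    using zero[of _ "n - r"] r by (intro sum.cong) auto
  also have "\<dots> = transpose (\<Sum>s\<le>n. ?P s) ** ?Q ** ?P (n - r)"
    by (simp add: matrix_mult_sum_left transpose_sum)
  finally show ?thesis by (simp add: sum_spectral_proj[OF E])
qed

lemma sum_reverse_atMost: "(\<Sum>r\<le>n. f (n - r)) = (\<Sum>r\<le>n. f r)" for f :: "nat \<Rightarrow> 'b::comm_monoid_add"
  by (rule sum.reindex_bij_witness[of _ "\<lambda>r. n - r" "\<lambda>r. n - r"]) auto

lemma conj_spectral_sum:
  assumes "hodge_operator n Q E"
  shows "conj_mat (spectral_sum n E w) = spectral_sum n E (\<lambda>r. w (n - r))"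
proof -
  have "conj_mat (spectral_sum n E w) = (\<Sum>r\<le>n. w (n - (n - r)) *\<^sub>R spectral_proj n E (n - r))"
    by (simp add: spectral_sum_def linear_sum[OF linear_conj_mat] conj_mat_simps conj_spectral_proj[OF assms])
  also have "\<dots> = spectral_sum n E (\<lambda>r. w (n - r))"
    unfolding spectral_sum_def by (rule sum_reverse_atMost)
  finally show ?thesis .
qed

lemma transpose_spectral_sum:
  assumes "hodge_operator n Q E"
  shows "transpose (spectral_sum n E w) ** gram Q = gram Q ** spectral_sum n E (\<lambda>r. w (n - r))"
proof -
  have "transpose (spectral_sum n E w) ** gram Q = (\<Sum>r\<le>n. w (n - (n - r)) *\<^sub>R (gram Q ** spectral_proj n E (n - r)))"
    by (simp add: spectral_sum_def transpose_sum transpose_scalar matrix_mult_sum_left matrix_mult_distribs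
        transpose_spectral_proj[OF assms])
  also have "\<dots> = (\<Sum>r\<le>n. w (n - r) *\<^sub>R (gram Q ** spectral_proj n E r))"
    by (rule sum_reverse_atMost)
  finally show ?thesis by (simp add: spectral_sum_def matrix_mult_sum_right matrix_mult_distribs)
qed

section \<open>Smoothness and equivariance of the functional calculus\<close>

lemma smooth_on_lagrange_product:
  assumes "smooth_on S f"
  shows "smooth_on S (\<lambda>x. lagrange_product r (f x) ss)"
proof (induction ss)
  case Nil
  then show ?case by (simp add: smooth_on_const)
next
  case (Cons s ss)
  have "smooth_on S (\<lambda>x. if s = r then mat 1 else (1 / (real r - real s)) *\<^sub>R (f x - real s *\<^sub>R mat 1))"
    by (cases "s = r")
      (auto intro!: smooth_on_const smooth_on_linear_comp[OF bounded_linear_scaleR_right] smooth_on_diff assms)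
  then show ?case
    by (simp only: lagrange_product.simps) (rule smooth_on_bilinear[OF bounded_bilinear_matrix_mult _ Cons])
qed

lemma smooth_on_spectral_sum:
  "smooth_on S f \<Longrightarrow> smooth_on S (\<lambda>x. spectral_sum n (f x) w)"
  unfolding spectral_sum_def spectral_proj_def
  by (intro smooth_on_sum smooth_on_linear_comp[OF bounded_linear_scaleR_right] smooth_on_lagrange_product)

lemma act_spectral_sum:
  assumes g: "invertible g"
  shows "spectral_sum n (act g E) w = act g (spectral_sum n E w)"
proof -
  have "lagrange_product r (act g E) ss = act g (lagrange_product r E ss)" for r ss
    by (induction ss) (simp_all add: act_mult_right[OF g] act_simps act_mat_1[OF g])
  moreover have "linear (act g)" by (simp add: linear_iff act_simps)
  ultimately show ?thesis
    by (simp add: spectral_sum_def spectral_proj_def linear_sum act_simps)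
qed

text \<open>\<open>g\<close> carries eigenvectors of \<open>E\<close> to eigenvectors of
  \<open>act g E\<close>, and the type survives because \<open>g\<close> is real and preserves the
  form.\<close>

lemma hodge_operator_act:
  assumes g: "g \<in> aut_real Q" and E: "hodge_operator n Q E"
  shows "hodge_operator n Q (act g E)"
proof -
  let ?g = "cplx_mat g" and ?h = "cplx_mat (matrix_inv g)"
  have inv_g: "invertible g" using g by (simp add: aut_real_iff)
  have inv: "?g ** ?h = mat 1" "?h ** ?g = mat 1" using cplx_mat_inv[OF inv_g] by auto
  have dec: "\<exists>w. (\<forall>r\<le>n. w r \<in> hcomp (act g E) r) \<and> v = (\<Sum>r\<le>n. w r)" for v
  proof -
    obtain w where w: "\<forall>r\<le>n. w r \<in> hcomp E r" "?h *v v = (\<Sum>r\<le>n. w r)"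
      using E unfolding hodge_operator_def by metis
    have "v = ?g *v (?h *v v)" by (simp add: matrix_vector_mul_assoc inv)
    then have "v = (\<Sum>r\<le>n. ?g *v w r)" by (simp add: w(2) mult_vec_sum)
    moreover have "?g *v w r \<in> hcomp (act g E) r" if "r \<le> n" for r
    proof -
      have "act g E *v (?g *v w r) = ?g *v (E *v ((?h ** ?g) *v w r))"
        by (simp add: act_def matrix_vector_mul_assoc matrix_mul_assoc)
      then show ?thesis using w(1) that by (simp add: inv hcomp_def mult_vec_scale)
    qed
    ultimately show ?thesis by (intro exI[of _ "\<lambda>r. ?g *v w r"]) simp
  qed
  have eq: "act g E - (real n / 2) *\<^sub>R mat 1 = act g (E - (real n / 2) *\<^sub>R mat 1)"
    by (simp add: act_simps act_mat_1[OF inv_g])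
  have ty: "has_type Q (- 1) (- 1) (act g (E - (real n / 2) *\<^sub>R mat 1))"
    using E by (intro has_type_act[OF g]) (simp add: hodge_operator_def)
  show ?thesis
    unfolding hodge_operator_def eq using dec ty by (intro conjI allI)
qed

text \<open>Both symmetries are checked on eigenvectors: Hodge symmetry of the summands gives the
  conjugate of \<open>E\<close>, and their orthogonality relations give its adjoint.\<close>

lemma hodge_decomposition_operator:
  fixes Q :: "int^'m^'m"
  assumes "E \<in> hodge_decompositions n Q h"
  shows "hodge_operator n Q E"
proof -
  have E: "polarized_hodge_structure n Q h (hcomp E)" using assms by (simp add: hodge_decompositions_def)
  have span: "\<exists>w. (\<forall>r\<le>n. w r \<in> hcomp E r) \<and> v = (\<Sum>r\<le>n. w r)" for v
    using E unfolding polarized_hodge_structure_def by metis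
  have conj: "hcomp E r = conj_vec ` hcomp E (n - r)" if "r \<le> n" for r
    using E that unfolding polarized_hodge_structure_def by blast
  have orth: "bilin (gram Q) x y = 0" if "a \<le> n" "b \<le> n" "b \<noteq> n - a" "x \<in> hcomp E a" "y \<in> hcomp E b" for a b x y
    using E that unfolding polarized_hodge_structure_def bil_eq_bilin by blast
  have eig: "E *v v = of_nat t *s v" if "v \<in> hcomp E t" for v t using that by (simp add: hcomp_def)
  have conj_eq: "conj_mat E = real n *\<^sub>R mat 1 - E"
  proof -
    have "conj_mat E *v v = (real n *\<^sub>R mat 1 - E) *v v" for v
    proof -
      obtain w where w: "\<forall>r\<le>n. w r \<in> hcomp E r" "v = (\<Sum>r\<le>n. w r)" using span by blast
      have "conj_mat E *v w r = (real n *\<^sub>R mat 1 - E) *v w r" if r: "r \<le> n" for r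
      proof -
        obtain u where u: "u \<in> hcomp E (n - r)" "w r = conj_vec u" using w(1) conj[OF r] r by auto
        have "conj_mat E *v w r = conj_vec (E *v u)" by (simp add: u(2) conj_vec_mult)
        also have "\<dots> = real (n - r) *\<^sub>R w r"
          by (simp add: eig[OF u(1)] u(2) conj_vec_def vec_eq_iff scaleR_conv_of_real[where 'a = complex])
        also have "\<dots> = (real n *\<^sub>R mat 1 - E) *v w r"
        proof -
          have "w r \<in> hcomp E r" using w(1) r by blast
          then show ?thesis using r
            by (simp add: matrix_vector_mult_diff_rdistrib scaleR_mult_vec eig of_nat_diff vec_eq_iff
                scaleR_conv_of_real[where 'a = complex] algebra_simps)
        qed
        finally show ?thesis .
      qed
      then show ?thesis by (simp only: w(2) mult_vec_sum) (rule sum.cong, auto)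
    qed
    then show ?thesis by (simp add: matrix_eq)
  qed
  have tr: "transpose E ** gram Q = gram Q ** (real n *\<^sub>R mat 1 - E)"
  proof (rule bilin_eqI)
    fix x y :: "complex^'m"
    obtain u where u: "\<forall>r\<le>n. u r \<in> hcomp E r" "x = (\<Sum>r\<le>n. u r)" using span by blast
    obtain w where w: "\<forall>r\<le>n. w r \<in> hcomp E r" "y = (\<Sum>r\<le>n. w r)" using span by blast
    have "bilin (transpose E ** gram Q) x y = (\<Sum>a\<le>n. \<Sum>b\<le>n. bilin (transpose E ** gram Q) (u a) (w b))"
      unfolding u(2) w(2) by (subst bilin_sum(1), subst bilin_sum(2)) simp
    also have "\<dots> = (\<Sum>a\<le>n. \<Sum>b\<le>n. bilin (gram Q ** (real n *\<^sub>R mat 1 - E)) (u a) (w b))"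
    proof (intro sum.cong refl)
      fix a b assume ab: "a \<in> {..n}" "b \<in> {..n}"
      then have uw: "u a \<in> hcomp E a" "w b \<in> hcomp E b" using u w by auto
      have "bilin (transpose E ** gram Q) (u a) (w b) = of_nat a * bilin (gram Q) (u a) (w b)"
        by (simp add: bilin_mult_left[symmetric] eig[OF uw(1)] bilin_add)
      moreover have "(real n *\<^sub>R mat 1 - E) *v w b = of_nat (n - b) *s w b"
        using ab by (simp add: matrix_vector_mult_diff_rdistrib scaleR_mult_vec eig[OF uw(2)] of_nat_diff vec_eq_iff
                scaleR_conv_of_real[where 'a = complex] algebra_simps)
      then have "bilin (gram Q ** (real n *\<^sub>R mat 1 - E)) (u a) (w b) = of_nat (n - b) * bilin (gram Q) (u a) (w b)"
        by (simp add: bilin_mult_right[symmetric] bilin_add)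
      \<comment> \<open>Either the degrees are dual, and the factors \<open>a\<close> and
        \<open>n - b\<close> coincide, or the pairing vanishes.\<close>
      moreover have "b = n - a \<or> bilin (gram Q) (u a) (w b) = 0"
        using orth[OF _ _ _ uw] ab by auto
      ultimately show "bilin (transpose E ** gram Q) (u a) (w b) = bilin (gram Q ** (real n *\<^sub>R mat 1 - E)) (u a) (w b)"
        using ab by auto
    qed
    also have "\<dots> = bilin (gram Q ** (real n *\<^sub>R mat 1 - E)) x y"
      unfolding u(2) w(2) by (subst bilin_sum(1), subst bilin_sum(2)) simp
    finally show "bilin (transpose E ** gram Q) x y = bilin (gram Q ** (real n *\<^sub>R mat 1 - E)) x y" .
  qed
  have "has_type Q (- 1) (- 1) (E - (real n / 2) *\<^sub>R mat 1)"
  proof -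
    let ?h = "(real n / 2) *\<^sub>R mat 1 :: complex^'m^'m"
    have cancel: "a + a - x - a = - (x - a)" for a x :: "complex^'m^'m" by simp
    have 1: "conj_mat E = ?h + ?h - E" by (simp only: scaleR_half_double conj_eq)
    have 2: "transpose E ** gram Q = gram Q ** (?h + ?h - E)" by (simp only: scaleR_half_double tr)
    have "conj_mat (E - ?h) = - (E - ?h)"
      by (simp only: conj_mat_simps 1 conj_mat_simps(7) cancel)
    moreover have "transpose (E - ?h) ** gram Q = - (gram Q ** (E - ?h))"
      by (simp only: transpose_simps transpose_scalar transpose_mat matrix_mult_diff_left 2 matrix_mult_diff_right
          matrix_mult_add_right matrix_mult_scaleR_left matrix_mult_scaleR_right matrix_mul_lid matrix_mul_rid cancel)
    ultimately show ?thesis by (simp add: has_type_def)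
  qed
  then show ?thesis using span by (simp add: hodge_operator_def)
qed

text \<open>Nondegeneracy over the complex numbers, from the polarization: a nonzero component of
  \<open>X *v v\<close> in degree \<open>r\<close> pairs nontrivially with its conjugate, while that
  conjugate lies in degree \<open>n - r\<close> and is orthogonal to all other components.\<close>

lemma gram_mult_eq_0:
  fixes Q :: "int^'m^'m" and X :: "complex^'m^'m"
  assumes "E \<in> hodge_decompositions n Q h" "gram Q ** X = 0"
  shows "X = 0"
proof -
  have E: "polarized_hodge_structure n Q h (hcomp E)" using assms(1) by (simp add: hodge_decompositions_def)
  have "X *v v = 0" for v
  proof -
    obtain w where w: "\<forall>r\<le>n. w r \<in> hcomp E r" "X *v v = (\<Sum>r\<le>n. w r)"
      using E unfolding polarized_hodge_structure_def by metis
    have "w r = 0" if r: "r \<le> n" for r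
    proof (rule ccontr)
      assume "w r \<noteq> 0"
      let ?z = "conj_vec (w r)"
      have z: "?z \<in> hcomp E (n - r)"
      proof -
        have "hcomp E r = conj_vec ` hcomp E (n - r)"
          using E r unfolding polarized_hodge_structure_def by blast
        then obtain u where "u \<in> hcomp E (n - r)" "w r = conj_vec u" using w(1) r by blast
        then show ?thesis by simp
      qed
      have "?z \<noteq> 0" using \<open>w r \<noteq> 0\<close> by (auto simp: vec_eq_iff conj_vec_def)
      have "\<forall>r\<le>n. \<forall>x\<in>hcomp E r. x \<noteq> 0 \<longrightarrow> Re (\<i> powi (int r - int (n - r)) * bil Q x (conj_vec x)) > 0"
        using E unfolding polarized_hodge_structure_def by blast
      then have "Re (\<i> powi (int (n - r) - int (n - (n - r))) * bil Q ?z (conj_vec ?z)) > 0"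
        using z \<open>?z \<noteq> 0\<close> diff_le_self by blast
      then have "bilin (gram Q) ?z (w r) \<noteq> 0" by (auto simp: bil_eq_bilin)
      moreover have "bilin (gram Q) ?z (w r) = (\<Sum>s\<le>n. if s = r then bilin (gram Q) ?z (w s) else 0)"
        using r by simp
      also have "\<dots> = (\<Sum>s\<le>n. bilin (gram Q) ?z (w s))"
      proof (intro sum.cong refl)
        fix s assume s: "s \<in> {..n}"
        have "\<forall>r\<le>n. \<forall>r'\<le>n. r' \<noteq> n - r \<longrightarrow> (\<forall>x\<in>hcomp E r. \<forall>y\<in>hcomp E r'. bilin (gram Q) x y = 0)"
          using E unfolding polarized_hodge_structure_def bil_eq_bilin by blast
        then have "s \<noteq> r \<Longrightarrow> bilin (gram Q) ?z (w s) = 0"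
          using z w(1) s r by (metis atMost_iff diff_diff_cancel diff_le_self)
        then show "(if s = r then bilin (gram Q) ?z (w s) else 0) = bilin (gram Q) ?z (w s)" by simp
      qed
      also have "\<dots> = bilin (gram Q) ?z (X *v v)" by (simp add: w(2) bilin_sum)
      also have "\<dots> = 0" unfolding bilin_mult_right assms(2) by (simp add: bilin_def)
      ultimately show False by simp
    qed
    then show ?thesis by (simp add: w(2))
  qed
  then show ?thesis by (simp add: matrix_eq)
qed

section \<open>Filtration and parity subspaces as images of spectral projectors\<close>

lemma hcomp_subset_hsum: "r \<in> I \<Longrightarrow> finite I \<Longrightarrow> v \<in> hcomp E r \<Longrightarrow> v \<in> hsum E I"
  unfolding hsum_def
  by (auto intro!: exI[of _ "\<lambda>s. if s = r then v else 0"] simp: hcomp_def)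

lemma spectral_sum_eigenvector:
  assumes "v \<in> hcomp E t" "t \<le> n"
  shows "spectral_sum n E w *v v = w t *\<^sub>R v"
proof -
  have "spectral_sum n E w *v v = (\<Sum>r\<le>n. if r = t then w t *\<^sub>R v else 0)"
    unfolding spectral_sum_def sum_mult_vec
    by (rule sum.cong) (auto simp: scaleR_mult_vec spectral_proj_eigenvector[OF assms])
  then show ?thesis using assms by simp
qed

lemma spectral_sum_hsum:
  assumes "I \<subseteq> {..n}" "v \<in> hsum E I"
  shows "spectral_sum n E (indicator J) *v v = (\<Sum>r\<in>I. indicator J r *\<^sub>R (spectral_proj n E r *v v))"
    "v = (\<Sum>r\<in>I. spectral_proj n E r *v v)"
proof -
  obtain u where u: "v = (\<Sum>r\<in>I. u r)" "\<forall>r\<in>I. u r \<in> hcomp E r"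
    using assms(2) by (auto simp: hsum_def)
  have fin: "finite I" using assms(1) finite_subset by blast
  have proj: "spectral_proj n E r *v v = u r" if "r \<in> I" for r
  proof -
    have "spectral_proj n E r *v v = (\<Sum>s\<in>I. if s = r then u r else 0)"
      unfolding u(1) mult_vec_sum
      using u(2) assms(1)
      by (intro sum.cong refl)
        (metis atMost_iff subsetD spectral_proj_eigenvector)
    then show ?thesis using that fin by simp
  qed
  have "spectral_sum n E (indicator J) *v v = (\<Sum>r\<in>I. indicator J r *\<^sub>R u r)"
    unfolding u(1) mult_vec_sum
    using u(2) assms(1) by (intro sum.cong) (auto simp: spectral_sum_eigenvector)
  also have "\<dots> = (\<Sum>r\<in>I. indicator J r *\<^sub>R (spectral_proj n E r *v v))"
    by (rule sum.cong) (auto simp: proj)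
  finally show "spectral_sum n E (indicator J) *v v = (\<Sum>r\<in>I. indicator J r *\<^sub>R (spectral_proj n E r *v v))" .
  show "v = (\<Sum>r\<in>I. spectral_proj n E r *v v)"
    using proj u(1) by simp
qed

text \<open>Membership in a varying subspace becomes a fixed point equation for a projector
  depending smoothly on \<open>E\<close>, and such an equation can be differentiated along
  curves.\<close>

lemma hsum_iff:
  assumes "hodge_operator n Q E" "I \<subseteq> {..n}"
  shows "v \<in> hsum E I \<longleftrightarrow> spectral_sum n E (indicator I) *v v = v"
proof
  assume v: "v \<in> hsum E I"
  have "spectral_sum n E (indicator I) *v v = (\<Sum>r\<in>I. spectral_proj n E r *v v)"
    unfolding spectral_sum_hsum(1)[OF assms(2) v] by (rule sum.cong) auto
  then show "spectral_sum n E (indicator I) *v v = v"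
    using spectral_sum_hsum(2)[OF assms(2) v] by simp
next
  assume "spectral_sum n E (indicator I) *v v = v"
  moreover have "spectral_sum n E (indicator I) *v v = (\<Sum>r\<le>n. indicator I r *\<^sub>R (spectral_proj n E r *v v))"
    by (simp add: spectral_sum_def sum_mult_vec scaleR_mult_vec)
  moreover have "\<dots> = (\<Sum>r\<in>I. spectral_proj n E r *v v)"
    using assms(2) by (intro sum.mono_neutral_cong_right) auto
  ultimately have v: "v = (\<Sum>r\<in>I. spectral_proj n E r *v v)" by simp
  moreover have "\<forall>r\<in>I. spectral_proj n E r *v v \<in> hcomp E r"
    using assms spectral_proj_in_hcomp by blast
  ultimately show "v \<in> hsum E I" unfolding hsum_def
    by (intro CollectI exI[of _ "\<lambda>r. spectral_proj n E r *v v"]) simp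
qed

definition plus_indices :: "nat \<Rightarrow> nat set" where
  "plus_indices n = {r. r \<le> n \<and> even (n - r)}"

text \<open>Every eigenvector of degree at most \<open>n\<close> lies in \<open>hplus\<close> or in
  \<open>hminus\<close>, according to the parity of \<open>n - t\<close>. Since these eigenvectors
  span, the description in \<open>hodge_proj\<close> has exactly one solution.\<close>

lemma hodge_proj_eq:
  assumes E: "hodge_operator n Q E"
  shows "hodge_proj n E = spectral_sum n E (indicator (plus_indices n))"
  unfolding hodge_proj_def
proof (rule the_equality)
  show "(\<forall>v\<in>hplus n E. spectral_sum n E (indicator (plus_indices n)) *v v = v) \<and>
    (\<forall>v\<in>hminus n E. spectral_sum n E (indicator (plus_indices n)) *v v = 0)"
  proof (intro conjI ballI)
    fix v assume "v \<in> hplus n E"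
    then show "spectral_sum n E (indicator (plus_indices n)) *v v = v"
      using hsum_iff[OF E, of "plus_indices n" v] by (auto simp: hplus_def plus_indices_def)
  next
    fix v assume v: "v \<in> hminus n E"
    show "spectral_sum n E (indicator (plus_indices n)) *v v = 0"
      by (subst spectral_sum_hsum(1)[OF _ v[unfolded hminus_def]])
        (auto simp: plus_indices_def intro!: sum.neutral)
  qed
  fix P assume P: "(\<forall>v\<in>hplus n E. P *v v = v) \<and> (\<forall>v\<in>hminus n E. P *v v = 0)"
  show "P = spectral_sum n E (indicator (plus_indices n))"
  proof (rule hodge_operator_eqI[OF E])
    fix t v assume t: "t \<le> n" "v \<in> hcomp E t"
    show "P *v v = spectral_sum n E (indicator (plus_indices n)) *v v"
    proof (cases "even (n - t)")
      case True
      then have "v \<in> hplus n E" using t by (auto simp: hplus_def intro: hcomp_subset_hsum)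
      then show ?thesis using P True t by (simp add: spectral_sum_eigenvector plus_indices_def)
    next
      case False
      then have "v \<in> hminus n E" using t by (auto simp: hminus_def intro: hcomp_subset_hsum)
      then show ?thesis using P False t by (simp add: spectral_sum_eigenvector plus_indices_def)
    qed
  qed
qed

lemma hfil_iff:
  assumes "hodge_operator n Q E"
  shows "v \<in> hfil n E r \<longleftrightarrow> spectral_sum n E (indicator {r..n}) *v v = v"
  unfolding hfil_def by (rule hsum_iff[OF assms]) auto

section \<open>First-order perturbation of spectral projectors\<close>

lemma spectral_sum_differentiable:
  assumes "(c has_vector_derivative A) (at (0::real))"
  obtains X where "((\<lambda>t. spectral_sum n (c t) w) has_vector_derivative X) (at 0)"
proof -
  have "curve_through UNIV (c 0) A c" using assms by (simp add: curve_through_def)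
  from differential_curve[OF smooth_on_spectral_sum[OF smooth_on_id] this] show thesis
    using that by blast
qed

text \<open>The first claim differentiates the relation that \<open>E\<close> commutes with w(E) and
  compresses to block (s, t). It says nothing for s = t; there, differentiating the idempotency of
  w(E), valid since \<open>w\<close> takes the values 0 and 1, makes the block vanish.\<close>

lemma spectral_sum_derivative:
  assumes c: "\<And>t. hodge_operator n Q (c t)" "c 0 = E" "(c has_vector_derivative A) (at (0::real))"
    and X: "((\<lambda>t. spectral_sum n (c t) w) has_vector_derivative X) (at 0)"
    and w: "\<And>r. r \<le> n \<Longrightarrow> w r = 0 \<or> w r = 1"
    and st: "s \<le> n" "t \<le> n"
  shows "(real s - real t) *\<^sub>R (spectral_proj n E s ** X ** spectral_proj n E t) =
      (w s - w t) *\<^sub>R (spectral_proj n E s ** A ** spectral_proj n E t)"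
    and "spectral_proj n E s ** X ** spectral_proj n E s = 0"
proof -
  note E = c(1)[of 0, unfolded c(2)]
  let ?P = "spectral_proj n E" and ?F = "spectral_sum n E w"
  have "c t ** spectral_sum n (c t) w = spectral_sum n (c t) w ** c t" for t
    using spectral_sum_mult[OF c(1)[of t], of real w] spectral_sum_mult[OF c(1)[of t], of w real]
    by (simp add: spectral_sum_operator[OF c(1)] mult.commute)
  then have "((\<lambda>t. c t ** spectral_sum n (c t) w) has_vector_derivative spectral_sum n (c 0) w ** A + X ** c 0) (at 0)"
    using bounded_bilinear.has_vector_derivative[OF bounded_bilinear_matrix_mult X c(3)] by simp
  moreover have "((\<lambda>t. c t ** spectral_sum n (c t) w) has_vector_derivative c 0 ** X + A ** spectral_sum n (c 0) w) (at 0)"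
    by (rule bounded_bilinear.has_vector_derivative[OF bounded_bilinear_matrix_mult c(3) X])
  ultimately have eq: "E ** X + A ** ?F = ?F ** A + X ** E"
    using vector_derivative_unique_at c(2) by blast
  have "?P s ** (E ** X + A ** ?F) ** ?P t = real s *\<^sub>R (?P s ** X ** ?P t) + w t *\<^sub>R (?P s ** A ** ?P t)"
    using operator_spectral_proj(2)[OF E st(1)] spectral_proj_sum(2)[OF E st(2), of w]
    by (simp add: matrix_mult_distribs matrix_mul_assoc)
      (simp add: matrix_mult_distribs flip: matrix_mul_assoc)
  moreover have "?P s ** (?F ** A + X ** E) ** ?P t = w s *\<^sub>R (?P s ** A ** ?P t) + real t *\<^sub>R (?P s ** X ** ?P t)"
    using operator_spectral_proj(1)[OF E st(2)] spectral_proj_sum(1)[OF E st(1), of w]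
    by (simp add: matrix_mult_distribs matrix_mul_assoc)
      (simp add: matrix_mult_distribs flip: matrix_mul_assoc)
  ultimately show "(real s - real t) *\<^sub>R (?P s ** X ** ?P t) = (w s - w t) *\<^sub>R (?P s ** A ** ?P t)"
    using eq by (simp add: algebra_simps)
  have "spectral_sum n (c t) w ** spectral_sum n (c t) w = spectral_sum n (c t) w" for t
  proof -
    have "w r * w r = w r" if "r \<le> n" for r using w[OF that] by auto
    then show ?thesis
      unfolding spectral_sum_mult[OF c(1)] by (auto simp: spectral_sum_def intro!: sum.cong)
  qed
  then have "((\<lambda>t. spectral_sum n (c t) w) has_vector_derivative
      spectral_sum n (c 0) w ** X + X ** spectral_sum n (c 0) w) (at 0)"
    using bounded_bilinear.has_vector_derivative[OF bounded_bilinear_matrix_mult X X] by simp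
  then have eq2: "?F ** X + X ** ?F = X" using X vector_derivative_unique_at c(2) by blast
  have "?P s ** (?F ** X + X ** ?F) ** ?P s = (2 * w s) *\<^sub>R (?P s ** X ** ?P s)"
    using spectral_proj_sum(1)[OF E st(1), of w] spectral_proj_sum(2)[OF E st(1), of w]
    by (simp add: matrix_mult_distribs matrix_mul_assoc)
      (simp add: matrix_mult_distribs flip: matrix_mul_assoc scaleR_left_distrib)
  \<comment> \<open>The factor is 1 or -1, because \<open>w s\<close> is 1 or 0.\<close>
  then have "(2 * w s - 1) *\<^sub>R (?P s ** X ** ?P s) = 0"
    using eq2 by (simp add: algebra_simps)
  then show "?P s ** X ** ?P s = 0" using w[OF st(1)] by auto
qed

text \<open>The eigenvalues stay fixed along the curve. Differentiating P_s E = s P_s and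
  compressing to block (s, s), the two terms with the derivative of the projection cancel.\<close>

lemma tangent_diagonal:
  assumes c: "\<And>t. hodge_operator n Q (c t)" "c 0 = E" "(c has_vector_derivative A) (at (0::real))"
    and s: "s \<le> n"
  shows "spectral_proj n E s ** A ** spectral_proj n E s = 0"
proof -
  note E = c(1)[of 0, unfolded c(2)]
  let ?P = "spectral_proj n E"
  have sp: "spectral_sum n (c t) (indicator {s}) = spectral_proj n (c t) s" for t
  proof -
    have "spectral_sum n (c t) (indicator {s}) = (\<Sum>r\<le>n. if r = s then spectral_proj n (c t) r else 0)"
      unfolding spectral_sum_def by (rule sum.cong) auto
    then show ?thesis using s by simp
  qed
  obtain X where X: "((\<lambda>t. spectral_proj n (c t) s) has_vector_derivative X) (at 0)"
    using spectral_sum_differentiable[OF c(3), of n "indicator {s}"] unfolding sp by blast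
  have "((\<lambda>t. spectral_proj n (c t) s ** c t) has_vector_derivative ?P s ** A + X ** E) (at 0)"
    using bounded_bilinear.has_vector_derivative[OF bounded_bilinear_matrix_mult X c(3)] by (simp add: c(2))
  moreover have "((\<lambda>t. spectral_proj n (c t) s ** c t) has_vector_derivative real s *\<^sub>R X) (at 0)"
    unfolding operator_spectral_proj(2)[OF c(1) s]
    by (rule bounded_linear.has_vector_derivative[OF bounded_linear_scaleR_right X])
  ultimately have eq: "?P s ** A + X ** E = real s *\<^sub>R X" by (rule vector_derivative_unique_at)
  have "?P s ** (?P s ** A + X ** E) ** ?P s = ?P s ** A ** ?P s + real s *\<^sub>R (?P s ** X ** ?P s)"
    using spectral_proj_mult[OF E s s] operator_spectral_proj(1)[OF E s]
    by (simp add: matrix_mult_distribs matrix_mul_assoc)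
      (simp add: matrix_mult_distribs flip: matrix_mul_assoc)
  then show ?thesis using eq by (simp add: matrix_mult_distribs)
qed

section \<open>Horizontal tangent vectors\<close>

text \<open>Horizontal tangent vectors at \<open>E\<close> turn out to have this form.\<close>

definition adjacent_blocks :: "nat \<Rightarrow> complex^'m^'m \<Rightarrow> complex^'m^'m \<Rightarrow> bool" where
  "adjacent_blocks n E A \<longleftrightarrow> (\<forall>s\<le>n. \<forall>t\<le>n. s \<noteq> Suc t \<longrightarrow> t \<noteq> Suc s \<longrightarrow>
     spectral_proj n E s ** A ** spectral_proj n E t = 0)"

lemma block_commutator_operator:
  assumes "hodge_operator n Q E" "s \<le> n" "t \<le> n"
  shows "spectral_proj n E s ** commutator A E ** spectral_proj n E t =
    (real t - real s) *\<^sub>R (spectral_proj n E s ** A ** spectral_proj n E t)"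
  using operator_spectral_proj(1)[OF assms(1,3)] operator_spectral_proj(2)[OF assms(1,2)]
  by (simp add: commutator_def matrix_mult_distribs matrix_mul_assoc)
    (simp add: matrix_mult_distribs scaleR_diff_left flip: matrix_mul_assoc)

lemma block_commutator_sum:
  assumes "hodge_operator n Q E" "s \<le> n" "t \<le> n"
  shows "spectral_proj n E s ** commutator A (spectral_sum n E w) ** spectral_proj n E t =
    (w t - w s) *\<^sub>R (spectral_proj n E s ** A ** spectral_proj n E t)"
  using spectral_proj_sum(2)[OF assms(1,3), of w] spectral_proj_sum(1)[OF assms(1,2), of w]
  by (simp add: commutator_def matrix_mult_distribs matrix_mul_assoc)
    (simp add: matrix_mult_distribs scaleR_diff_left flip: matrix_mul_assoc)

text \<open>Perturbation theory divides block (s, t) by s - t, whereas the commutator with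
  \<open>E\<close> multiplies it by t - s. On adjacent degrees these agree up to a sign, which the
  outer commutator with the projector absorbs; elsewhere both sides vanish.\<close>

lemma hodge_proj_derivative:
  assumes c: "\<And>t. hodge_operator n Q (c t)" "c 0 = E" "(c has_vector_derivative A) (at (0::real))"
    and adj: "adjacent_blocks n E A"
  shows "((\<lambda>t. hodge_proj n (c t)) has_vector_derivative
           commutator (commutator A E) (hodge_proj n E)) (at 0)"
proof -
  note E = c(1)[of 0, unfolded c(2)]
  let ?P = "spectral_proj n E"
  let ?w = "indicator (plus_indices n) :: nat \<Rightarrow> real"
  obtain X where X: "((\<lambda>t. spectral_sum n (c t) ?w) has_vector_derivative X) (at 0)"
    using spectral_sum_differentiable[OF c(3)] by blast
  have w: "?w r = 0 \<or> ?w r = 1" for r by (simp add: indicator_def)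
  have "X = commutator (commutator A E) (spectral_sum n E ?w)"
  proof (rule matrix_block_eqI[OF E])
    fix s t assume st: "s \<le> n" "t \<le> n"
    have X1: "(real s - real t) *\<^sub>R (?P s ** X ** ?P t) = (?w s - ?w t) *\<^sub>R (?P s ** A ** ?P t)"
      using spectral_sum_derivative(1)[OF c X w st] .
    have X0: "?P s ** X ** ?P s = 0"
      using spectral_sum_derivative(2)[OF c X w st] .
    have R: "?P s ** commutator (commutator A E) (spectral_sum n E ?w) ** ?P t =
        ((?w t - ?w s) * (real t - real s)) *\<^sub>R (?P s ** A ** ?P t)"
      by (simp add: block_commutator_sum[OF E st] block_commutator_operator[OF E st])
    consider "s = t" | "s = Suc t" | "t = Suc s" | "s \<noteq> t" "?P s ** A ** ?P t = 0"
      using adj st unfolding adjacent_blocks_def by metis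
    then show "?P s ** X ** ?P t = ?P s ** commutator (commutator A E) (spectral_sum n E ?w) ** ?P t"
    proof cases
      case 1
      then show ?thesis using X0 R by simp
    next
      case 2
      then show ?thesis using X1 R by simp
    next
      case 3
      then have "- (?P s ** X ** ?P t) = (?w s - ?w t) *\<^sub>R (?P s ** A ** ?P t)" using X1 by simp
      then have "?P s ** X ** ?P t = (?w t - ?w s) *\<^sub>R (?P s ** A ** ?P t)"
        by (metis add.inverse_inverse minus_diff_eq scaleR_minus_left)
      then show ?thesis using R 3 by simp
    next
      case 4
      then show ?thesis using X1 R by simp
    qed
  qed
  then show ?thesis using X by (simp add: hodge_proj_eq[OF c(1)] hodge_proj_eq[OF E])
qed

section \<open>The orbits \<open>D\<close> and \<open>D1\<close> of the base point and their tangent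
  vectors\<close>

locale hodge_orbit =
  fixes n :: nat and Q :: "int^'m^'m" and G :: "(real^'m^'m) set" and E0 :: "complex^'m^'m"
  assumes G: "isometry_group Q G" and E0: "hodge_operator n Q E0"
    and gram_injective: "\<And>X :: complex^'m^'m. gram Q ** X = 0 \<Longrightarrow> X = 0"
begin

definition D where "D = (\<lambda>g. act g E0) ` G"

definition D1 where "D1 = (\<lambda>g. act g (hodge_proj n E0)) ` G"

lemma base_point_in_D1: "hodge_proj n E0 \<in> D1"
  using mat_1_isometry_group[OF G]
  by (auto simp: D1_def act_def matrix_inv_eqI cplx_mat_simps intro!: image_eqI[of _ _ "mat 1"])

lemma D_hodge_operator: "E \<in> D \<Longrightarrow> hodge_operator n Q E"
  using hodge_operator_act[OF isometry_group_subset[OF G] E0] by (auto simp: D_def)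

lemma hodge_proj_in_D1: "E \<in> D \<Longrightarrow> hodge_proj n E \<in> D1"
proof -
  assume "E \<in> D"
  then obtain g where g: "g \<in> G" "E = act g E0" by (auto simp: D_def)
  have "g \<in> aut_real Q" using isometry_group_subset[OF G g(1)] .
  then have inv: "invertible g" by (simp add: aut_real_iff)
  have "hodge_proj n E = act g (hodge_proj n E0)"
    using hodge_proj_eq[OF D_hodge_operator[OF \<open>E \<in> D\<close>]] hodge_proj_eq[OF E0]
    by (simp add: g(2) act_spectral_sum[OF inv])
  then show ?thesis using g(1) by (auto simp: D1_def)
qed

lemma tangent_D:
  assumes "A \<in> tangent_space D E"
  shows "has_type Q (- 1) (- 1) A" "\<And>s. s \<le> n \<Longrightarrow> spectral_proj n E s ** A ** spectral_proj n E s = 0"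
    "E \<in> D"
proof -
  obtain c where c: "c 0 = E" "\<And>t. c t \<in> D" "(c has_vector_derivative A) (at 0)"
    using assms by (auto simp: tangent_space_def curve_through_def)
  have h: "hodge_operator n Q (c t)" for t using D_hodge_operator c(2) .
  show "has_type Q (- 1) (- 1) A"
    by (rule has_type_derivative[OF c(3), of _ _ _ "(real n / 2) *\<^sub>R mat 1"]) (use h in \<open>simp add: hodge_operator_def\<close>)
  show "spectral_proj n E s ** A ** spectral_proj n E s = 0" if "s \<le> n" for s
    by (rule tangent_diagonal[OF h c(1,3) that])
  show "E \<in> D" using c(1,2) by metis
qed

text \<open>Conjugation exchanges blocks (s, t) and (n - s, n - t) and changes \<open>A\<close> only
  by a sign. It therefore swaps blocks above and below the diagonal, so a tangent vector is
  determined by its blocks with s < t.\<close>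

lemma block_conj:
  assumes E: "hodge_operator n Q E" and A: "has_type Q (- 1) (- 1) A" and st: "s \<le> n" "t \<le> n"
    and 0: "spectral_proj n E (n - s) ** A ** spectral_proj n E (n - t) = 0"
  shows "spectral_proj n E s ** A ** spectral_proj n E t = 0"
proof -
  have "conj_mat (spectral_proj n E s ** A ** spectral_proj n E t) = 0"
    using A 0 by (simp add: conj_mat_simps conj_spectral_proj[OF E] st has_type_def matrix_mult_distribs)
  then have "conj_mat (conj_mat (spectral_proj n E s ** A ** spectral_proj n E t)) = 0"
    by (simp add: conj_mat_simps)
  then show ?thesis by (simp add: conj_mat_simps)
qed

text \<open>The derivative of \<open>t \<mapsto> \<Phi>\<^sub>r(c t)\<close>, where \<open>\<Phi>\<^sub>r\<close> is the projector onto \<open>F\<^sup>r\<close>, represents the component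
  of \<open>A\<close> in \<open>Hom(F\<^sup>r, H/F\<^sup>r)\<close>.\<close>

lemma filtration_derivative:
  assumes A: "A \<in> tangent_space D E"
  obtains X where
    "\<And>s t. s \<le> n \<Longrightarrow> t \<le> n \<Longrightarrow> s < r \<Longrightarrow> r \<le> t \<Longrightarrow>
      (real t - real s) *\<^sub>R (spectral_proj n E s ** X ** spectral_proj n E t) =
      spectral_proj n E s ** A ** spectral_proj n E t"
    "\<And>v. v \<in> hfil n E r \<Longrightarrow> hom_component n D E A r v = {u. u - X *v v \<in> hfil n E r}"
proof -
  note E = D_hodge_operator[OF tangent_D(3)[OF A]]
  let ?w = "indicator {r..n} :: nat \<Rightarrow> real"
  let ?F = "spectral_sum n E ?w"
  \<comment> \<open>\<open>hom_component\<close> ranges over all curves with velocity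
    \<open>A\<close>. As the projector is a polynomial on the whole matrix space, its differential
    there gives one \<open>X\<close> valid for every such curve.\<close>
  define X where "X = differential UNIV (\<lambda>E. spectral_sum n E ?w) E A"
  have der: "((\<lambda>t. spectral_sum n (c t) ?w) has_vector_derivative X) (at 0)"
    if "curve_through D E A c" for c
  proof -
    have "curve_through UNIV E A c" using that by (simp add: curve_through_def)
    from differential_curve[OF smooth_on_spectral_sum[OF smooth_on_id] this] show ?thesis by (simp add: X_def)
  qed
  obtain c where c: "curve_through D E A c" using A by (auto simp: tangent_space_def)
  have blocks: "(real t - real s) *\<^sub>R (spectral_proj n E s ** X ** spectral_proj n E t) =
      spectral_proj n E s ** A ** spectral_proj n E t"
    if st: "s \<le> n" "t \<le> n" "s < r" "r \<le> t" for s t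
  proof -
    have "(real s - real t) *\<^sub>R (spectral_proj n E s ** X ** spectral_proj n E t) =
      (?w s - ?w t) *\<^sub>R (spectral_proj n E s ** A ** spectral_proj n E t)"
      using c st(1,2) D_hodge_operator
      by (intro spectral_sum_derivative(1)[OF _ _ _ der[OF c]]) (auto simp: curve_through_def indicator_def)
    then have "- ((real t - real s) *\<^sub>R (spectral_proj n E s ** X ** spectral_proj n E t)) =
       - (spectral_proj n E s ** A ** spectral_proj n E t)"
      using st by (simp flip: scaleR_minus_left)
    then show ?thesis by (simp only: neg_equal_iff_equal)
  qed
  have hom: "hom_component n D E A r v = {u. u - X *v v \<in> hfil n E r}" if v: "v \<in> hfil n E r" for v
  proof (intro set_eqI iffI)
    fix u assume "u \<in> hom_component n D E A r v"
    then obtain d w where d: "curve_through D E A d" "\<And>t. w t \<in> hfil n (d t) r" "w 0 = v"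
      "(w has_vector_derivative u) (at 0)" by (auto simp: hom_component_def)
    have dD: "hodge_operator n Q (d t)" for t using d(1) D_hodge_operator by (auto simp: curve_through_def)
    have d0: "d 0 = E" using d(1) by (simp add: curve_through_def)
    have eq: "spectral_sum n (d t) ?w *v w t = w t" for t using d(2) hfil_iff[OF dD] by blast
    \<comment> \<open>Differentiating the equation that the projector at \<open>d t\<close> fixes
      \<open>w t\<close>; it follows that \<open>u - X *v v\<close> equals \<open>?F *v u\<close>
      and so lies in \<open>F^r\<close>.\<close>
    have "((\<lambda>t. spectral_sum n (d t) ?w *v w t) has_vector_derivative
        spectral_sum n (d 0) ?w *v u + X *v w 0) (at 0)"
      by (rule bounded_bilinear.has_vector_derivative[OF bounded_bilinear_matrix_vector_mult der[OF d(1)] d(4)])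
    then have "?F *v u + X *v v = u"
      using d(3,4) vector_derivative_unique_at unfolding eq d0 by metis
    moreover have "?F *v (?F *v u) = ?F *v u"
    proof -
      have "?F ** ?F = ?F"
        unfolding spectral_sum_mult[OF E] by (auto simp: spectral_sum_def indicator_def intro!: sum.cong)
      then show ?thesis by (simp add: matrix_vector_mul_assoc)
    qed
    ultimately have "?F *v (u - X *v v) = u - X *v v" by (metis add_diff_cancel_right')
    then show "u \<in> {u. u - X *v v \<in> hfil n E r}" using hfil_iff[OF E] by blast
  next
    fix u assume "u \<in> {u. u - X *v v \<in> hfil n E r}"
    then have f: "?F *v (u - X *v v) = u - X *v v" using hfil_iff[OF E] by blast
    define f where "f = u - X *v v"
    have cD: "hodge_operator n Q (c t)" for t using c D_hodge_operator by (auto simp: curve_through_def)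
    \<comment> \<open>Projecting the straight line with velocity \<open>f\<close> into the moving
      filtration step gives a section through \<open>v\<close> whose derivative is
      \<open>f + X *v v = u\<close>.\<close>
    define w where "w t = spectral_sum n (c t) ?w *v (v + t *\<^sub>R f)" for t
    have c0: "c 0 = E" using c by (simp add: curve_through_def)
    have "((\<lambda>t. v + t *\<^sub>R f) has_vector_derivative f) (at 0)"
      by (auto intro!: derivative_eq_intros)
    then have "(w has_vector_derivative spectral_sum n (c 0) ?w *v f + X *v (v + 0 *\<^sub>R f)) (at 0)"
      unfolding w_def by (rule bounded_bilinear.has_vector_derivative[OF bounded_bilinear_matrix_vector_mult der[OF c]])
    moreover have "spectral_sum n (c 0) ?w *v f + X *v (v + 0 *\<^sub>R f) = u"
      using f by (simp add: c0 f_def)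
    ultimately have "(w has_vector_derivative u) (at 0)" by simp
    moreover have "w 0 = v" using v hfil_iff[OF E] by (simp add: w_def c0)
    moreover have "w t \<in> hfil n (c t) r" for t
    proof -
      have "spectral_sum n (c t) ?w ** spectral_sum n (c t) ?w = spectral_sum n (c t) ?w"
        unfolding spectral_sum_mult[OF cD] by (auto simp: spectral_sum_def indicator_def intro!: sum.cong)
      then show ?thesis by (simp add: hfil_iff[OF cD] w_def matrix_vector_mul_assoc)
    qed
    ultimately show "u \<in> hom_component n D E A r v" using c by (auto simp: hom_component_def)
  qed
  show thesis using that blocks hom by blast
qed

lemma hfil_spectral_proj:
  assumes "hodge_operator n Q E" "r \<le> t" "t \<le> n"
  shows "spectral_proj n E t *v v \<in> hfil n E r"
  using spectral_proj_sum(2)[OF assms(1,3), of "indicator {r..n}"] assms(2,3)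
  by (simp add: hfil_iff[OF assms(1)] matrix_vector_mul_assoc)

lemma spectral_proj_hfil:
  assumes "hodge_operator n Q E" "v \<in> hfil n E r" "s < r" "s \<le> n"
  shows "spectral_proj n E s *v v = 0"
proof -
  have "spectral_proj n E s *v v = spectral_proj n E s *v (spectral_sum n E (indicator {r..n}) *v v)"
    using assms hfil_iff by metis
  also have "\<dots> = 0"
    using spectral_proj_sum(1)[OF assms(1,4), of "indicator {r..n}"] assms(3)
    by (simp add: matrix_vector_mul_assoc)
  finally show ?thesis .
qed

text \<open>Horizontality removes the blocks with s + 1 < t, conjugation removes their mirror
  images, and tangency to \<open>D\<close> removes the diagonal.\<close>

lemma horizontal_adjacent:
  assumes "A \<in> horizontal_space n D E"
  shows "adjacent_blocks n E A"
proof -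
  have A: "A \<in> tangent_space D E"
    and hor: "\<And>r v. r \<in> {1..n} \<Longrightarrow> v \<in> hfil n E r \<Longrightarrow> hom_component n D E A r v \<subseteq> hfil n E (r - 1)"
    using assms by (auto simp: horizontal_space_def)
  note E = D_hodge_operator[OF tangent_D(3)[OF A]]
  let ?P = "spectral_proj n E"
  have up: "?P s ** A ** ?P t = 0" if st: "s \<le> n" "t \<le> n" "Suc s < t" for s t
  proof -
    obtain X where X: "\<And>s' t'. s' \<le> n \<Longrightarrow> t' \<le> n \<Longrightarrow> s' < t \<Longrightarrow> t \<le> t' \<Longrightarrow>
      (real t' - real s') *\<^sub>R (?P s' ** X ** ?P t') = ?P s' ** A ** ?P t'"
      "\<And>v. v \<in> hfil n E t \<Longrightarrow> hom_component n D E A t v = {u. u - X *v v \<in> hfil n E t}"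
      using filtration_derivative[OF A, of t] by metis
    have "(?P s ** X ** ?P t) *v v = 0" for v
    proof -
      have v: "?P t *v v \<in> hfil n E t" using hfil_spectral_proj[OF E] st by blast
      \<comment> \<open>So \<open>X *v (?P t *v v)\<close> itself represents the coset, and
        horizontality applies to it directly.\<close>
      have "0 \<in> hfil n E t" by (simp add: hfil_iff[OF E])
      then have "X *v (?P t *v v) \<in> hom_component n D E A t (?P t *v v)" by (simp add: X(2)[OF v])
      then have "X *v (?P t *v v) \<in> hfil n E (t - 1)" using hor[OF _ v] st by auto
      then have "?P s *v (X *v (?P t *v v)) = 0" using spectral_proj_hfil[OF E] st by auto
      then show ?thesis by (simp add: matrix_vector_mul_assoc matrix_mul_assoc)
    qed
    then have "?P s ** X ** ?P t = 0" by (simp add: matrix_eq)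
    then show ?thesis using X(1)[of s t] st by simp
  qed
  have "?P s ** A ** ?P t = 0" if st: "s \<le> n" "t \<le> n" "s \<noteq> Suc t" "t \<noteq> Suc s" for s t
  proof -
    consider "s = t" | "Suc s < t" | "Suc t < s" using st by linarith
    then show ?thesis
    proof cases
      case 1
      then show ?thesis using tangent_D(2)[OF A] st by simp
    next
      case 2
      then show ?thesis using up st by blast
    next
      case 3
      then show ?thesis using st
        by (intro block_conj[OF E tangent_D(1)[OF A] st(1,2)] up) auto
    qed
  qed
  then show ?thesis by (simp add: adjacent_blocks_def)
qed

lemma commutator_in_tangent_D:
  assumes "has_type Q 1 (- 1) A" "E \<in> D"
  shows "commutator A E \<in> tangent_space D E"
  using commutator_in_tangent_space_orbit[OF G has_type_re_mat(2)[OF assms(1)] assms(2)[unfolded D_def]]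
  by (simp add: has_type_re_mat(1)[OF assms(1)] D_def)

text \<open>The Hom components see only blocks with s < t. There the commutator with
  \<open>E\<close> multiplies by t - s = 1, so the candidate is i times \<open>A\<close>; below the
  diagonal the factor -1 is what reality requires. A tangent vector with the same Hom components has
  the same blocks above the diagonal and, by conjugation, below it.\<close>

lemma hodge_J_horizontal:
  assumes "A \<in> horizontal_space n D E"
  shows "hodge_J n D E A = cscale \<i> (commutator A E)"
proof -
  have A: "A \<in> tangent_space D E" using assms by (simp add: horizontal_space_def)
  note ED = tangent_D(3)[OF A]
  note E = D_hodge_operator[OF ED]
  note adj = horizontal_adjacent[OF assms]
  let ?P = "spectral_proj n E"
  define B where "B = cscale \<i> (commutator A E)"
  have B: "B \<in> tangent_space D E"
    using commutator_in_tangent_D[OF _ ED, of "cscale \<i> A"] has_type_cscale_i[OF tangent_D(1)[OF A]]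
    by (simp add: B_def cscale_commutator)
  have B_upper: "?P s ** B ** ?P t = cscale \<i> (?P s ** A ** ?P t)" if st: "s \<le> n" "t \<le> n" "s < t" for s t
  proof -
    have "?P s ** B ** ?P t = cscale \<i> ((real t - real s) *\<^sub>R (?P s ** A ** ?P t))"
      by (simp add: B_def cscale_simps block_commutator_operator[OF E st(1,2)])
    moreover have "(real t - real s) *\<^sub>R (?P s ** A ** ?P t) = ?P s ** A ** ?P t"
    proof (cases "t = Suc s")
      case False
      then have "?P s ** A ** ?P t = 0" using adj st by (auto simp: adjacent_blocks_def)
      then show ?thesis by simp
    qed simp
    ultimately show ?thesis by simp
  qed
  have B_hom: "hom_component n D E B r v = (\<lambda>u. \<i> *s u) ` hom_component n D E A r v"
    if r: "r \<le> n" and v: "v \<in> hfil n E r" for r v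
  proof -
    obtain X where X: "\<And>s t. s \<le> n \<Longrightarrow> t \<le> n \<Longrightarrow> s < r \<Longrightarrow> r \<le> t \<Longrightarrow>
      (real t - real s) *\<^sub>R (?P s ** X ** ?P t) = ?P s ** A ** ?P t"
      "\<And>v. v \<in> hfil n E r \<Longrightarrow> hom_component n D E A r v = {u. u - X *v v \<in> hfil n E r}"
      using filtration_derivative[OF A, of r] by metis
    obtain Y where Y: "\<And>s t. s \<le> n \<Longrightarrow> t \<le> n \<Longrightarrow> s < r \<Longrightarrow> r \<le> t \<Longrightarrow>
      (real t - real s) *\<^sub>R (?P s ** Y ** ?P t) = ?P s ** B ** ?P t"
      "\<And>v. v \<in> hfil n E r \<Longrightarrow> hom_component n D E B r v = {u. u - Y *v v \<in> hfil n E r}"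
      using filtration_derivative[OF B, of r] by metis
    let ?F = "spectral_sum n E (indicator {r..n})"
    have F: "u \<in> hfil n E r \<longleftrightarrow> ?F *v u = u" for u using hfil_iff[OF E] .
    \<comment> \<open>This says that \<open>Y\<close> and i times \<open>X\<close> induce the same
      map from \<open>F^r\<close> to \<open>H/F^r\<close>.\<close>
    have "(mat 1 - ?F) ** (Y - cscale \<i> X) ** ?F = 0"
    proof (rule matrix_block_eqI[OF E])
      fix s t assume st: "s \<le> n" "t \<le> n"
      have "?P s ** ((mat 1 - ?F) ** (Y - cscale \<i> X) ** ?F) ** ?P t =
         (?P s ** (mat 1 - ?F)) ** (Y - cscale \<i> X) ** (?F ** ?P t)"
        by (simp add: matrix_mul_assoc)
      also have "\<dots> = ((1 - indicator {r..n} s) * indicator {r..n} t) *\<^sub>R (?P s ** (Y - cscale \<i> X) ** ?P t)"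
        using spectral_proj_sum(1)[OF E st(1), of "indicator {r..n}"] spectral_proj_sum(2)[OF E st(2), of "indicator {r..n}"]
        by (simp add: matrix_mult_distribs algebra_simps)
      also have "\<dots> = 0"
      proof (cases "s < r \<and> r \<le> t")
        case True
        then have "(real t - real s) *\<^sub>R (?P s ** (Y - cscale \<i> X) ** ?P t) = 0"
          using X(1)[OF st] Y(1)[OF st] B_upper[OF st]
          by (simp add: matrix_mult_distribs cscale_simps scaleR_diff_right)
        then show ?thesis using True by simp
      qed (use st in \<open>auto simp: indicator_def\<close>)
      finally show "?P s ** ((mat 1 - ?F) ** (Y - cscale \<i> X) ** ?F) ** ?P t = ?P s ** 0 ** ?P t" by simp
    qed
    then have "((mat 1 - ?F) ** (Y - cscale \<i> X) ** ?F) *v v = 0" by simp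
    then have "(mat 1 - ?F) *v ((Y - cscale \<i> X) *v (?F *v v)) = 0"
      by (simp add: matrix_vector_mul_assoc matrix_mul_assoc)
    then have YX: "Y *v v - \<i> *s (X *v v) \<in> hfil n E r"
      using v F by (simp add: matrix_vector_mult_diff_rdistrib cscale_mult_vec)
    have closed: "a + b \<in> hfil n E r" "a - b \<in> hfil n E r" "k *s a \<in> hfil n E r"
      if "a \<in> hfil n E r" "b \<in> hfil n E r" for a b and k :: complex
      using that by (simp_all add: F algebra_simps mult_vec_scale)
    show ?thesis
      unfolding X(2)[OF v] Y(2)[OF v]
    proof (intro set_eqI iffI)
      fix u assume u: "u \<in> {u. u - Y *v v \<in> hfil n E r}"
      have "- \<i> *s u - X *v v = - \<i> *s ((u - Y *v v) + (Y *v v - \<i> *s (X *v v)))"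
        by (simp add: vec_eq_iff algebra_simps)
      then have "- \<i> *s u - X *v v \<in> hfil n E r"
        using closed(3)[OF closed(1) closed(1), of "u - Y *v v" "Y *v v - \<i> *s (X *v v)" _ _ "- \<i>"] u YX
        by (metis mem_Collect_eq)
      moreover have "u = \<i> *s (- \<i> *s u)" by (simp add: vec_eq_iff)
      ultimately show "u \<in> (*s) \<i> ` {u. u - X *v v \<in> hfil n E r}"
        by (intro image_eqI[of u _ "- \<i> *s u"]) simp_all
    next
      fix u assume "u \<in> (*s) \<i> ` {u. u - X *v v \<in> hfil n E r}"
      then obtain x where x: "u = \<i> *s x" "x - X *v v \<in> hfil n E r" by blast
      have "u - Y *v v = \<i> *s (x - X *v v) - (Y *v v - \<i> *s (X *v v))"
        by (simp add: x(1) vec_eq_iff algebra_simps)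
      moreover have "\<i> *s (x - X *v v) \<in> hfil n E r" using closed(3)[OF x(2) x(2)] .
      ultimately show "u \<in> {u. u - Y *v v \<in> hfil n E r}"
        using closed(2)[OF _ YX, of "\<i> *s (x - X *v v)"] by (simp only: mem_Collect_eq)
    qed
  qed
  have uniq: "C = B" if C: "C \<in> tangent_space D E"
    and C_hom: "\<forall>r\<le>n. \<forall>v\<in>hfil n E r. hom_component n D E C r v = (\<lambda>u. \<i> *s u) ` hom_component n D E A r v" for C
  proof -
    \<comment> \<open>Block (s, t) is read off from the filtration step with index \<open>t\<close>:
      it contains the image of \<open>?P t\<close> and is annihilated by \<open>?P s\<close>, as s <
      t.\<close>
    have upper: "?P s ** (C - B) ** ?P t = 0" if st: "s \<le> n" "t \<le> n" "s < t" for s t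
    proof -
      obtain X where X: "\<And>s t'. s \<le> n \<Longrightarrow> t' \<le> n \<Longrightarrow> s < t \<Longrightarrow> t \<le> t' \<Longrightarrow>
        (real t' - real s) *\<^sub>R (?P s ** X ** ?P t') = ?P s ** B ** ?P t'"
        "\<And>v. v \<in> hfil n E t \<Longrightarrow> hom_component n D E B t v = {u. u - X *v v \<in> hfil n E t}"
        using filtration_derivative[OF B, of t] by metis
      obtain Y where Y: "\<And>s t'. s \<le> n \<Longrightarrow> t' \<le> n \<Longrightarrow> s < t \<Longrightarrow> t \<le> t' \<Longrightarrow>
        (real t' - real s) *\<^sub>R (?P s ** Y ** ?P t') = ?P s ** C ** ?P t'"
        "\<And>v. v \<in> hfil n E t \<Longrightarrow> hom_component n D E C t v = {u. u - Y *v v \<in> hfil n E t}"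
        using filtration_derivative[OF C, of t] by metis
      have "(?P s ** (X - Y) ** ?P t) *v v = 0" for v
      proof -
        have v: "?P t *v v \<in> hfil n E t" using hfil_spectral_proj[OF E] st by blast
        have "0 \<in> hfil n E t" by (simp add: hfil_iff[OF E])
        then have "X *v (?P t *v v) \<in> hom_component n D E B t (?P t *v v)" by (simp add: X(2)[OF v])
        also have "hom_component n D E B t (?P t *v v) = hom_component n D E C t (?P t *v v)"
          using B_hom C_hom v st(2) by simp
        finally have "(X - Y) *v (?P t *v v) \<in> hfil n E t"
          by (simp add: Y(2)[OF v] matrix_vector_mult_diff_rdistrib)
        then have "?P s *v ((X - Y) *v (?P t *v v)) = 0" using spectral_proj_hfil[OF E] st by auto
        then show ?thesis by (simp add: matrix_vector_mul_assoc matrix_mul_assoc)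
      qed
      then have "?P s ** (X - Y) ** ?P t = 0" by (simp add: matrix_eq)
      then have "?P s ** X ** ?P t = ?P s ** Y ** ?P t" by (simp add: matrix_mult_distribs)
      then show ?thesis using X(1)[of s t] Y(1)[of s t] st by (simp add: matrix_mult_distribs)
    qed
    have ty: "has_type Q (- 1) (- 1) (C - B)"
      using has_type_diff tangent_D(1) B C by blast
    have "C - B = 0"
    proof (rule matrix_block_eqI[OF E])
      fix s t assume st: "s \<le> n" "t \<le> n"
      consider "s = t" | "s < t" | "t < s" by linarith
      then have "?P s ** (C - B) ** ?P t = 0"
      proof cases
        case 1
        then show ?thesis using tangent_D(2)[OF B] tangent_D(2)[OF C] st by (simp add: matrix_mult_distribs)
      next
        case 2
        then show ?thesis using upper st by blast
      next
        case 3
        then show ?thesis using st by (intro block_conj[OF E ty st] upper) auto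
      qed
      then show "?P s ** (C - B) ** ?P t = ?P s ** 0 ** ?P t" by simp
    qed
    then show ?thesis by simp
  qed
  show ?thesis
    unfolding hodge_J_def B_def[symmetric]
    by (rule the_equality) (use B B_hom uniq in blast)+
qed

end

section \<open>The symmetric space\<close>

text \<open>Coordinates given by inner products are linear and smooth on the whole ambient space,
  which makes the expansion usable with functions as coefficients.\<close>

lemma subspace_orthonormal_expansion:
  fixes S :: "'a::euclidean_space set"
  assumes "subspace S"
  obtains B where "finite B" "B \<subseteq> S" "\<And>x. x \<in> S \<Longrightarrow> x = (\<Sum>b\<in>B. (x \<bullet> b) *\<^sub>R b)"
proof -
  obtain B where B: "B \<subseteq> S" "pairwise orthogonal B" "\<And>x. x \<in> B \<Longrightarrow> norm x = 1"
    "independent B" "card B = dim S" "span B = S"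
    using orthonormal_basis_subspace[OF assms] by metis
  have fin: "finite B" using B(4) independent_imp_finite by blast
  have "x = (\<Sum>b\<in>B. (x \<bullet> b) *\<^sub>R b)" if "x \<in> S" for x
  proof -
    have "x \<in> span B" using that B(6) by simp
    then obtain u where u: "x = (\<Sum>b\<in>B. u b *\<^sub>R b)" using fin span_finite by fastforce
    have "x \<bullet> b = u b" if b: "b \<in> B" for b
    proof -
      have "x \<bullet> b = (\<Sum>a\<in>B. if a = b then u b else 0)"
        unfolding u inner_sum_left
      proof (rule sum.cong)
        fix a assume "a \<in> B"
        then show "(u a *\<^sub>R a) \<bullet> b = (if a = b then u b else 0)"
          using B(2,3) b by (auto simp: pairwise_def orthogonal_def norm_eq_1)
      qed simp
      then show ?thesis using b fin by simp
    qed
    then show ?thesis using u by simp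
  qed
  then show thesis using that fin B(1) by blast
qed

text \<open>Bilinearity of the Killing form is established only on the subalgebra. Composing with
  orthogonal coordinates gives a globally bilinear extension, as the product rule demands.\<close>

lemma (in lie_subalgebra) killing_form_bounded_bilinear:
  obtains \<beta> where "bounded_bilinear \<beta>" "\<And>A B. A \<in> \<gg> \<Longrightarrow> B \<in> \<gg> \<Longrightarrow> \<beta> A B = killing_form \<gg> A B"
proof -
  obtain B where B: "finite B" "B \<subseteq> \<gg>" "\<And>x. x \<in> \<gg> \<Longrightarrow> x = (\<Sum>b\<in>B. (x \<bullet> b) *\<^sub>R b)"
    using subspace_orthonormal_expansion[OF subspace] by metis
  define \<beta> where "\<beta> X Y = (\<Sum>a\<in>B. \<Sum>b\<in>B. (X \<bullet> a) * ((Y \<bullet> b) * killing_form \<gg> a b))" for X Y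
  have "bilinear \<beta>"
    by (simp add: bilinear_def linear_iff \<beta>_def inner_add_left algebra_simps sum.distrib sum_distrib_left)
  then have "bounded_bilinear \<beta>" using bilinear_conv_bounded_bilinear by blast
  moreover have "\<beta> X Y = killing_form \<gg> X Y" if XY: "X \<in> \<gg>" "Y \<in> \<gg>" for X Y
  proof -
    have sum: "killing_form \<gg> (\<Sum>b\<in>C. f b *\<^sub>R b) Z = (\<Sum>b\<in>C. f b * killing_form \<gg> b Z)"
      if "Z \<in> \<gg>" "C \<subseteq> \<gg>" "finite C" for Z C and f :: "_ \<Rightarrow> real"
      using that(3,2)
    proof (induction C rule: finite_induct)
      case empty
      then show ?case using killing_form_scaleR[OF that(1) that(1), of 0]
        using killing_form_scaleR[of 0 Z 0] that(1) subspace_0[OF subspace] by simp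
    next
      case (insert x C)
      have "(\<Sum>b\<in>C. f b *\<^sub>R b) \<in> \<gg>"
        using insert by (intro subspace_sum[OF subspace] subspace_scale[OF subspace]) auto
      then show ?case
        using insert that(1) by (simp add: killing_form_add killing_form_scaleR subspace_scale[OF subspace])
    qed
    have "killing_form \<gg> X Y = (\<Sum>a\<in>B. (X \<bullet> a) * killing_form \<gg> a Y)"
      using sum[OF XY(2) B(2,1), of "\<lambda>a. X \<bullet> a"] B(3)[OF XY(1)] by simp
    also have "\<dots> = (\<Sum>a\<in>B. (X \<bullet> a) * (\<Sum>b\<in>B. (Y \<bullet> b) * killing_form \<gg> b a))"
    proof (rule sum.cong)
      fix a assume "a \<in> B"
      then have a: "a \<in> \<gg>" using B(2) by auto
      have "killing_form \<gg> a Y = (\<Sum>b\<in>B. (Y \<bullet> b) * killing_form \<gg> b a)"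
        using sum[OF a B(2,1), of "\<lambda>a. Y \<bullet> a"] B(3)[OF XY(2)] killing_form_commute[OF a XY(2)] by simp
      then show "(X \<bullet> a) * killing_form \<gg> a Y = (X \<bullet> a) * (\<Sum>b\<in>B. (Y \<bullet> b) * killing_form \<gg> b a)" by simp
    qed simp
    also have "\<dots> = \<beta> X Y"
      unfolding \<beta>_def sum_distrib_left
    proof (intro sum.cong refl)
      fix a b assume "a \<in> B" "b \<in> B"
      then show "X \<bullet> a * (Y \<bullet> b * killing_form \<gg> b a) = X \<bullet> a * (Y \<bullet> b * killing_form \<gg> a b)"
        using B(2) killing_form_commute[OF subsetD subsetD, OF B(2) _ B(2)] by simp
    qed
    finally show ?thesis by simp
  qed
  ultimately show thesis using that by blast
qed

lemma aut_real_inv: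
  assumes "g \<in> aut_real Q" shows "matrix_inv g \<in> aut_real Q"
proof -
  have inv: "g ** matrix_inv g = mat 1" "matrix_inv g ** g = mat 1"
    using assms matrix_inv_inverse by (auto simp: aut_real_iff)
  have "transpose (matrix_inv g) ** gram Q ** matrix_inv g =
      transpose (matrix_inv g) ** (transpose g ** gram Q ** g) ** matrix_inv g"
    using assms by (simp add: aut_real_iff)
  also have "\<dots> = transpose (g ** matrix_inv g) ** gram Q ** (g ** matrix_inv g)"
    by (simp add: matrix_transpose_mul matrix_mul_assoc)
  finally show ?thesis using inv by (auto simp: aut_real_iff invertible_def)
qed

lemma spectral_sum_cong: "(\<And>r. r \<le> n \<Longrightarrow> w r = w' r) \<Longrightarrow> spectral_sum n E w = spectral_sum n E w'"
  by (auto simp: spectral_sum_def intro!: sum.cong)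

text \<open>For an idempotent \<open>P\<close>, the map \<open>Z \<mapsto> [[Z, P], P]\<close> removes the diagonal blocks of \<open>Z\<close>.\<close>

lemma idempotent_commutator:
  fixes P :: "complex^'m^'m"
  assumes "P ** P = P"
  shows "commutator (commutator (commutator Z P) P) P = commutator Z P"
proof -
  have PP: "M ** P ** P = M ** P" for M using assms by (simp flip: matrix_mul_assoc)
  show ?thesis
    by (simp only: commutator_def matrix_mult_diff_left matrix_mult_diff_right matrix_mul_assoc PP assms) simp
qed

text \<open>The hypothesis on \<open>X\<close> is the linearization of \<open>P ** P = P\<close>; it
  says that \<open>X\<close> maps the image of \<open>P\<close> into the kernel and
  conversely.\<close>

lemma off_diagonal:
  fixes P :: "complex^'m^'m"
  assumes P: "P ** P = P" and X: "X = P ** X + X ** P"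
  shows "P ** X ** P = 0" "commutator (commutator X P) P = X"
proof -
  have PP: "M ** P ** P = M ** P" for M using P by (simp flip: matrix_mul_assoc)
  have "P ** X ** P = P ** (P ** X + X ** P) ** P" using X by simp
  also have "\<dots> = P ** X ** P + P ** X ** P"
    by (simp add: matrix_mult_distribs matrix_mul_assoc PP P)
  finally show 0: "P ** X ** P = 0" by simp
  show "commutator (commutator X P) P = X"
    using X by (simp add: commutator_def matrix_mult_distribs matrix_mul_assoc PP P 0 add.commute)
qed

lemma commutator_off_diagonal:
  fixes P :: "complex^'m^'m"
  assumes "P ** P = P"
  shows "commutator Z P = P ** commutator Z P + commutator Z P ** P"
proof -
  have PP: "M ** P ** P = M ** P" for M using assms by (simp flip: matrix_mul_assoc)
  show ?thesis by (simp add: commutator_def matrix_mult_distribs matrix_mul_assoc PP assms)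
qed

text \<open>Each factor exchanges the image and the kernel of \<open>P\<close>, so the product
  preserves both.\<close>

lemma off_diagonal_mult:
  fixes P :: "complex^'m^'m"
  assumes P: "P ** P = P" and X: "X = P ** X + X ** P" and Y: "Y = P ** Y + Y ** P"
  shows "commutator (X ** Y) P = 0"
proof -
  have "P ** X = X - X ** P" using X by (metis add_diff_cancel_right')
  then have "P ** X ** Y = X ** Y - X ** (P ** Y)" by (simp add: matrix_mult_distribs matrix_mul_assoc)
  also have "P ** Y = Y - Y ** P" using Y by (metis add_diff_cancel_right')
  finally show ?thesis by (simp add: commutator_def matrix_mult_distribs matrix_mul_assoc)
qed

section \<open>Tangent spaces of the symmetric space and its invariant metric\<close>

context hodge_orbit
begin

abbreviation \<sigma> :: real where "\<sigma> \<equiv> (- 1) ^ n"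

lemma \<sigma>_mult: "\<sigma> * \<sigma> = 1"
  by (simp flip: power_add mult_2)

text \<open>The reflection r to n - r preserves the parity defining \<open>H^+\<close> for even
  \<open>n\<close> and reverses it for odd \<open>n\<close>. Hence the function
  \<open>?w - 1 / 2\<close>, with values 1/2 and -1/2, is multiplied by (-1)^n, which is both signs
  of the type.\<close>

lemma hodge_proj_type:
  "hodge_proj n E0 ** hodge_proj n E0 = hodge_proj n E0"
  "has_type Q \<sigma> \<sigma> (hodge_proj n E0 - (1 / 2) *\<^sub>R mat 1)"
proof -
  let ?w = "indicator (plus_indices n) :: nat \<Rightarrow> real"
  have "spectral_sum n E0 (\<lambda>r. ?w r * ?w r) = spectral_sum n E0 ?w"
    by (rule spectral_sum_cong) (simp add: indicator_def)
  then show "hodge_proj n E0 ** hodge_proj n E0 = hodge_proj n E0"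
    by (simp add: hodge_proj_eq[OF E0] spectral_sum_mult[OF E0])
  let ?u = "\<lambda>r. ?w r - 1 / 2"
  have eq: "hodge_proj n E0 - (1 / 2) *\<^sub>R mat 1 = spectral_sum n E0 ?u"
    by (simp add: hodge_proj_eq[OF E0] spectral_sum_def scaleR_diff_left sum_subtractf
        flip: sum_spectral_proj[OF E0] scaleR_sum_right)
  have "?u (n - r) = \<sigma> * ?u r" if "r \<le> n" for r
    using that by (cases "even n") (auto simp: indicator_def plus_indices_def)
  then have "spectral_sum n E0 (\<lambda>r. ?u (n - r)) = spectral_sum n E0 (\<lambda>r. \<sigma> * ?u r)"
    by (rule spectral_sum_cong)
  also have "\<dots> = \<sigma> *\<^sub>R spectral_sum n E0 ?u"
    by (simp add: spectral_sum_def scaleR_sum_right)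
  finally show "has_type Q \<sigma> \<sigma> (hodge_proj n E0 - (1 / 2) *\<^sub>R mat 1)"
    unfolding has_type_def eq conj_spectral_sum[OF E0] transpose_spectral_sum[OF E0]
    by (simp add: matrix_mult_distribs)
qed

lemma D1_idempotent:
  assumes "P \<in> D1"
  shows "P ** P = P" "has_type Q \<sigma> \<sigma> (P - (1 / 2) *\<^sub>R mat 1)"
proof -
  obtain g where g: "g \<in> G" "P = act g (hodge_proj n E0)" using assms by (auto simp: D1_def)
  have aut: "g \<in> aut_real Q" using isometry_group_subset[OF G g(1)] .
  then have inv: "invertible g" by (simp add: aut_real_iff)
  show "P ** P = P" using hodge_proj_type(1) by (simp add: g(2) flip: act_mult_right[OF inv])
  show "has_type Q \<sigma> \<sigma> (P - (1 / 2) *\<^sub>R mat 1)"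
    using has_type_act[OF aut hodge_proj_type(2)] by (simp add: g(2) act_simps act_mat_1[OF inv])
qed

text \<open>Scalar matrices commute with everything, so in a commutator \<open>P\<close> may be
  replaced by its centred version, which has a type.\<close>

lemma has_type_commutator_D1:
  assumes "P \<in> D1" "has_type Q e d A"
  shows "has_type Q (e * \<sigma>) (- (d * \<sigma>)) (commutator A P)"
proof -
  have "commutator A (mat 1) = 0" by (simp add: commutator_def)
  then have "commutator A P = commutator A (P - (1 / 2) *\<^sub>R mat 1)"
    by (simp add: commutator_diff_right commutator_scaleR_right)
  then show ?thesis using has_type_commutator[OF assms(2) D1_idempotent(2)[OF assms(1)]] by simp
qed

lemma commutator_in_tangent_D1:
  assumes "has_type Q 1 (- 1) A" "P \<in> D1"
  shows "commutator A P \<in> tangent_space D1 P"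
  using commutator_in_tangent_space_orbit[OF G has_type_re_mat(2)[OF assms(1)] assms(2)[unfolded D1_def]]
  by (simp add: has_type_re_mat(1)[OF assms(1)] D1_def)

text \<open>Velocities satisfy the linearized equations of the orbit. Conversely, under these
  equations \<open>[X, P]\<close> lies in the Lie algebra, and its infinitesimal action at
  \<open>P\<close> is \<open>[[X, P], P] = X\<close>.\<close>

lemma tangent_D1_iff:
  "X \<in> tangent_space D1 P \<longleftrightarrow> P \<in> D1 \<and> has_type Q \<sigma> \<sigma> X \<and> X = P ** X + X ** P"
proof
  assume "X \<in> tangent_space D1 P"
  then obtain c where c: "c 0 = P" "\<And>t. c t \<in> D1" "(c has_vector_derivative X) (at 0)"
    by (auto simp: tangent_space_def curve_through_def)
  have "P \<in> D1" using c(1,2) by metis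
  moreover have "has_type Q \<sigma> \<sigma> X"
    by (rule has_type_derivative[OF c(3) D1_idempotent(2)[OF c(2)]])
  moreover have "X = P ** X + X ** P"
  proof -
    have "((\<lambda>t. c t ** c t) has_vector_derivative c 0 ** X + X ** c 0) (at 0)"
      by (rule bounded_bilinear.has_vector_derivative[OF bounded_bilinear_matrix_mult c(3,3)])
    then show ?thesis
      using c(3) vector_derivative_unique_at by (simp add: D1_idempotent(1)[OF c(2)] c(1))
  qed
  ultimately show "P \<in> D1 \<and> has_type Q \<sigma> \<sigma> X \<and> X = P ** X + X ** P" by blast
next
  assume X: "P \<in> D1 \<and> has_type Q \<sigma> \<sigma> X \<and> X = P ** X + X ** P"
  then have "has_type Q 1 (- 1) (commutator X P)"
    using has_type_commutator_D1[of P \<sigma> \<sigma> X] by (simp add: \<sigma>_mult)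
  from commutator_in_tangent_D1[OF this] X show "X \<in> tangent_space D1 P"
    using off_diagonal(2)[OF D1_idempotent(1)] by metis
qed

lemma tangent_D1:
  assumes "X \<in> tangent_space D1 P"
  shows "P \<in> D1" "has_type Q \<sigma> \<sigma> X" "X = P ** X + X ** P" "has_type Q 1 (- 1) (commutator X P)"
    "commutator (commutator X P) P = X"
proof -
  show *: "P \<in> D1" "has_type Q \<sigma> \<sigma> X" "X = P ** X + X ** P" using assms tangent_D1_iff by blast+
  show "has_type Q 1 (- 1) (commutator X P)"
    using has_type_commutator_D1[OF *(1,2)] by (simp add: \<sigma>_mult)
  show "commutator (commutator X P) P = X"
    by (rule off_diagonal(2)[OF D1_idempotent(1)[OF *(1)] *(3)])
qed

lemma tangent_D1_zero: "P \<in> D1 \<Longrightarrow> 0 \<in> tangent_space D1 P"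
  by (simp add: tangent_D1_iff has_type_def conj_mat_simps transpose_simps)

lemma tangent_D1_linear:
  assumes "X \<in> tangent_space D1 P" "Y \<in> tangent_space D1 P"
  shows "X + Y \<in> tangent_space D1 P" "X - Y \<in> tangent_space D1 P" "k *\<^sub>R X \<in> tangent_space D1 P"
proof -
  note X = tangent_D1(1-3)[OF assms(1)] and Y = tangent_D1(2,3)[OF assms(2)]
  have "P ** (X + Y) + (X + Y) ** P = (P ** X + X ** P) + (P ** Y + Y ** P)"
    "P ** (X - Y) + (X - Y) ** P = (P ** X + X ** P) - (P ** Y + Y ** P)"
    "P ** (k *\<^sub>R X) + (k *\<^sub>R X) ** P = k *\<^sub>R (P ** X + X ** P)"
    by (simp_all add: matrix_mult_distribs scaleR_right_distrib)
  then have "X + Y = P ** (X + Y) + (X + Y) ** P" "X - Y = P ** (X - Y) + (X - Y) ** P"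
    "k *\<^sub>R X = P ** (k *\<^sub>R X) + (k *\<^sub>R X) ** P"
    unfolding X(3)[symmetric] Y(2)[symmetric] by simp_all
  then show "X + Y \<in> tangent_space D1 P" "X - Y \<in> tangent_space D1 P" "k *\<^sub>R X \<in> tangent_space D1 P"
    using X Y has_type_add has_type_diff has_type_scaleR by (simp_all add: tangent_D1_iff)
qed

abbreviation \<kappa> :: "real^'m^'m \<Rightarrow> real^'m^'m \<Rightarrow> real" where
  "\<kappa> \<equiv> killing_form (isometry_algebra Q)"

lemmas \<kappa>_commute = lie_subalgebra.killing_form_commute[OF lie_subalgebra_isometry_algebra]
  and \<kappa>_add = lie_subalgebra.killing_form_add[OF lie_subalgebra_isometry_algebra]
  and \<kappa>_scaleR = lie_subalgebra.killing_form_scaleR[OF lie_subalgebra_isometry_algebra]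

text \<open>Conjugation by the involution \<open>2 P - 1\<close> is an automorphism of the Lie algebra with the
  diagonal and the off-diagonal elements as eigenspaces.\<close>

lemma \<kappa>_orthogonal:
  assumes P: "P \<in> D1" and A: "A \<in> isometry_algebra Q" "cplx_mat A = P ** cplx_mat A + cplx_mat A ** P"
    and B: "B \<in> isometry_algebra Q" "commutator (cplx_mat B) P = 0"
  shows "\<kappa> A B = 0"
proof -
  \<comment> \<open>The involution \<open>2 P - 1\<close>, written through \<open>P - 1/2\<close>
    because that is the matrix with a type.\<close>
  define S where "S = 2 *\<^sub>R (P - (1 / 2) *\<^sub>R mat 1)"
  note PP = D1_idempotent(1)[OF P]
  have S: "has_type Q \<sigma> \<sigma> S" using has_type_scaleR[OF D1_idempotent(2)[OF P]] by (simp add: S_def)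
  have S2: "S = 2 *\<^sub>R P - mat 1" by (simp add: S_def scaleR_diff_right)
  have "4 *\<^sub>R P = 2 *\<^sub>R P + 2 *\<^sub>R P" by (simp flip: scaleR_left_distrib)
  then have SS: "S ** S = mat 1"
    unfolding S2 by (simp add: matrix_mult_distribs PP algebra_simps)
  have SSM: "M ** S ** S = M" for M using SS by (metis matrix_mul_assoc matrix_mul_rid)
  define \<theta> where "\<theta> Z = re_mat (S ** cplx_mat Z ** S)" for Z
  have ty: "has_type Q 1 (- 1) (S ** cplx_mat Z ** S)" if "Z \<in> isometry_algebra Q" for Z
  proof -
    have Z: "has_type Q 1 (- 1) (cplx_mat Z)" using that has_type_isometry_algebra by blast
    have "transpose (S ** cplx_mat Z ** S) ** gram Q = transpose S ** (transpose (S ** cplx_mat Z) ** gram Q)"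
      by (simp add: matrix_transpose_mul matrix_mul_assoc)
    also have "\<dots> = transpose S ** ((\<sigma> * - 1) *\<^sub>R (gram Q ** cplx_mat Z ** S))"
      unfolding has_type_transpose_mult[OF S Z] ..
    also have "\<dots> = (\<sigma> * - 1) *\<^sub>R ((transpose S ** gram Q) ** cplx_mat Z ** S)"
      by (simp add: matrix_mult_distribs matrix_mul_assoc)
    also have "\<dots> = (\<sigma> * - 1 * \<sigma>) *\<^sub>R (gram Q ** S ** cplx_mat Z ** S)"
      using S unfolding has_type_def by (simp add: matrix_mult_scaleR_left)
    also have "\<sigma> * - 1 * \<sigma> = - 1" using \<sigma>_mult by (simp add: algebra_simps)
    finally have 1: "transpose (S ** cplx_mat Z ** S) ** gram Q = - 1 *\<^sub>R (gram Q ** (S ** cplx_mat Z ** S))"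
      by (simp add: matrix_mul_assoc)
    have "conj_mat (S ** cplx_mat Z ** S) = (\<sigma> * \<sigma>) *\<^sub>R (S ** cplx_mat Z ** S)"
      using S unfolding conj_mat_simps(1,9) has_type_def
      by (simp only: matrix_mult_scaleR_left matrix_mult_scaleR_right scaleR_scaleR)
    then show ?thesis using 1 by (simp add: has_type_def \<sigma>_mult)
  qed
  have c\<theta>: "cplx_mat (\<theta> Z) = S ** cplx_mat Z ** S" if "Z \<in> isometry_algebra Q" for Z
    using has_type_re_mat(1)[OF ty[OF that]] by (simp add: \<theta>_def)
  have \<theta>_in: "\<theta> Z \<in> isometry_algebra Q" if "Z \<in> isometry_algebra Q" for Z
    using has_type_re_mat(2)[OF ty[OF that]] by (simp add: \<theta>_def)
  have lin: "linear \<theta>"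
    by (simp add: linear_iff \<theta>_def cplx_mat_simps matrix_mult_distribs linear_add[OF linear_re_mat]
        linear_scale[OF linear_re_mat])
  have inv: "\<theta> (\<theta> Z) = Z" if "Z \<in> isometry_algebra Q" for Z
  proof -
    have "cplx_mat (\<theta> (\<theta> Z)) = S ** (S ** cplx_mat Z ** S) ** S"
      by (simp only: c\<theta>[OF \<theta>_in[OF that]] c\<theta>[OF that])
    also have "\<dots> = cplx_mat Z" by (simp only: matrix_mul_assoc SS SSM matrix_mul_lid)
    finally show ?thesis by simp
  qed
  have hom: "\<theta> (commutator X Y) = commutator (\<theta> X) (\<theta> Y)"
    if "X \<in> isometry_algebra Q" "Y \<in> isometry_algebra Q" for X Y
  proof -
    have XY: "commutator X Y \<in> isometry_algebra Q"
      using lie_subalgebra.closed[OF lie_subalgebra_isometry_algebra] that by blast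
    have "cplx_mat (\<theta> (commutator X Y)) = cplx_mat (commutator (\<theta> X) (\<theta> Y))"
      by (simp only: c\<theta>[OF XY] cplx_mat_commutator c\<theta>[OF that(1)] c\<theta>[OF that(2)])
        (simp only: commutator_def matrix_mult_diff_left matrix_mult_diff_right matrix_mul_assoc SSM)
    then show ?thesis by simp
  qed
  have "\<theta> A = - A"
  proof -
    have "P ** cplx_mat A ** P = 0" by (rule off_diagonal(1)[OF PP A(2)])
    then have "S ** cplx_mat A ** S = cplx_mat A - 2 *\<^sub>R (P ** cplx_mat A + cplx_mat A ** P)"
      unfolding S2 by (simp add: matrix_mult_distribs algebra_simps)
    also have "\<dots> = cplx_mat A - 2 *\<^sub>R cplx_mat A" using A(2) by simp
    also have "\<dots> = cplx_mat (- A)" by (simp add: cplx_mat_simps scaleR_2)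
    finally show ?thesis unfolding c\<theta>[OF A(1), symmetric] by simp
  qed
  moreover have "\<theta> B = B"
  proof -
    have "cplx_mat B ** S = S ** cplx_mat B"
      using B(2) unfolding S2 by (simp add: commutator_def matrix_mult_distribs)
    then have "S ** cplx_mat B ** S = cplx_mat B" by (metis SSM)
    then show ?thesis unfolding c\<theta>[OF B(1), symmetric] by simp
  qed
  moreover have "\<kappa> (\<theta> A) (\<theta> B) = \<kappa> A B"
    using \<theta>_in inv hom A(1) B(1)
    by (intro lie_subalgebra.killing_form_automorphism[OF lie_subalgebra_isometry_algebra lin _ lin]) auto
  ultimately have "\<kappa> (- A) B = \<kappa> A B" by simp
  then show ?thesis using \<kappa>_scaleR[OF A(1) B(1), of "- 1"] by simp
qed

lemma \<kappa>_act:
  assumes g: "g \<in> aut_real Q" and A: "has_type Q 1 (- 1) A" and B: "has_type Q 1 (- 1) B"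
  shows "\<kappa> (re_mat (act g A)) (re_mat (act g B)) = \<kappa> (re_mat A) (re_mat B)"
proof -
  have inv: "invertible g" using g by (simp add: aut_real_iff)
  define \<phi> where "\<phi> h Z = h ** Z ** matrix_inv h" for h Z :: "real^'m^'m"
  have c\<phi>: "cplx_mat (\<phi> h Z) = act h (cplx_mat Z)" for h Z
    by (simp add: \<phi>_def act_def cplx_mat_simps)
  have in_alg: "\<phi> h ` isometry_algebra Q \<subseteq> isometry_algebra Q" if "h \<in> aut_real Q" for h
    using has_type_act[OF that] by (auto simp: has_type_isometry_algebra c\<phi>)
  have lin: "linear (\<phi> h)" for h
    by (simp add: linear_iff \<phi>_def matrix_mult_distribs)
  have "\<kappa> (\<phi> g (re_mat A)) (\<phi> g (re_mat B)) = \<kappa> (re_mat A) (re_mat B)"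
  proof (rule lie_subalgebra.killing_form_automorphism[OF lie_subalgebra_isometry_algebra
        lin in_alg[OF g] lin in_alg[OF aut_real_inv[OF g]]])
    fix Z
    have "cplx_mat (\<phi> g (\<phi> (matrix_inv g) Z)) = cplx_mat Z" "cplx_mat (\<phi> (matrix_inv g) (\<phi> g Z)) = cplx_mat Z"
      by (simp_all only: c\<phi> act_inverse[OF inv])
    then show "\<phi> g (\<phi> (matrix_inv g) Z) = Z" "\<phi> (matrix_inv g) (\<phi> g Z) = Z" by simp_all
  next
    fix X Y
    have "cplx_mat (\<phi> g (commutator X Y)) = cplx_mat (commutator (\<phi> g X) (\<phi> g Y))"
      by (simp only: c\<phi> cplx_mat_commutator act_commutator[OF inv])
    then show "\<phi> g (commutator X Y) = commutator (\<phi> g X) (\<phi> g Y)" by simp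
  qed (use has_type_re_mat A B in auto)
  moreover have "\<phi> g (re_mat Z) = re_mat (act g Z)" if "has_type Q 1 (- 1) Z" for Z
    by (metis c\<phi> has_type_re_mat(1)[OF that] re_cplx_mat)
  ultimately show ?thesis using A B by simp
qed

text \<open>Any \<open>B\<close> in the Lie algebra splits into its off-diagonal part
  \<open>[[B, P], P]\<close>, which represents a tangent vector, and a part commuting with
  \<open>P\<close>, which is Killing-orthogonal to \<open>[X, P]\<close>. So orthogonality to
  tangent vectors extends to the whole semisimple algebra.\<close>

lemma \<kappa>_nondegenerate:
  assumes ss: "semisimple (isometry_algebra Q)" and X: "X \<in> tangent_space D1 P"
    and 0: "\<And>Y. Y \<in> tangent_space D1 P \<Longrightarrow> \<kappa> (re_mat (commutator X P)) (re_mat (commutator Y P)) = 0"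
  shows "X = 0"
proof -
  note XP = tangent_D1[OF X]
  note PP = D1_idempotent(1)[OF XP(1)]
  let ?A = "re_mat (commutator X P)"
  have A: "?A \<in> isometry_algebra Q" "cplx_mat ?A = commutator X P" using has_type_re_mat[OF XP(4)] by auto
  have "\<kappa> ?A B = 0" if B: "B \<in> isometry_algebra Q" for B
  proof -
    have Bt: "has_type Q 1 (- 1) (cplx_mat B)" using B has_type_isometry_algebra by blast
    let ?Y = "commutator (cplx_mat B) P"
    have Y: "?Y \<in> tangent_space D1 P" by (rule commutator_in_tangent_D1[OF Bt XP(1)])
    let ?B = "re_mat (commutator ?Y P)"
    have B': "?B \<in> isometry_algebra Q" "cplx_mat ?B = commutator ?Y P"
      using has_type_re_mat[OF tangent_D1(4)[OF Y]] by auto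
    have diff: "B - ?B \<in> isometry_algebra Q"
      using B B'(1) lie_subalgebra.subspace[OF lie_subalgebra_isometry_algebra] subspace_diff by blast
    have "commutator (cplx_mat (B - ?B)) P = 0"
      using idempotent_commutator[OF PP] by (simp add: cplx_mat_simps B'(2) commutator_diff_left)
    then have "\<kappa> ?A (B - ?B) = 0"
      using diff A commutator_off_diagonal[OF PP, of X] by (intro \<kappa>_orthogonal[OF XP(1)]) auto
    moreover have "\<kappa> ?A ?B = 0" using 0[OF Y] .
    moreover have "\<kappa> B ?A = \<kappa> (B - ?B) ?A + \<kappa> ?B ?A" using \<kappa>_add[OF diff B'(1) A(1)] by simp
    ultimately show ?thesis
      unfolding \<kappa>_commute[OF A(1) B] \<kappa>_commute[OF A(1) diff] \<kappa>_commute[OF A(1) B'(1)] by linarith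
  qed
  then have "?A = 0" using ss A(1) by (auto simp: semisimple_def)
  then have "commutator X P = 0" using A(2) by (simp add: cplx_mat_simps)
  then show ?thesis using XP(5) by simp
qed

text \<open>Elements of the Lie algebra of \<open>K\<close> commute with the projector at the base
  point, hence are Killing-orthogonal to off-diagonal elements. Preserving \<open>H^+\<close>
  directly kills only one off-diagonal block.\<close>

lemma cartan_p_off_diagonal:
  assumes K: "K = {g \<in> G. (*v) (cplx_mat g) ` hplus n E0 = hplus n E0}"
    and A: "has_type Q 1 (- 1) A" and off: "A = hodge_proj n E0 ** A + A ** hodge_proj n E0"
  shows "re_mat A \<in> cartan_p G K"
proof -
  let ?P = "hodge_proj n E0"
  have P: "?P \<in> D1" by (rule base_point_in_D1)
  note PP = D1_idempotent[OF P]
  have hplus: "v \<in> hplus n E0 \<longleftrightarrow> ?P *v v = v" for v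
    using hsum_iff[OF E0, of "plus_indices n" v]
    by (auto simp: hplus_def hodge_proj_eq[OF E0] plus_indices_def)
  have "\<kappa> (re_mat A) B = 0" if BK: "B \<in> lie_algebra K" for B
  proof -
    obtain c where c: "c 0 = mat 1" "\<And>t. c t \<in> K" "(c has_vector_derivative B) (at 0)"
      using BK by (auto simp: lie_algebra_def tangent_space_def curve_through_def)
    have "B \<in> lie_algebra G"
      using c K by (auto simp: lie_algebra_def tangent_space_def curve_through_def)
    then have B: "B \<in> isometry_algebra Q" using lie_algebra_isometry_group[OF G] by simp
    let ?B = "cplx_mat B"
    have Bt: "has_type Q 1 (- 1) ?B" using B has_type_isometry_algebra by blast
    have "(mat 1 - ?P) ** cplx_mat (c t) ** ?P = 0" for t
    proof -
      have "((mat 1 - ?P) ** cplx_mat (c t) ** ?P) *v v = 0" for v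
      proof -
        have "?P *v v \<in> hplus n E0" by (simp add: hplus matrix_vector_mul_assoc PP(1))
        moreover have "(*v) (cplx_mat (c t)) ` hplus n E0 = hplus n E0" using c(2)[of t] K by blast
        ultimately have "cplx_mat (c t) *v (?P *v v) \<in> hplus n E0" by blast
        then have "?P *v (cplx_mat (c t) *v (?P *v v)) = cplx_mat (c t) *v (?P *v v)" by (simp add: hplus)
        then have "(mat 1 - ?P) *v (cplx_mat (c t) *v (?P *v v)) = 0"
          by (simp add: matrix_vector_mult_diff_rdistrib)
        then show ?thesis by (simp add: matrix_vector_mul_assoc matrix_mul_assoc)
      qed
      then show ?thesis by (simp add: matrix_eq)
    qed
    moreover have "linear (\<lambda>M. (mat 1 - ?P) ** cplx_mat M ** ?P)"
      by (simp add: linear_iff cplx_mat_simps matrix_mult_distribs scaleR_diff_right)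
    then have "((\<lambda>t. (mat 1 - ?P) ** cplx_mat (c t) ** ?P) has_vector_derivative (mat 1 - ?P) ** ?B ** ?P) (at 0)"
      using bounded_linear.has_vector_derivative[OF _ c(3)] linear_conv_bounded_linear by blast
    ultimately have "((\<lambda>t. 0) has_vector_derivative (mat 1 - ?P) ** ?B ** ?P) (at 0)" by simp
    then have lower: "(mat 1 - ?P) ** ?B ** ?P = 0"
      using vector_derivative_unique_at has_vector_derivative_const by blast
    \<comment> \<open>The other block follows by symmetry. For even \<open>n\<close>,
      \<open>?P\<close> is self-adjoint and \<open>?B\<close> skew for the form, and taking adjoints
      reverses the product; for odd \<open>n\<close>, conjugation exchanges \<open>?P\<close> and
      its complement.\<close>
    have upper: "?P ** ?B ** (mat 1 - ?P) = 0"
    proof (cases "even n")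
      case True
      have "transpose (?P - (1 / 2) *\<^sub>R mat 1) ** gram Q = gram Q ** (?P - (1 / 2) *\<^sub>R mat 1)"
        using PP(2) True by (simp add: has_type_def)
      then have PQ: "transpose ?P ** gram Q = gram Q ** ?P"
        by (simp add: transpose_simps transpose_scalar matrix_mult_distribs)
      have BQ: "transpose ?B ** gram Q = - (gram Q ** ?B)" using Bt by (simp add: has_type_def)
      have "0 = transpose ((mat 1 - ?P) ** ?B ** ?P) ** gram Q" by (simp add: lower transpose_simps)
      also have "\<dots> = transpose ?P ** transpose ?B ** ((mat 1 - transpose ?P) ** gram Q)"
        by (simp add: matrix_transpose_mul transpose_simps matrix_mul_assoc)
      also have "(mat 1 - transpose ?P) ** gram Q = gram Q ** (mat 1 - ?P)"
        by (simp add: matrix_mult_distribs PQ)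
      also have "transpose ?P ** transpose ?B ** (gram Q ** (mat 1 - ?P)) = transpose ?P ** (transpose ?B ** gram Q) ** (mat 1 - ?P)"
        by (simp add: matrix_mul_assoc)
      also have "\<dots> = - ((transpose ?P ** gram Q) ** ?B ** (mat 1 - ?P))"
        unfolding BQ by (simp add: matrix_mult_uminus_left matrix_mult_uminus_right matrix_mul_assoc)
      also have "\<dots> = - (gram Q ** (?P ** ?B ** (mat 1 - ?P)))" by (simp only: PQ matrix_mul_assoc)
      finally show ?thesis using gram_injective by simp
    next
      case False
      have "conj_mat (?P - (1 / 2) *\<^sub>R mat 1) = - (?P - (1 / 2) *\<^sub>R mat 1)"
        using PP(2) False by (simp add: has_type_def)
      then have "conj_mat ?P - (1 / 2) *\<^sub>R mat 1 = (1 / 2) *\<^sub>R mat 1 - ?P" by (simp add: conj_mat_simps)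
      then have "conj_mat ?P = ((1 / 2) *\<^sub>R mat 1 + (1 / 2) *\<^sub>R mat 1) - ?P" by (simp add: diff_eq_eq)
      then have cP: "conj_mat ?P = mat 1 - ?P" by (simp only: scaleR_half_double) simp
      then have c1P: "conj_mat (mat 1 - ?P) = ?P" by (simp add: conj_mat_simps)
      have "conj_mat ((mat 1 - ?P) ** ?B ** ?P) = 0" by (simp add: lower conj_mat_simps)
      then show ?thesis by (simp add: conj_mat_simps(1,9) cP c1P)
    qed
    have "commutator ?B ?P = 0"
      using lower upper by (simp add: commutator_def matrix_mult_distribs)
    then show ?thesis
      using B off has_type_re_mat[OF A] by (intro \<kappa>_orthogonal[OF P]) auto
  qed
  then show ?thesis
    using has_type_re_mat[OF A] by (simp add: cartan_p_def lie_algebra_isometry_group[OF G])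
qed

text \<open>The metric is prescribed only on vectors \<open>[A, P0]\<close> with \<open>A\<close> in
  the Cartan complement. A tangent vector \<open>Z\<close> at \<open>P0\<close> has this form with
  \<open>A = [Z, P0]\<close>; other points follow from invariance of the metric and of the Killing
  form.\<close>

lemma invariant_metric_formula:
  assumes K: "K = {g \<in> G. (*v) (cplx_mat g) ` hplus n E0 = hplus n E0}"
    and met: "invariant_metric G K D1 (hodge_proj n E0) met"
  obtains k where "k > 0" "\<And>P X Y. X \<in> tangent_space D1 P \<Longrightarrow> Y \<in> tangent_space D1 P \<Longrightarrow>
    met P X Y = k * \<kappa> (re_mat (commutator X P)) (re_mat (commutator Y P))"
proof -
  let ?P0 = "hodge_proj n E0"
  obtain k where k: "k > 0"
    "\<And>A B. A \<in> cartan_p G K \<Longrightarrow> B \<in> cartan_p G K \<Longrightarrow>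
      met ?P0 (commutator (cplx_mat A) ?P0) (commutator (cplx_mat B) ?P0) = k * \<kappa> A B"
    and inv: "\<And>g p X Y. g \<in> G \<Longrightarrow> p \<in> D1 \<Longrightarrow> X \<in> tangent_space D1 p \<Longrightarrow> Y \<in> tangent_space D1 p \<Longrightarrow>
      met (act g p) (act g X) (act g Y) = met p X Y"
    using met unfolding invariant_metric_def lie_algebra_isometry_group[OF G] by blast
  have P0: "?P0 \<in> D1" by (rule base_point_in_D1)
  have "met P X Y = k * \<kappa> (re_mat (commutator X P)) (re_mat (commutator Y P))"
    if X: "X \<in> tangent_space D1 P" and Y: "Y \<in> tangent_space D1 P" for P X Y
  proof -
    obtain g where g: "g \<in> G" "P = act g ?P0" using tangent_D1(1)[OF X] by (auto simp: D1_def)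
    have aut: "g \<in> aut_real Q" using isometry_group_subset[OF G g(1)] .
    then have inv_g: "invertible g" "invertible (matrix_inv g)"
      using aut_real_inv[OF aut] by (simp_all add: aut_real_iff)
    have P0_eq: "act (matrix_inv g) P = ?P0" by (simp add: g(2) act_inverse[OF inv_g(1)])
    have pulled: "act (matrix_inv g) Z \<in> tangent_space D1 ?P0" if Z: "Z \<in> tangent_space D1 P" for Z
    proof -
      have "act (matrix_inv g) Z = act (matrix_inv g) (P ** Z + Z ** P)" using tangent_D1(3)[OF Z] by simp
      then show ?thesis
        using has_type_act[OF aut_real_inv[OF aut] tangent_D1(2)[OF Z]] P0
        by (simp add: tangent_D1_iff act_simps act_mult_right[OF inv_g(2)] P0_eq)
    qed
    let ?X = "act (matrix_inv g) X"
    let ?Y = "act (matrix_inv g) Y"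
    have form: "met ?P0 X0 Y0 = k * \<kappa> (re_mat (commutator X0 ?P0)) (re_mat (commutator Y0 ?P0))"
      if X0: "X0 \<in> tangent_space D1 ?P0" and Y0: "Y0 \<in> tangent_space D1 ?P0" for X0 Y0
    proof -
      have *: "re_mat (commutator Z ?P0) \<in> cartan_p G K"
        "commutator (cplx_mat (re_mat (commutator Z ?P0))) ?P0 = Z" if Z: "Z \<in> tangent_space D1 ?P0" for Z
        using cartan_p_off_diagonal[OF K tangent_D1(4)[OF Z]] commutator_off_diagonal[OF D1_idempotent(1)[OF P0]]
          has_type_re_mat(1)[OF tangent_D1(4)[OF Z]] tangent_D1(5)[OF Z] by auto
      show ?thesis using k(2)[OF *(1)[OF X0] *(1)[OF Y0]] by (simp add: *(2) X0 Y0)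
    qed
    have "met P X Y = met (act g ?P0) (act g ?X) (act g ?Y)"
      by (simp add: g(2) act_inverse[OF inv_g(1)])
    also have "\<dots> = met ?P0 ?X ?Y" using inv[OF g(1) P0 pulled[OF X] pulled[OF Y]] .
    also have "\<dots> = k * \<kappa> (re_mat (commutator ?X ?P0)) (re_mat (commutator ?Y ?P0))"
      by (rule form[OF pulled[OF X] pulled[OF Y]])
    also have "commutator ?X ?P0 = act (matrix_inv g) (commutator X P)"
      by (simp add: act_commutator[OF inv_g(2)] P0_eq)
    also have "commutator ?Y ?P0 = act (matrix_inv g) (commutator Y P)"
      by (simp add: act_commutator[OF inv_g(2)] P0_eq)
    also have "\<kappa> (re_mat (act (matrix_inv g) (commutator X P))) (re_mat (act (matrix_inv g) (commutator Y P))) =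
       \<kappa> (re_mat (commutator X P)) (re_mat (commutator Y P))"
      by (rule \<kappa>_act[OF aut_real_inv[OF aut] tangent_D1(4)[OF X] tangent_D1(4)[OF Y]])
    finally show ?thesis .
  qed
  then show thesis using that k(1) by blast
qed

end

section \<open>The Levi-Civita connection and its pullbacks\<close>

text \<open>A connection acts on total functions, so values off \<open>S\<close> could matter a
  priori. The difference \<open>R\<close> of the two sections vanishes on \<open>S\<close>, as does
  the indicator \<phi> of the complement, and multiplying \<open>R\<close> by \<phi> changes
  nothing; in the Leibniz rule both terms are then 0.\<close>

lemma connection_along_cong:
  assumes nabf: "connection_along S M f nabf" and W: "section_along S M f W"
    and eq: "\<And>x. x \<in> S \<Longrightarrow> W x = Z x" and zero: "\<And>x. x \<in> S \<Longrightarrow> 0 \<in> tangent_space M (f x)"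
    and p: "p \<in> S" "v \<in> tangent_space S p"
  shows "nabf p v Z = nabf p v W"
proof -
  define \<phi> :: "'a \<Rightarrow> real" where "\<phi> x = (if x \<in> S then 0 else 1)" for x
  have \<phi>: "smooth_on S \<phi>"
    by (rule smooth_on_cong[of _ "\<lambda>x. 0"]) (simp_all add: \<phi>_def smooth_on_const)
  define R where "R x = Z x - W x" for x
  have "smooth_on S R" by (rule smooth_on_cong[of _ "\<lambda>x. 0"]) (simp_all add: R_def eq smooth_on_const)
  then have R: "section_along S M f R" using zero by (simp add: section_along_def R_def eq)
  have \<phi>R: "(\<lambda>x. \<phi> x *\<^sub>R R x) = R" by (auto simp: \<phi>_def R_def eq fun_eq_iff)
  have "nabf p v (\<lambda>x. \<phi> x *\<^sub>R R x) = differential S \<phi> p v *\<^sub>R R p + \<phi> p *\<^sub>R nabf p v R"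
    using nabf \<phi> R p unfolding connection_along_def by blast
  then have "nabf p v R = 0" using p(1) unfolding \<phi>R by (simp add: \<phi>_def R_def eq)
  moreover have "nabf p v (\<lambda>x. W x + R x) = nabf p v W + nabf p v R"
    using nabf W R p unfolding connection_along_def by blast
  moreover have "(\<lambda>x. W x + R x) = Z" by (simp add: R_def)
  ultimately show ?thesis by simp
qed

lemma connection_along_sum:
  assumes nabf: "connection_along S M f nabf" and fin: "finite I"
    and W: "\<And>i. i \<in> I \<Longrightarrow> section_along S M f (W i)"
    and zero: "section_along S M f (\<lambda>x. 0)"
    and add: "\<And>Y Z. section_along S M f Y \<Longrightarrow> section_along S M f Z \<Longrightarrow> section_along S M f (\<lambda>x. Y x + Z x)"
    and p: "p \<in> S" "v \<in> tangent_space S p"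
  shows "nabf p v (\<lambda>x. \<Sum>i\<in>I. W i x) = (\<Sum>i\<in>I. nabf p v (W i))"
proof -
  have nab_add: "nabf p v (\<lambda>x. Y x + Z x) = nabf p v Y + nabf p v Z"
    if "section_along S M f Y" "section_along S M f Z" for Y Z
    using nabf p that unfolding connection_along_def by blast
  have "nabf p v (\<lambda>x. \<Sum>i\<in>I. W i x) = (\<Sum>i\<in>I. nabf p v (W i)) \<and> section_along S M f (\<lambda>x. \<Sum>i\<in>I. W i x)"
    using fin W
  proof (induction I rule: finite_induct)
    case empty
    have "nabf p v (\<lambda>x. 0) = nabf p v (\<lambda>x. 0) + nabf p v (\<lambda>x. 0)" using nab_add[OF zero zero] by simp
    then show ?case using zero by simp
  next
    case (insert i I)
    then show ?case using nab_add add by simp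
  qed
  then show ?thesis by blast
qed

lemma commutator_has_vector_derivative:
  fixes a b :: "real \<Rightarrow> complex^'m^'m"
  assumes "(a has_vector_derivative a') (at t)" "(b has_vector_derivative b') (at t)"
  shows "((\<lambda>t. commutator (a t) (b t)) has_vector_derivative commutator (a t) b' + commutator a' (b t)) (at t)"
  using bounded_bilinear.has_vector_derivative[OF bounded_bilinear_commutator assms] .

lemma smooth_on_commutator:
  fixes f g :: "'a::euclidean_space \<Rightarrow> complex^'m^'m"
  shows "smooth_on S f \<Longrightarrow> smooth_on S g \<Longrightarrow> smooth_on S (\<lambda>x. commutator (f x) (g x))"
  by (rule smooth_on_bilinear[OF bounded_bilinear_commutator])

text \<open>The group \<open>K\<close> is eliminated here: the metric enters in the explicit form
  supplied by \<open>invariant_metric_formula\<close>.\<close>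

locale hodge_orbit_connection = hodge_orbit n Q G E0
  for n :: nat and Q :: "int^'m^'m" and G :: "(real^'m^'m) set" and E0 :: "complex^'m^'m" +
  fixes met :: "complex^'m^'m \<Rightarrow> complex^'m^'m \<Rightarrow> complex^'m^'m \<Rightarrow> real"
    and nab :: "complex^'m^'m \<Rightarrow> complex^'m^'m \<Rightarrow> (complex^'m^'m \<Rightarrow> complex^'m^'m) \<Rightarrow> complex^'m^'m"
    and k :: real
  assumes semisimple: "semisimple (isometry_algebra Q)"
    and k: "k > 0"
    and met: "\<And>P X Y. X \<in> tangent_space D1 P \<Longrightarrow> Y \<in> tangent_space D1 P \<Longrightarrow>
      met P X Y = k * \<kappa> (re_mat (commutator X P)) (re_mat (commutator Y P))"
    and levi_civita: "levi_civita D1 met nab"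
begin

text \<open>These are the fundamental fields of the group action. They are defined on all of
  \<open>D1\<close>, so the axioms of \<open>levi_civita\<close> apply to them.\<close>

lemma vector_field_commutator:
  assumes "has_type Q 1 (- 1) A"
  shows "vector_field D1 (\<lambda>x. commutator A x)"
  using commutator_in_tangent_D1[OF assms]
  by (simp add: section_along_def smooth_on_commutator[OF smooth_on_const smooth_on_id])

lemma differential_commutator:
  assumes "v \<in> tangent_space D1 P"
  shows "differential D1 (\<lambda>x. commutator A x) P v = commutator A v"
proof (rule differential_eqI[OF assms])
  fix c assume "curve_through D1 P v c"
  then have "(c has_vector_derivative v) (at 0)" by (simp add: curve_through_def)
  from commutator_has_vector_derivative[OF has_vector_derivative_const[of A] this]
  show "((\<lambda>t. commutator A (c t)) has_vector_derivative commutator A v) (at 0)" by simp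
qed

abbreviation proj :: "complex^'m^'m \<Rightarrow> complex^'m^'m \<Rightarrow> complex^'m^'m" where
  "proj P Z \<equiv> commutator (commutator Z P) P"

lemma proj_tangent:
  assumes "P \<in> D1" "has_type Q \<sigma> \<sigma> Z"
  shows "proj P Z \<in> tangent_space D1 P"
  using commutator_in_tangent_D1[OF _ assms(1)] has_type_commutator_D1[OF assms] by (simp add: \<sigma>_mult)

lemma has_type_lie_tangent:
  assumes "has_type Q 1 (- 1) A" "has_type Q \<sigma> \<sigma> w"
  shows "has_type Q \<sigma> \<sigma> (commutator A w)"
  using has_type_commutator[OF assms] by simp

lemma metric_commute:
  assumes "X \<in> tangent_space D1 P" "Y \<in> tangent_space D1 P"
  shows "met P X Y = met P Y X"
  using \<kappa>_commute[OF has_type_re_mat(2)[OF tangent_D1(4)[OF assms(1)]] has_type_re_mat(2)[OF tangent_D1(4)[OF assms(2)]]]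
  by (simp only: met[OF assms] met[OF assms(2,1)])

lemma metric_add:
  assumes "X \<in> tangent_space D1 P" "Y \<in> tangent_space D1 P" "Z \<in> tangent_space D1 P"
  shows "met P (X + Y) Z = met P X Z + met P Y Z"
  using assms has_type_re_mat(2)[OF tangent_D1(4)] tangent_D1_linear(1)[OF assms(1,2)]
  by (simp add: met commutator_add_left linear_add[OF linear_re_mat] \<kappa>_add algebra_simps)

text \<open>The projected flat connection is metric on fundamental fields. The field of
  \<open>A\<close> is represented in the Lie algebra by \<open>[[A, x], x]\<close>; of its
  derivative only the off-diagonal part survives pairing with another off-diagonal
  representative.\<close>

lemma metric_derivative:
  assumes P: "P \<in> D1" and A: "has_type Q 1 (- 1) A" and B: "has_type Q 1 (- 1) B"
    and w: "w \<in> tangent_space D1 P"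
  shows "differential D1 (\<lambda>x. met x (commutator A x) (commutator B x)) P w =
    met P (proj P (commutator A w)) (commutator B P) + met P (commutator A P) (proj P (commutator B w))"
proof (rule differential_eqI[OF w])
  fix c assume "curve_through D1 P w c"
  then have c: "c 0 = P" "\<And>t. c t \<in> D1" "(c has_vector_derivative w) (at 0)"
    by (auto simp: curve_through_def)
  obtain \<beta> where \<beta>: "bounded_bilinear \<beta>"
    "\<And>A B. A \<in> isometry_algebra Q \<Longrightarrow> B \<in> isometry_algebra Q \<Longrightarrow> \<beta> A B = \<kappa> A B"
    using lie_subalgebra.killing_form_bounded_bilinear[OF lie_subalgebra_isometry_algebra] by metis
  note PP = D1_idempotent(1)[OF P]
  note wP = tangent_D1[OF w]
  define a where "a C t = re_mat (proj (c t) C)" for C t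
  \<comment> \<open>The first summand is \<open>[[C, w], P]\<close>; the added projection, harmless
    by \<open>idempotent_commutator\<close>, displays it as the representative of the tangent vector
    \<open>proj P [C, w]\<close>.\<close>
  define a' where "a' C = re_mat (proj P (commutator (commutator C w) P)) + re_mat (commutator (commutator C P) w)" for C
  have br: "bounded_linear re_mat" using linear_re_mat linear_conv_bounded_linear by blast
  have a: "(a C has_vector_derivative a' C) (at 0)" "a C 0 \<in> isometry_algebra Q"
    "a C t \<in> isometry_algebra Q" "cplx_mat (a C 0) = proj P C"
    "a C t = re_mat (commutator (commutator C (c t)) (c t))"
    if C: "has_type Q 1 (- 1) C" for C t
  proof -
    have "((\<lambda>t. commutator C (c t)) has_vector_derivative commutator C w) (at 0)"
      using commutator_has_vector_derivative[OF has_vector_derivative_const[of C] c(3)] by simp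
    from commutator_has_vector_derivative[OF this c(3)]
    have "((\<lambda>t. proj (c t) C) has_vector_derivative commutator (commutator C P) w + commutator (commutator C w) P) (at 0)"
      by (simp add: c(1))
    from bounded_linear.has_vector_derivative[OF br this]
    have "(a C has_vector_derivative re_mat (commutator (commutator C P) w + commutator (commutator C w) P)) (at 0)"
      by (simp add: a_def[abs_def])
    then show "(a C has_vector_derivative a' C) (at 0)"
      by (simp add: a'_def idempotent_commutator[OF PP] linear_add[OF linear_re_mat] add.commute)
    have "has_type Q 1 (- 1) (proj (c t) C)" for t
      using tangent_D1(4)[OF commutator_in_tangent_D1[OF C c(2)]] .
    note ty = has_type_re_mat[OF this]
    show "a C 0 \<in> isometry_algebra Q" "a C t \<in> isometry_algebra Q" "cplx_mat (a C 0) = proj P C"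
      using ty(2)[of 0] ty(2)[of t] ty(1)[of 0] by (simp_all add: a_def c(1))
    show "a C t = re_mat (commutator (commutator C (c t)) (c t))" by (simp add: a_def)
  qed
  have cross: "\<beta> (a' C) (a C' 0) = \<kappa> (re_mat (commutator (proj P (commutator C w)) P)) (re_mat (proj P C'))"
    if C: "has_type Q 1 (- 1) C" "has_type Q 1 (- 1) C'" for C C'
  proof -
    \<comment> \<open>Both factors are tangent vectors at \<open>P\<close>, so their commutator
      commutes with \<open>P\<close> and is Killing-orthogonal to \<open>a C' 0\<close>.\<close>
    let ?N = "commutator (commutator C P) w"
    have T: "commutator C P \<in> tangent_space D1 P" by (rule commutator_in_tangent_D1[OF C(1) P])
    have N: "has_type Q 1 (- 1) ?N"
      using has_type_commutator[OF tangent_D1(2)[OF T] wP(2)] by (simp add: \<sigma>_mult)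
    have "commutator (commutator C P ** w) P = 0" "commutator (w ** commutator C P) P = 0"
      using off_diagonal_mult[OF PP] tangent_D1(3)[OF T] wP(3) by blast+
    then have N0: "commutator ?N P = 0"
      by (simp add: commutator_diff_left commutator_def[of "commutator C P" w])
    have M: "has_type Q 1 (- 1) (commutator (proj P (commutator C w)) P)"
      by (rule tangent_D1(4)[OF proj_tangent[OF P has_type_lie_tangent[OF C(1) wP(2)]]])
    note Nr = has_type_re_mat[OF N] and Mr = has_type_re_mat[OF M]
    have "\<beta> (a' C) (a C' 0) = \<beta> (re_mat (commutator (proj P (commutator C w)) P)) (a C' 0) + \<beta> (re_mat ?N) (a C' 0)"
      by (simp add: a'_def bounded_bilinear.add_left[OF \<beta>(1)])
    also have "\<beta> (re_mat ?N) (a C' 0) = \<kappa> (a C' 0) (re_mat ?N)"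
      using \<beta>(2) \<kappa>_commute Nr(2) a(2)[OF C(2)] by simp
    also have "\<dots> = 0"
      using Nr a(2,4)[OF C(2)] N0 commutator_off_diagonal[OF PP, of "commutator C' P"]
      by (intro \<kappa>_orthogonal[OF P]) auto
    finally show ?thesis using \<beta>(2)[OF Mr(2) a(2)[OF C(2)]] by (simp add: a_def c(1))
  qed
  have eq: "met (c t) (commutator A (c t)) (commutator B (c t)) = k * \<beta> (a A t) (a B t)" for t
    using met[OF commutator_in_tangent_D1[OF A c(2)] commutator_in_tangent_D1[OF B c(2)]]
      \<beta>(2)[OF a(3)[OF A] a(3)[OF B]] by (simp add: a(5)[OF A] a(5)[OF B])
  have "((\<lambda>t. \<beta> (a A t) (a B t)) has_vector_derivative \<beta> (a A 0) (a' B) + \<beta> (a' A) (a B 0)) (at 0)"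
    by (rule bounded_bilinear.has_vector_derivative[OF \<beta>(1) a(1)[OF A] a(1)[OF B]])
  from bounded_linear.has_vector_derivative[OF bounded_linear_mult_right this, of k]
  have "((\<lambda>t. k * \<beta> (a A t) (a B t)) has_vector_derivative k * (\<beta> (a A 0) (a' B) + \<beta> (a' A) (a B 0))) (at 0)" .
  moreover have "\<beta> (a A 0) (a' B) = \<beta> (a' B) (a A 0)"
  proof -
    have "a' B \<in> isometry_algebra Q"
    proof -
      have T: "commutator B P \<in> tangent_space D1 P" by (rule commutator_in_tangent_D1[OF B P])
      have "has_type Q 1 (- 1) (commutator (commutator B P) w)"
        using has_type_commutator[OF tangent_D1(2)[OF T] wP(2)] by (simp add: \<sigma>_mult)
      moreover have "has_type Q 1 (- 1) (commutator (proj P (commutator B w)) P)"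
        by (rule tangent_D1(4)[OF proj_tangent[OF P has_type_lie_tangent[OF B wP(2)]]])
      ultimately show ?thesis
        unfolding a'_def using has_type_re_mat(2)
          subspace_add[OF lie_subalgebra.subspace[OF lie_subalgebra_isometry_algebra]] by blast
    qed
    then show ?thesis using \<beta>(2) \<kappa>_commute a(2)[OF A] by simp
  qed
  ultimately have "((\<lambda>t. met (c t) (commutator A (c t)) (commutator B (c t))) has_vector_derivative
    k * (\<beta> (a' B) (a A 0) + \<beta> (a' A) (a B 0))) (at 0)" by (simp add: eq)
  moreover have "k * (\<beta> (a' B) (a A 0) + \<beta> (a' A) (a B 0)) =
    met P (proj P (commutator A w)) (commutator B P) + met P (commutator A P) (proj P (commutator B w))"
  proof -
    have T: "proj P (commutator C w) \<in> tangent_space D1 P" "commutator C P \<in> tangent_space D1 P"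
      if "has_type Q 1 (- 1) C" for C
      using proj_tangent[OF P has_type_lie_tangent[OF that wP(2)]] commutator_in_tangent_D1[OF that P] by auto
    show ?thesis
      unfolding metric_commute[OF T(2)[OF A] T(1)[OF B]]
      by (simp add: cross[OF A B] cross[OF B A] met[OF T(1)[OF A] T(2)[OF B]] met[OF T(1)[OF B] T(2)[OF A]] algebra_simps)
  qed
  ultimately show "((\<lambda>t. met (c t) (commutator A (c t)) (commutator B (c t))) has_vector_derivative
    met P (proj P (commutator A w)) (commutator B P) + met P (commutator A P) (proj P (commutator B w))) (at 0)"
    by simp
qed

text \<open>The fields \<open>x \<mapsto> [A, x]\<close> span the tangent spaces, so the usual permutation argument shows that
  the difference between \<open>nab\<close> and the projected flat connection, symmetric because both are
  torsion-free and skew because both are metric, vanishes.\<close>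

lemma levi_civita_commutator:
  assumes P: "P \<in> D1" and A: "has_type Q 1 (- 1) A" and w: "w \<in> tangent_space D1 P"
  shows "nab P w (\<lambda>x. commutator A x) = proj P (commutator A w)"
proof -
  let ?L = "has_type Q 1 (- 1)"
  let ?Y = "\<lambda>C x. commutator C x"
  define T where "T A C = nab P (?Y C P) (?Y A) - proj P (commutator A (?Y C P))" for A C
  note PP = D1_idempotent(1)[OF P]
  have Y: "?Y C P \<in> tangent_space D1 P" if "?L C" for C by (rule commutator_in_tangent_D1[OF that P])
  have con: "connection_along D1 D1 (\<lambda>p. p) nab" using levi_civita by (simp add: levi_civita_def)
  have nabT: "nab P (?Y C P) (?Y A) \<in> tangent_space D1 P" if "?L A" "?L C" for A C
    using con vector_field_commutator[OF that(1)] Y[OF that(2)] P unfolding connection_along_def by blast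
  have projT: "proj P (commutator A (?Y C P)) \<in> tangent_space D1 P" if "?L A" "?L C" for A C
    by (rule proj_tangent[OF P has_type_lie_tangent[OF that(1) tangent_D1(2)[OF Y[OF that(2)]]]])
  have TT: "T A C \<in> tangent_space D1 P" if "?L A" "?L C" for A C
    unfolding T_def by (rule tangent_D1_linear(2)[OF nabT[OF that] projT[OF that]])
  have sym: "T A C = T C A" if A: "?L A" and C: "?L C" for A C
  proof -
    have "nab P (?Y C P) (?Y A) - nab P (?Y A P) (?Y C) = lie_bracket D1 (?Y C) (?Y A) P"
      using levi_civita vector_field_commutator[OF A] vector_field_commutator[OF C] P
      unfolding levi_civita_def by blast
    also have "\<dots> = commutator A (commutator C P) - commutator C (commutator A P)"
      unfolding lie_bracket_def by (simp add: differential_commutator Y[OF A] Y[OF C])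
    also have "\<dots> = commutator (commutator A C) P" by (rule commutator_jacobi)
    \<comment> \<open>A tangent vector is fixed by the projection; the right-hand side then becomes
      the antisymmetrized projected flat connection, which is thus torsion-free on these
      fields.\<close>
    also have "\<dots> = proj P (commutator (commutator A C) P)" using idempotent_commutator[OF PP] by simp
    also have "\<dots> = proj P (commutator A (?Y C P)) - proj P (commutator C (?Y A P))"
      by (simp add: commutator_jacobi[symmetric] commutator_diff_left)
    finally have "nab P (?Y C P) (?Y A) - nab P (?Y A P) (?Y C) =
      proj P (commutator A (?Y C P)) - proj P (commutator C (?Y A P))" .
    then show ?thesis unfolding T_def by (simp add: algebra_simps)
  qed
  have skew: "met P (T A C) (?Y B P) + met P (?Y A P) (T B C) = 0" if A: "?L A" and B: "?L B" and C: "?L C" for A B C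
  proof -
    have "differential D1 (\<lambda>x. met x (?Y A x) (?Y B x)) P (?Y C P) =
      met P (nab P (?Y C P) (?Y A)) (?Y B P) + met P (?Y A P) (nab P (?Y C P) (?Y B))"
      using levi_civita vector_field_commutator[OF A] vector_field_commutator[OF B] P Y[OF C]
      unfolding levi_civita_def by blast
    moreover have "nab P (?Y C P) (?Y X) = T X C + proj P (commutator X (?Y C P))" for X by (simp add: T_def)
    moreover have "met P (T A C + proj P (commutator A (?Y C P))) (?Y B P) =
        met P (T A C) (?Y B P) + met P (proj P (commutator A (?Y C P))) (?Y B P)"
      by (rule metric_add[OF TT[OF A C] projT[OF A C] Y[OF B]])
    moreover have "met P (?Y A P) (T B C + proj P (commutator B (?Y C P))) =
        met P (?Y A P) (T B C) + met P (?Y A P) (proj P (commutator B (?Y C P)))"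
      using metric_add[OF TT[OF B C] projT[OF B C] Y[OF A]] metric_commute Y[OF A] TT[OF B C] projT[OF B C]
        tangent_D1_linear(1)[OF TT[OF B C] projT[OF B C]] by simp
    ultimately show ?thesis using metric_derivative[OF P A B Y[OF C]] by simp
  qed
  define \<tau> where "\<tau> A B C = met P (T A C) (?Y B P)" for A B C
  have \<tau>1: "\<tau> A B C = - \<tau> B A C" if "?L A" "?L B" "?L C" for A B C
    using skew[OF that] metric_commute[OF Y[OF that(1)] TT[OF that(2,3)]] by (simp add: \<tau>_def)
  have \<tau>2: "\<tau> A B C = \<tau> C B A" if "?L A" "?L C" for A B C
    using sym[OF that] by (simp add: \<tau>_def)
  have \<tau>0: "\<tau> A B C = 0" if L: "?L A" "?L B" "?L C" for A B C
  proof -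
    have "\<tau> A B C = - \<tau> B A C" by (rule \<tau>1[OF L])
    also have "\<tau> B A C = \<tau> C A B" by (rule \<tau>2[OF L(2,3)])
    also have "\<tau> C A B = - \<tau> A C B" by (rule \<tau>1[OF L(3,1,2)])
    also have "\<tau> A C B = \<tau> B C A" by (rule \<tau>2[OF L(1,2)])
    also have "\<tau> B C A = - \<tau> C B A" by (rule \<tau>1[OF L(2,3,1)])
    also have "\<tau> C B A = \<tau> A B C" by (rule \<tau>2[OF L(3,1)])
    finally show ?thesis by simp
  qed
  \<comment> \<open>This choice makes the fundamental field of \<open>C\<close> take the prescribed
    value \<open>w\<close> at \<open>P\<close>.\<close>
  define C where "C = commutator w P"
  have C: "?L C" "?Y C P = w" using tangent_D1(4,5)[OF w] by (simp_all add: C_def)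
  have "T A C = 0"
  proof (rule \<kappa>_nondegenerate[OF semisimple TT[OF A C(1)]])
    fix V assume V: "V \<in> tangent_space D1 P"
    have "met P (T A C) V = 0"
      using \<tau>0[OF A tangent_D1(4)[OF V] C(1)] tangent_D1(5)[OF V] by (simp add: \<tau>_def)
    then show "\<kappa> (re_mat (commutator (T A C) P)) (re_mat (commutator V P)) = 0"
      using met[OF TT[OF A C(1)] V] k by simp
  qed
  then show ?thesis by (simp add: T_def C(2))
qed

text \<open>The chain rule determines the pullback connection only on sections of the form Y(f x).
  From \<open>W = [[W, f], f]\<close>, expanding \<open>[W, f]\<close> in a basis of the Lie algebra
  writes \<open>W\<close> as a combination of fundamental fields along \<open>f\<close> with smooth
  coefficients; the Leibniz rule reassembles the derivative.\<close>

lemma pullback_connection_formula: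
  fixes f :: "'a::euclidean_space \<Rightarrow> complex^'m^'m"
  assumes nabf: "pullback_connection S D1 f nab nabf" and f: "smooth_on S f" "f ` S \<subseteq> D1"
    and W: "section_along S D1 f W" and p: "p \<in> S" "v \<in> tangent_space S p"
  shows "nabf p v W = proj (f p) (differential S W p v)"
proof -
  have con: "connection_along S D1 f nabf" using nabf by (simp add: pullback_connection_def)
  obtain c where c: "curve_through S p v c" using p(2) by (auto simp: tangent_space_def)
  have c0: "c 0 = p" "\<And>t. c t \<in> S" using c by (auto simp: curve_through_def)
  obtain B where B: "finite B" "B \<subseteq> isometry_algebra Q"
    "\<And>x. x \<in> isometry_algebra Q \<Longrightarrow> x = (\<Sum>b\<in>B. (x \<bullet> b) *\<^sub>R b)"
    using subspace_orthonormal_expansion[OF lie_subalgebra.subspace[OF lie_subalgebra_isometry_algebra[of Q]]]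
    by blast
  have Bt: "has_type Q 1 (- 1) (cplx_mat b)" if "b \<in> B" for b using B(2) that has_type_isometry_algebra by blast
  define a where "a b x = re_mat (commutator (W x) (f x)) \<bullet> b" for b x
  define Z where "Z b x = commutator (cplx_mat b) (f x)" for b x
  have WT: "W x \<in> tangent_space D1 (f x)" if "x \<in> S" for x using W that by (simp add: section_along_def)
  have W_smooth: "smooth_on S W" using W by (simp add: section_along_def)
  have br: "bounded_linear re_mat" using linear_re_mat linear_conv_bounded_linear by blast
  have a: "smooth_on S (a b)" for b
    unfolding a_def
    by (rule smooth_on_linear_comp[OF bounded_linear_inner_left smooth_on_linear_comp[OF br smooth_on_commutator[OF W_smooth f(1)]]])
  have Z_smooth: "smooth_on S (Z b)" for b
    unfolding Z_def by (rule smooth_on_commutator[OF smooth_on_const f(1)])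
  have Z: "section_along S D1 f (Z b)" if "b \<in> B" for b
    using Z_smooth commutator_in_tangent_D1[OF Bt[OF that]] f(2) by (auto simp: section_along_def Z_def)
  have aZ: "section_along S D1 f (\<lambda>x. a b x *\<^sub>R Z b x)" if "b \<in> B" for b
    using Z[OF that] smooth_on_bilinear[OF bounded_bilinear_scaleR a Z_smooth] tangent_D1_linear(3)
    by (auto simp: section_along_def)
  have eq: "W x = (\<Sum>b\<in>B. a b x *\<^sub>R Z b x)" if x: "x \<in> S" for x
  proof -
    note T = tangent_D1[OF WT[OF x]]
    note R = has_type_re_mat[OF T(4)]
    have "commutator (W x) (f x) = cplx_mat (\<Sum>b\<in>B. a b x *\<^sub>R b)"
      using R(1) B(3)[OF R(2)] by (simp add: a_def)
    also have "\<dots> = (\<Sum>b\<in>B. a b x *\<^sub>R cplx_mat b)"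
      by (simp add: linear_sum[OF linear_cplx_mat] cplx_mat_simps)
    finally show ?thesis
      using T(5) by (simp add: Z_def commutator_sum_left commutator_scaleR_left)
  qed
  have zero: "section_along S D1 f (\<lambda>x. 0)"
    using f(2) tangent_D1_zero by (auto simp: section_along_def smooth_on_const)
  have add: "section_along S D1 f (\<lambda>x. Y x + V x)" if "section_along S D1 f Y" "section_along S D1 f V" for Y V
    using that by (auto simp: section_along_def smooth_on_add tangent_D1_linear(1))
  have sum: "nabf p v (\<lambda>x. \<Sum>b\<in>B. a b x *\<^sub>R Z b x) = (\<Sum>b\<in>B. nabf p v (\<lambda>x. a b x *\<^sub>R Z b x))"
    by (rule connection_along_sum[OF con B(1)]) (simp_all only: aZ zero add p)
  let ?w = "differential S f p v"
  have w: "?w \<in> tangent_space D1 (f p)" by (rule differential_tangent[OF f p(2)])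
  have fp: "f p \<in> D1" using f(2) p(1) by blast
  have nabZ: "nabf p v (Z b) = proj (f p) (commutator (cplx_mat b) ?w)" if b: "b \<in> B" for b
  proof -
    have "nabf p v (\<lambda>x. commutator (cplx_mat b) (f x)) = nab (f p) ?w (\<lambda>x. commutator (cplx_mat b) x)"
      using nabf vector_field_commutator[OF Bt[OF b]] p unfolding pullback_connection_def by blast
    then show ?thesis using levi_civita_commutator[OF fp Bt[OF b] w] by (simp add: Z_def[abs_def])
  qed
  have leibniz: "nabf p v (\<lambda>x. a b x *\<^sub>R Z b x) =
      differential S (a b) p v *\<^sub>R Z b p + a b p *\<^sub>R proj (f p) (commutator (cplx_mat b) ?w)" if b: "b \<in> B" for b
  proof -
    have "\<forall>\<phi> W. smooth_on S \<phi> \<longrightarrow> section_along S D1 f W \<longrightarrow> (\<forall>p\<in>S. \<forall>v\<in>tangent_space S p.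
        nabf p v (\<lambda>x. \<phi> x *\<^sub>R W x) = differential S \<phi> p v *\<^sub>R W p + \<phi> p *\<^sub>R nabf p v W)"
      using con unfolding connection_along_def by (elim conjE)
    from this[rule_format, OF a Z[OF b] p] show ?thesis using nabZ[OF b] by simp
  qed
  have "nabf p v W = nabf p v (\<lambda>x. \<Sum>b\<in>B. a b x *\<^sub>R Z b x)"
    using eq W f(2) tangent_D1_zero by (intro connection_along_cong[OF con W _ _ p, symmetric]) auto
  also have "\<dots> = (\<Sum>b\<in>B. differential S (a b) p v *\<^sub>R Z b p + a b p *\<^sub>R proj (f p) (commutator (cplx_mat b) ?w))"
    unfolding sum by (rule sum.cong) (simp_all only: leibniz)
  also have "\<dots> = proj (f p) (\<Sum>b\<in>B. a b p *\<^sub>R commutator (cplx_mat b) ?w + differential S (a b) p v *\<^sub>R Z b p)"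
  proof -
    have "proj (f p) (Z b p) = Z b p" for b
      using idempotent_commutator[OF D1_idempotent(1)[OF fp]] by (simp add: Z_def)
    then show ?thesis
      by (simp add: commutator_sum_left commutator_add_left commutator_scaleR_left add.commute)
  qed
  also have "(\<Sum>b\<in>B. a b p *\<^sub>R commutator (cplx_mat b) ?w + differential S (a b) p v *\<^sub>R Z b p) = differential S W p v"
  proof -
    have "((\<lambda>t. \<Sum>b\<in>B. a b (c t) *\<^sub>R Z b (c t)) has_vector_derivative
       (\<Sum>b\<in>B. a b (c 0) *\<^sub>R commutator (cplx_mat b) ?w + differential S (a b) p v *\<^sub>R Z b (c 0))) (at 0)"
    proof (intro has_vector_derivative_sum has_vector_derivative_scaleR)
      fix b assume "b \<in> B"
      show "((\<lambda>t. a b (c t)) has_field_derivative differential S (a b) p v) (at 0)"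
        using differential_curve[OF a c] by (simp add: has_real_derivative_iff_has_vector_derivative)
      show "((\<lambda>t. Z b (c t)) has_vector_derivative commutator (cplx_mat b) ?w) (at 0)"
        using commutator_has_vector_derivative[OF has_vector_derivative_const differential_curve[OF f(1) c], of "cplx_mat b"]
        by (simp add: Z_def)
    qed
    then have "((\<lambda>t. W (c t)) has_vector_derivative
       (\<Sum>b\<in>B. a b p *\<^sub>R commutator (cplx_mat b) ?w + differential S (a b) p v *\<^sub>R Z b p)) (at 0)"
      using eq c0 by simp
    then show ?thesis using differential_curve[OF W_smooth c] vector_derivative_unique_at by blast
  qed
  finally show ?thesis .
qed

end

section \<open>Submanifolds\<close>

lemma tangent_space_subspace:
  fixes L :: "'a::euclidean_space set"
  assumes "subspace L"
  shows "tangent_space L z \<subseteq> L"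
proof
  fix v assume "v \<in> tangent_space L z"
  then obtain c where c: "\<And>t. c t \<in> L" "(c has_vector_derivative v) (at 0)"
    by (auto simp: tangent_space_def curve_through_def)
  obtain B where B: "finite B" "B \<subseteq> L" "\<And>x. x \<in> L \<Longrightarrow> x = (\<Sum>b\<in>B. (x \<bullet> b) *\<^sub>R b)"
    using subspace_orthonormal_expansion[OF assms] by blast
  have "linear (\<lambda>x. \<Sum>b\<in>B. (x \<bullet> b) *\<^sub>R b)"
    by (simp add: linear_iff inner_add_left scaleR_add_left sum.distrib scaleR_sum_right)
  then have "((\<lambda>t. \<Sum>b\<in>B. (c t \<bullet> b) *\<^sub>R b) has_vector_derivative (\<Sum>b\<in>B. (v \<bullet> b) *\<^sub>R b)) (at 0)"
    using bounded_linear.has_vector_derivative[OF _ c(2)] linear_conv_bounded_linear by blast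
  then have "(c has_vector_derivative (\<Sum>b\<in>B. (v \<bullet> b) *\<^sub>R b)) (at 0)"
    using B(3)[OF c(1)] by simp
  then have "v = (\<Sum>b\<in>B. (v \<bullet> b) *\<^sub>R b)" using c(2) vector_derivative_unique_at by blast
  moreover have "(\<Sum>b\<in>B. (v \<bullet> b) *\<^sub>R b) \<in> L"
    using B(2) by (intro subspace_sum[OF assms] subspace_scale[OF assms]) auto
  ultimately show "v \<in> L" by simp
qed

lemma smooth_on_open_derivative:
  fixes f :: "'a::euclidean_space \<Rightarrow> 'b::euclidean_space"
  assumes S: "open S" and f: "smooth_on S f" and p: "p \<in> S"
  obtains W f' where "open W" "p \<in> W" "W \<subseteq> S" "\<And>x. x \<in> W \<Longrightarrow> (f has_derivative f' x) (at x)"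
    "\<And>k v. Ck_on k W (\<lambda>x. f' x v)" "\<And>x v. x \<in> W \<Longrightarrow> differential S f x v = f' x v"
proof -
  obtain W F F' where W: "open W" "p \<in> W" "\<And>x. x \<in> S \<inter> W \<Longrightarrow> f x = F x"
    "\<And>x. x \<in> W \<Longrightarrow> (F has_derivative F' x) (at x)" "\<And>k v. Ck_on k W (\<lambda>x. F' x v)"
    using smooth_on_local_extension[OF f p] by metis
  have "differential S f x v = F' x v" if "x \<in> S \<inter> W" for x v
    using that tangent_space_open[OF S, of x]
    by (intro differential_eqI differential_local_extension[OF W(1) _ _ W(3) W(4)]) auto
  moreover have "(f has_derivative F' x) (at x)" if "x \<in> S \<inter> W" for x
    using has_derivative_transform_within_open[OF W(4) open_Int[OF S W(1)] that] W(3) that by auto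
  moreover have "Ck_on k (S \<inter> W) (\<lambda>x. F' x v)" for k v using Ck_on_subset[OF W(5)] by blast
  ultimately show thesis using that[of "S \<inter> W" F'] W(1,2) S p by auto
qed

lemma smooth_on_differential:
  fixes f :: "'a::euclidean_space \<Rightarrow> 'b::euclidean_space"
  assumes S: "open S" and f: "smooth_on S f"
  shows "smooth_on S (\<lambda>x. differential S f x v)"
  unfolding smooth_on_def
proof
  fix p assume "p \<in> S"
  obtain W f' where "open W" "p \<in> W" "W \<subseteq> S" "\<And>x. x \<in> W \<Longrightarrow> (f has_derivative f' x) (at x)"
    "\<And>k v. Ck_on k W (\<lambda>x. f' x v)" "\<And>x v. x \<in> W \<Longrightarrow> differential S f x v = f' x v"
    by (rule smooth_on_open_derivative[OF S f \<open>p \<in> S\<close>]) (rule that)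
  then show "\<exists>W F. open W \<and> p \<in> W \<and> (\<forall>k. Ck_on k W F) \<and> (\<forall>x\<in>S \<inter> W. differential S f x v = F x)"
    by (intro exI[of _ W] exI[of _ "\<lambda>x. f' x v"]) auto
qed

text \<open>Equality of mixed partial derivatives. On a holomorphic curve it takes the place of a
  bracket term, as the coordinate fields 1 and i commute.\<close>

lemma differential_symmetric:
  fixes f :: "'a::euclidean_space \<Rightarrow> 'b::euclidean_space"
  assumes S: "open S" and f: "smooth_on S f" and p: "p \<in> S"
  shows "differential S (\<lambda>x. differential S f x v) p u = differential S (\<lambda>x. differential S f x u) p v"
proof -
  obtain W f' where W: "open W" "p \<in> W" "W \<subseteq> S" "\<And>x. x \<in> W \<Longrightarrow> (f has_derivative f' x) (at x)"
    "\<And>k v. Ck_on k W (\<lambda>x. f' x v)" "\<And>x v. x \<in> W \<Longrightarrow> differential S f x v = f' x v"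
    by (rule smooth_on_open_derivative[OF S f p]) (rule that)
  obtain H where H: "\<And>u v. H u v = H v u"
    "\<And>c V u v. c 0 = p \<Longrightarrow> (c has_vector_derivative u) (at 0) \<Longrightarrow> (V has_vector_derivative v) (at (0::real)) \<Longrightarrow>
      ((\<lambda>t. f' (c t) (V t)) has_vector_derivative f' p v + H (V 0) u) (at 0)"
    by (rule derivative_along_curve[OF W(1,2) W(4,5)]; (assumption | (rule that, assumption+)))
  have "differential S (\<lambda>x. differential S f x v) p u = H v u" for u v
  proof (rule differential_eqI)
    show "u \<in> tangent_space S p" using tangent_space_open[OF S p] by simp
    fix c assume "curve_through S p u c"
    then have c: "c 0 = p" "(c has_vector_derivative u) (at 0)" by (auto simp: curve_through_def)
    have "f' p 0 = 0" using linear_0[OF has_derivative_linear[OF W(4)[OF W(2)]]] .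
    then have "((\<lambda>t. f' (c t) v) has_vector_derivative H v u) (at 0)"
      using H(2)[OF c has_vector_derivative_const, of v] by simp
    moreover have "\<forall>\<^sub>F t in at 0. c t \<in> W" using curve_eventually_in[OF c(2) W(1)] W(2) c(1) by simp
    then have "\<forall>\<^sub>F t in at 0. f' (c t) v = differential S f (c t) v"
      by eventually_elim (simp add: W(6))
    moreover have "f' (c 0) v = differential S f (c 0) v" using W(2,6) c(1) by simp
    ultimately show "((\<lambda>t. differential S f (c t) v) has_vector_derivative H v u) (at 0)"
      by (rule has_vector_derivative_eventually)
  qed
  then show ?thesis using H(1) by simp
qed

section \<open>Tangent vectors and brackets on parametrized submanifolds\<close>

locale local_parametrization =
  fixes U W L \<Omega> :: "'a::euclidean_space set" and \<phi> \<psi> :: "'a \<Rightarrow> 'a"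
  assumes W: "open W" and L: "subspace L" and \<Omega>: "openin (top_of_set L) \<Omega>"
    and \<phi>_image: "\<phi> ` \<Omega> = U \<inter> W" and \<psi>_\<phi>: "\<And>z. z \<in> \<Omega> \<Longrightarrow> \<psi> (\<phi> z) = z"
    and \<psi>: "smooth_on (U \<inter> W) \<psi>" and \<phi>: "smooth_on \<Omega> \<phi>"
begin

lemma \<psi>_in: "q \<in> U \<Longrightarrow> q \<in> W \<Longrightarrow> \<psi> q \<in> \<Omega>"
  and \<phi>_\<psi>: "q \<in> U \<Longrightarrow> q \<in> W \<Longrightarrow> \<phi> (\<psi> q) = q"
  using \<phi>_image \<psi>_\<phi> by (metis IntI imageE)+

lemma tangent_domain:
  assumes "z \<in> \<Omega>"
  shows "tangent_space \<Omega> z = L"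
proof
  have \<Omega>L: "\<Omega> \<subseteq> L" using \<Omega> openin_subset by fastforce
  then have "tangent_space \<Omega> z \<subseteq> tangent_space L z" by (auto simp: tangent_space_def curve_through_def)
  then show "tangent_space \<Omega> z \<subseteq> L" using tangent_space_subspace[OF L] by blast
  show "L \<subseteq> tangent_space \<Omega> z"
  proof
    fix v assume v: "v \<in> L"
    obtain T where T: "open T" "\<Omega> = T \<inter> L" using \<Omega> by (auto simp: openin_open)
    have d: "((\<lambda>t. z + t *\<^sub>R v) has_vector_derivative v) (at 0)"
      by (auto intro!: derivative_eq_intros)
    show "v \<in> tangent_space \<Omega> z"
    proof (rule tangent_spaceI[OF d])
      have "z + t *\<^sub>R v \<in> L" for t
        using assms v \<Omega>L by (auto intro!: subspace_add[OF L] subspace_scale[OF L])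
      then show "\<forall>\<^sub>F t in at 0. z + t *\<^sub>R v \<in> \<Omega>"
        using curve_eventually_in[OF d T(1)] assms T(2) by (auto elim: eventually_mono)
    qed (use assms in auto)
  qed
qed

text \<open>A curve with velocity \<open>v\<close>, cut down to \<open>W\<close>, is pulled back by
  the smooth inverse; the velocity of the pulled back curve is the required preimage.\<close>

lemma tangent_eq_image:
  assumes p: "p \<in> U" "p \<in> W" and v: "v \<in> tangent_space U p"
  obtains y where "y \<in> L" "differential \<Omega> \<phi> (\<psi> p) y = v"
proof -
  obtain c where c: "c 0 = p" "\<And>t. c t \<in> U" "(c has_vector_derivative v) (at 0)"
    using v by (auto simp: tangent_space_def curve_through_def)
  have "v \<in> tangent_space (U \<inter> W) p"
    using curve_eventually_in[OF c(3) W] c p by (intro tangent_spaceI[OF c(3)]) (auto elim: eventually_mono)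
  then obtain d where d: "curve_through (U \<inter> W) p v d" by (auto simp: tangent_space_def)
  let ?y = "differential (U \<inter> W) \<psi> p v"
  have dt: "d 0 = p" "\<And>t. d t \<in> U" "\<And>t. d t \<in> W" "(d has_vector_derivative v) (at 0)"
    using d by (auto simp: curve_through_def)
  have y: "curve_through \<Omega> (\<psi> p) ?y (\<lambda>t. \<psi> (d t))"
    using differential_curve[OF \<psi> d] dt \<psi>_in by (simp add: curve_through_def)
  have "((\<lambda>t. \<phi> (\<psi> (d t))) has_vector_derivative differential \<Omega> \<phi> (\<psi> p) ?y) (at 0)"
    by (rule differential_curve[OF \<phi> y])
  then have "(d has_vector_derivative differential \<Omega> \<phi> (\<psi> p) ?y) (at 0)" using \<phi>_\<psi> dt by simp
  then have "differential \<Omega> \<phi> (\<psi> p) ?y = v" using dt(4) vector_derivative_unique_at by blast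
  moreover have "?y \<in> L" using y tangent_domain[OF \<psi>_in[OF p]] by (auto simp: tangent_space_def)
  ultimately show thesis using that by blast
qed

lemma differential_in_tangent:
  assumes p: "p \<in> U" "p \<in> W" and y: "y \<in> L"
  shows "differential \<Omega> \<phi> (\<psi> p) y \<in> tangent_space U p"
  using differential_tangent[OF \<phi>, of U y "\<psi> p"] \<phi>_image y tangent_domain[OF \<psi>_in[OF p]] \<phi>_\<psi>[OF p] by auto

text \<open>A vector field satisfies \<open>X q = d\<Phi> (d\<Psi> (X q))\<close> for smooth extensions of \<open>\<phi>\<close> and \<open>\<psi>\<close>; in the
  bracket the symmetric second derivatives cancel, so that it lies in the image of \<open>d\<Phi>\<close> on \<open>L\<close>.\<close>

lemma lie_bracket_in_tangent:
  assumes p: "p \<in> U" "p \<in> W" and X: "vector_field U X" and Y: "vector_field U Y"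
  shows "lie_bracket U X Y p \<in> tangent_space U p"
proof -
  define z where "z = \<psi> p"
  have z: "z \<in> \<Omega>" using \<psi>_in[OF p] by (simp add: z_def)
  obtain V1 \<Phi> \<Phi>' where V1: "open V1" "z \<in> V1" "\<And>x. x \<in> \<Omega> \<inter> V1 \<Longrightarrow> \<phi> x = \<Phi> x"
    "\<And>x. x \<in> V1 \<Longrightarrow> (\<Phi> has_derivative \<Phi>' x) (at x)" "\<And>k v. Ck_on k V1 (\<lambda>x. \<Phi>' x v)"
    using smooth_on_local_extension[OF \<phi> z] by metis
  have pUW: "p \<in> U \<inter> W" using p by simp
  obtain V2 \<Psi> \<Psi>' where V2: "open V2" "p \<in> V2" "\<And>x. x \<in> (U \<inter> W) \<inter> V2 \<Longrightarrow> \<psi> x = \<Psi> x"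
    "\<And>x. x \<in> V2 \<Longrightarrow> (\<Psi> has_derivative \<Psi>' x) (at x)" "\<And>k v. Ck_on k V2 (\<lambda>x. \<Psi>' x v)"
    "continuous_on V2 \<Psi>"
    using smooth_on_local_extension[OF \<psi> pUW] by metis
  have \<Psi>p: "\<Psi> p = z" using V2(2,3) p by (simp add: z_def)
  \<comment> \<open>On this neighbourhood \<open>\<Psi>\<close> lands where \<open>\<Phi>\<close>
    extends \<phi>, so their composite is the identity at the points of \<open>U\<close>.\<close>
  define N where "N = W \<inter> (V2 \<inter> \<Psi> -` V1)"
  have N: "open N" "p \<in> N"
    using continuous_open_preimage[OF V2(6,1) V1(1)] W p V2(2) V1(2) \<Psi>p by (auto simp: N_def)
  have loc: "\<Psi> q \<in> \<Omega>" "\<Phi> (\<Psi> q) = q" if "q \<in> U" "q \<in> N" for q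
    using that V2(3)[of q] V1(3)[of "\<Psi> q"] \<psi>_in[of q] \<phi>_\<psi>[of q] by (auto simp: N_def)
  have \<Omega>L: "\<Omega> \<subseteq> L" using \<Omega> openin_subset by fastforce
  have tan: "\<Phi>' (\<Psi> q) (\<Psi>' q v) = v" "\<Psi>' q v \<in> L" if q: "q \<in> U" "q \<in> N" and v: "v \<in> tangent_space U q" for q v
  proof -
    obtain c where c: "c 0 = q" "\<And>t. c t \<in> U" "(c has_vector_derivative v) (at 0)"
      using v by (auto simp: tangent_space_def curve_through_def)
    have ev: "\<forall>\<^sub>F t in at 0. c t \<in> N" using curve_eventually_in[OF c(3) N(1)] c(1) q by simp
    have d: "((\<lambda>t. \<Psi> (c t)) has_vector_derivative \<Psi>' q v) (at 0)"
      using vector_derivative_compose[OF c(3)] V2(4)[of q] q c(1) by (simp add: N_def)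
    have "((\<lambda>t. \<Phi> (\<Psi> (c t))) has_vector_derivative \<Phi>' (\<Psi> q) (\<Psi>' q v)) (at 0)"
      using vector_derivative_compose[OF d] V1(4)[of "\<Psi> q"] q c(1) by (simp add: N_def)
    moreover have "\<forall>\<^sub>F t in at 0. \<Phi> (\<Psi> (c t)) = c t"
      using ev by eventually_elim (rule loc(2)[OF c(2)])
    moreover have "\<Phi> (\<Psi> (c 0)) = c 0" using loc(2)[OF q] c(1) by simp
    ultimately have "(c has_vector_derivative \<Phi>' (\<Psi> q) (\<Psi>' q v)) (at 0)"
      by (rule has_vector_derivative_eventually)
    then show "\<Phi>' (\<Psi> q) (\<Psi>' q v) = v" using c(3) vector_derivative_unique_at by blast
    have "\<Psi>' q v \<in> tangent_space L (\<Psi> q)"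
    proof (rule tangent_spaceI[OF d])
      show "\<forall>\<^sub>F t in at 0. \<Psi> (c t) \<in> L"
        using ev by eventually_elim (use loc(1) c(2) \<Omega>L in blast)
      show "\<Psi> q \<in> L" using loc(1)[OF q] \<Omega>L by blast
    qed (use c(1) in simp)
    then show "\<Psi>' q v \<in> L" using tangent_space_subspace[OF L] by blast
  qed
  obtain H1 where H1: "\<And>u v. H1 u v = H1 v u"
    "\<And>c V u v. c 0 = z \<Longrightarrow> (c has_vector_derivative u) (at 0) \<Longrightarrow> (V has_vector_derivative v) (at (0::real)) \<Longrightarrow>
      ((\<lambda>t. \<Phi>' (c t) (V t)) has_vector_derivative \<Phi>' z v + H1 (V 0) u) (at 0)"
    using derivative_along_curve[OF V1(1,2,4,5)] by blast
  obtain H2 where H2: "\<And>u v. H2 u v = H2 v u"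
    "\<And>c V u v. c 0 = p \<Longrightarrow> (c has_vector_derivative u) (at 0) \<Longrightarrow> (V has_vector_derivative v) (at (0::real)) \<Longrightarrow>
      ((\<lambda>t. \<Psi>' (c t) (V t)) has_vector_derivative \<Psi>' p v + H2 (V 0) u) (at 0)"
    using derivative_along_curve[OF V2(1,2,4,5)] by blast
  have main: "\<exists>s\<in>L. differential U A p (B p) = \<Phi>' z s + H1 (\<Psi>' p (A p)) (\<Psi>' p (B p))"
    if A: "vector_field U A" and B: "vector_field U B" for A B
  proof -
    have AB: "smooth_on U A" "\<And>q. q \<in> U \<Longrightarrow> A q \<in> tangent_space U q" "B p \<in> tangent_space U p"
      using A B p by (auto simp: section_along_def)
    obtain c where c: "curve_through U p (B p) c" using AB(3) by (auto simp: tangent_space_def)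
    then have c': "c 0 = p" "\<And>t. c t \<in> U" "(c has_vector_derivative B p) (at 0)"
      by (auto simp: curve_through_def)
    have ev: "\<forall>\<^sub>F t in at 0. c t \<in> N" using curve_eventually_in[OF c'(3) N(1)] c'(1) N(2) by simp
    have dA: "((\<lambda>t. A (c t)) has_vector_derivative differential U A p (B p)) (at 0)"
      by (rule differential_curve[OF AB(1) c])
    define s where "s = \<Psi>' p (differential U A p (B p)) + H2 (A p) (B p)"
    have d2: "((\<lambda>t. \<Psi>' (c t) (A (c t))) has_vector_derivative s) (at 0)"
      using H2(2)[OF c'(1,3) dA] by (simp add: s_def c'(1))
    have dc: "((\<lambda>t. \<Psi> (c t)) has_vector_derivative \<Psi>' p (B p)) (at 0)"
      using vector_derivative_compose[OF c'(3)] V2(4)[OF V2(2)] c'(1) by simp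
    have "((\<lambda>t. \<Phi>' (\<Psi> (c t)) (\<Psi>' (c t) (A (c t)))) has_vector_derivative
        \<Phi>' z s + H1 (\<Psi>' (c 0) (A (c 0))) (\<Psi>' p (B p))) (at 0)"
      by (rule H1(2)[OF _ dc d2]) (simp add: c'(1) \<Psi>p)
    moreover have "\<forall>\<^sub>F t in at 0. \<Phi>' (\<Psi> (c t)) (\<Psi>' (c t) (A (c t))) = A (c t)"
      using ev by eventually_elim (rule tan(1)[OF c'(2) _ AB(2)[OF c'(2)]])
    moreover have "\<Phi>' (\<Psi> (c 0)) (\<Psi>' (c 0) (A (c 0))) = A (c 0)"
      using tan(1)[OF p(1) N(2) AB(2)[OF p(1)]] by (simp add: c'(1))
    ultimately have "((\<lambda>t. A (c t)) has_vector_derivative \<Phi>' z s + H1 (\<Psi>' (c 0) (A (c 0))) (\<Psi>' p (B p))) (at 0)"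
      by (rule has_vector_derivative_eventually)
    then have "((\<lambda>t. A (c t)) has_vector_derivative \<Phi>' z s + H1 (\<Psi>' p (A p)) (\<Psi>' p (B p))) (at 0)"
      by (simp only: c'(1))
    then have "differential U A p (B p) = \<Phi>' z s + H1 (\<Psi>' p (A p)) (\<Psi>' p (B p))"
      using dA vector_derivative_unique_at by blast
    \<comment> \<open>\<open>s\<close> is the velocity of a curve that stays in \<open>L\<close>
      near 0. Thus the derivative of \<open>A\<close> along \<open>B\<close> is a tangent vector
      plus a term symmetric in the two fields.\<close>
    moreover have "s \<in> tangent_space L (\<Psi>' p (A p))"
    proof (rule tangent_spaceI[OF d2])
      show "\<forall>\<^sub>F t in at 0. \<Psi>' (c t) (A (c t)) \<in> L"
        using ev by eventually_elim (use tan(2)[OF c'(2) _ AB(2)[OF c'(2)]] in blast)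
      show "\<Psi>' p (A p) \<in> L" using tan(2)[OF p(1) N(2) AB(2)[OF p(1)]] .
    qed (simp add: c'(1))
    ultimately show ?thesis using tangent_space_subspace[OF L] by blast
  qed
  obtain s where s: "s \<in> L" "differential U Y p (X p) = \<Phi>' z s + H1 (\<Psi>' p (Y p)) (\<Psi>' p (X p))"
    using main[OF Y X] by blast
  obtain r where r: "r \<in> L" "differential U X p (Y p) = \<Phi>' z r + H1 (\<Psi>' p (X p)) (\<Psi>' p (Y p))"
    using main[OF X Y] by blast
  have "lie_bracket U X Y p = \<Phi>' z (s - r)"
    using s(2) r(2) H1(1) linear_diff[OF has_derivative_linear[OF V1(4)[OF V1(2)]]]
    by (simp add: lie_bracket_def)
  moreover have sr: "s - r \<in> L" using s(1) r(1) subspace_diff[OF L] by blast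
  moreover have "differential \<Omega> \<phi> z (s - r) = \<Phi>' z (s - r)"
    using sr tangent_domain[OF z]
    by (intro differential_eqI differential_local_extension[OF V1(1) z V1(2,3) V1(4)[OF V1(2)]]) auto
  ultimately show ?thesis using differential_in_tangent[OF p sr] by (simp add: z_def)
qed

end

text \<open>On adjacent blocks the factor (t - s)^2 is 1. With J X = i [X, E] this gives [J X, E] =
  i X, and it also reflects J J X = -X.\<close>

lemma adjacent_commutator_twice:
  assumes E: "hodge_operator n Q E" and A: "adjacent_blocks n E A"
  shows "commutator (commutator A E) E = A"
proof (rule matrix_block_eqI[OF E])
  fix s t assume st: "s \<le> n" "t \<le> n"
  have "spectral_proj n E s ** commutator (commutator A E) E ** spectral_proj n E t =
      ((real t - real s) * (real t - real s)) *\<^sub>R (spectral_proj n E s ** A ** spectral_proj n E t)"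
    by (simp add: block_commutator_operator[OF E st])
  moreover have "s = Suc t \<or> t = Suc s \<or> spectral_proj n E s ** A ** spectral_proj n E t = 0"
    using A st by (auto simp: adjacent_blocks_def)
  ultimately show "spectral_proj n E s ** commutator (commutator A E) E ** spectral_proj n E t =
      spectral_proj n E s ** A ** spectral_proj n E t" by auto
qed

text \<open>Adjacent degrees have opposite parity, so exactly one of the two indicator values is
  1.\<close>

lemma adjacent_off_diagonal:
  assumes E: "hodge_operator n Q E" and A: "adjacent_blocks n E A"
  shows "A = hodge_proj n E ** A + A ** hodge_proj n E"
proof (rule matrix_block_eqI[OF E])
  fix s t assume st: "s \<le> n" "t \<le> n"
  let ?w = "indicator (plus_indices n) :: nat \<Rightarrow> real" and ?P = "spectral_proj n E"
  have "?P s ** (hodge_proj n E ** A + A ** hodge_proj n E) ** ?P t = (?w s + ?w t) *\<^sub>R (?P s ** A ** ?P t)"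
    using spectral_proj_sum(1)[OF E st(1), of ?w] spectral_proj_sum(2)[OF E st(2), of ?w]
    by (simp add: hodge_proj_eq[OF E] matrix_mult_distribs matrix_mul_assoc)
      (simp add: matrix_mult_distribs scaleR_left_distrib flip: matrix_mul_assoc)
  moreover have "s = Suc t \<or> t = Suc s \<or> ?P s ** A ** ?P t = 0"
    using A st by (auto simp: adjacent_blocks_def)
  moreover have "?w s + ?w t = 1" if "s = Suc t \<or> t = Suc s"
    using that st by (auto simp: indicator_def plus_indices_def)
  ultimately show "?P s ** A ** ?P t = ?P s ** (hodge_proj n E ** A + A ** hodge_proj n E) ** ?P t" by auto
qed

text \<open>Opposite parity and distance one make the coefficient of each adjacent block 1 or -1, so
  the blocks can be recovered. This is injectivity of d pi on horizontal vectors.\<close>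

lemma adjacent_hodge_proj_injective:
  assumes E: "hodge_operator n Q E" and A: "adjacent_blocks n E A" "adjacent_blocks n E B"
    and eq: "commutator (commutator A E) (hodge_proj n E) = commutator (commutator B E) (hodge_proj n E)"
  shows "A = B"
proof (rule matrix_block_eqI[OF E])
  fix s t assume st: "s \<le> n" "t \<le> n"
  let ?w = "indicator (plus_indices n) :: nat \<Rightarrow> real" and ?P = "spectral_proj n E"
  have *: "?P s ** commutator (commutator X E) (hodge_proj n E) ** ?P t =
      ((?w t - ?w s) * (real t - real s)) *\<^sub>R (?P s ** X ** ?P t)" for X
    by (simp add: hodge_proj_eq[OF E] block_commutator_sum[OF E st] block_commutator_operator[OF E st])
  show "?P s ** A ** ?P t = ?P s ** B ** ?P t"
  proof (cases "s = Suc t \<or> t = Suc s")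
    case True
    then have "(?w t - ?w s) * (real t - real s) \<noteq> 0"
      using st by (auto simp: indicator_def plus_indices_def)
    moreover have "((?w t - ?w s) * (real t - real s)) *\<^sub>R (?P s ** A ** ?P t) =
        ((?w t - ?w s) * (real t - real s)) *\<^sub>R (?P s ** B ** ?P t)"
      using *[of A] *[of B] unfolding eq by (rule trans[OF sym])
    ultimately show ?thesis by (simp only: scaleR_cancel_left) simp
  next
    case False
    then show ?thesis using A st by (simp add: adjacent_blocks_def)
  qed
qed

context hodge_orbit_connection
begin

text \<open>Here \<open>Y = J X\<close>, and \<open>X'\<close>, \<open>Y'\<close> are the derivatives of \<open>X\<close> along \<open>Y\<close> and of \<open>Y\<close> along \<open>X\<close>; the
  summands are the covariant derivatives of \<open>d\<pi>(X) = -\<i> [Y, P]\<close> and \<open>d\<pi>(Y) = \<i> [X, P]\<close>.\<close>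

lemma proj_sum:
  assumes P: "P ** P = P" and X: "X = P ** X + X ** P" and Y: "Y = P ** Y + Y ** P"
  shows "proj P (cscale (- \<i>) (commutator Y (cscale (- \<i>) (commutator Y P)) + commutator Y' P)) +
         proj P (cscale \<i> (commutator X (cscale \<i> (commutator X P)) + commutator X' P)) =
         cscale (- \<i>) (commutator (Y' - X') P)"
proof -
  have diag: "commutator (commutator V (commutator V P)) P = 0" if V: "V = P ** V + V ** P" for V
    using off_diagonal_mult[OF P V commutator_off_diagonal[OF P]]
      off_diagonal_mult[OF P commutator_off_diagonal[OF P] V]
    by (simp add: commutator_def[of V "commutator V P"] commutator_diff_left)
  show ?thesis
    by (simp add: cscale_commutator commutator_add_left diag[OF X] diag[OF Y] cscale_simps
        idempotent_commutator[OF P] commutator_diff_left commutator_uminus_left commutator_uminus_right)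
qed

end

section \<open>Horizontal slices\<close>

text \<open>Centring \<open>E\<close> does not change the commutator. For horizontal
  \<open>A\<close>, \<open>[A, E]\<close> is thus the Lie algebra element whose infinitesimal action
  on the projector is d pi of \<open>A\<close>.\<close>

lemma (in hodge_orbit) commutator_operator_type:
  assumes "hodge_operator n Q E" "has_type Q (- 1) (- 1) A"
  shows "has_type Q 1 (- 1) (commutator A E)"
proof -
  have "commutator A (mat 1) = 0" by (simp add: commutator_def)
  then have "commutator A E = commutator A (E - (real n / 2) *\<^sub>R mat 1)"
    by (simp add: commutator_diff_right commutator_scaleR_right)
  moreover have "has_type Q (- 1) (- 1) (E - (real n / 2) *\<^sub>R mat 1)"
    using assms(1) by (simp add: hodge_operator_def)
  ultimately show ?thesis using has_type_commutator[OF assms(2)] by force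
qed

locale horizontal_slice_in_orbit = hodge_orbit_connection n Q G E0 met nab k
  for n :: nat and Q :: "int^'m^'m" and G :: "(real^'m^'m) set" and E0 :: "complex^'m^'m"
    and met :: "complex^'m^'m \<Rightarrow> complex^'m^'m \<Rightarrow> complex^'m^'m \<Rightarrow> real"
    and nab :: "complex^'m^'m \<Rightarrow> complex^'m^'m \<Rightarrow> (complex^'m^'m \<Rightarrow> complex^'m^'m) \<Rightarrow> complex^'m^'m"
    and k :: real +
  fixes U :: "(complex^'m^'m) set"
  assumes slice: "horizontal_slice n D U"
begin

lemma U_subset: "U \<subseteq> D"
  using slice by (simp add: horizontal_slice_def complex_submanifold_def)

lemma U_operator: "p \<in> U \<Longrightarrow> hodge_operator n Q p"
  using U_subset D_hodge_operator by blast

lemma tangent_U: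
  assumes "v \<in> tangent_space U p"
  shows "p \<in> U" "v \<in> horizontal_space n D p" "adjacent_blocks n p v" "has_type Q (- 1) (- 1) v"
    "hodge_J n D p v = cscale \<i> (commutator v p)"
proof -
  show p: "p \<in> U" using assms by (auto simp: tangent_space_def curve_through_def)
  show h: "v \<in> horizontal_space n D p" using slice assms p by (auto simp: horizontal_slice_def)
  show "adjacent_blocks n p v" by (rule horizontal_adjacent[OF h])
  show "has_type Q (- 1) (- 1) v" using h by (intro tangent_D(1)[of v p]) (simp add: horizontal_space_def)
  show "hodge_J n D p v = cscale \<i> (commutator v p)" by (rule hodge_J_horizontal[OF h])
qed

lemma slice_parametrization:
  assumes "p \<in> U"
  obtains W L \<Omega> \<phi> \<psi> where "local_parametrization U W L \<Omega> \<phi> \<psi>" "p \<in> W"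
    "\<And>y. y \<in> L \<Longrightarrow> mat_i y \<in> L"
    "\<And>z y. z \<in> \<Omega> \<Longrightarrow> y \<in> tangent_space \<Omega> z \<Longrightarrow>
      differential \<Omega> \<phi> z (mat_i y) = hodge_J n D (\<phi> z) (differential \<Omega> \<phi> z y)"
proof -
  have "\<exists>W (L :: (complex^'m^'m) set) \<Omega> \<phi> \<psi>.
        open W \<and> p \<in> W \<and> subspace L \<and> mat_i ` L \<subseteq> L \<and> openin (top_of_set L) \<Omega> \<and>
        \<phi> ` \<Omega> = U \<inter> W \<and> (\<forall>z\<in>\<Omega>. \<psi> (\<phi> z) = z) \<and> smooth_on (U \<inter> W) \<psi> \<and>
        holomorphic_into n D mat_i \<Omega> \<phi>"
    using slice assms by (simp add: horizontal_slice_def complex_submanifold_def)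
  then obtain W and L :: "(complex^'m^'m) set" and \<Omega> \<phi> \<psi> where *: "open W" "p \<in> W" "subspace L" "mat_i ` L \<subseteq> L" "openin (top_of_set L) \<Omega>"
        "\<phi> ` \<Omega> = U \<inter> W" "\<forall>z\<in>\<Omega>. \<psi> (\<phi> z) = z" "smooth_on (U \<inter> W) \<psi>"
        "holomorphic_into n D mat_i \<Omega> \<phi>" by (elim exE conjE) (rule that, assumption+)
  have "local_parametrization U W L \<Omega> \<phi> \<psi>"
    using * by unfold_locales (auto simp: holomorphic_into_def)
  then show thesis
    using * by (intro that[of W L \<Omega> \<phi> \<psi>]) (auto simp: holomorphic_into_def)
qed

text \<open>The parameter space \<open>L\<close> is closed under multiplication by i, and the
  holomorphic parametrization carries this multiplication to \<open>J\<close>.\<close>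

lemma hodge_J_in_tangent:
  assumes v: "v \<in> tangent_space U p"
  shows "hodge_J n D p v \<in> tangent_space U p"
proof -
  note p = tangent_U(1)[OF v]
  obtain W L \<Omega> \<phi> \<psi> where par: "local_parametrization U W L \<Omega> \<phi> \<psi>" "p \<in> W"
    "\<And>y. y \<in> L \<Longrightarrow> mat_i y \<in> L"
    "\<And>z y. z \<in> \<Omega> \<Longrightarrow> y \<in> tangent_space \<Omega> z \<Longrightarrow>
      differential \<Omega> \<phi> z (mat_i y) = hodge_J n D (\<phi> z) (differential \<Omega> \<phi> z y)"
    by (rule slice_parametrization[OF p]) (rule that)
  interpret local_parametrization U W L \<Omega> \<phi> \<psi> by (rule par(1))
  obtain y where y: "y \<in> L" "differential \<Omega> \<phi> (\<psi> p) y = v"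
    using tangent_eq_image[OF p par(2) v] by blast
  have z: "\<psi> p \<in> \<Omega>" by (rule \<psi>_in[OF p par(2)])
  have "hodge_J n D p v = differential \<Omega> \<phi> (\<psi> p) (mat_i y)"
    using par(4)[OF z, of y] y tangent_domain[OF z] \<phi>_\<psi>[OF p par(2)] by simp
  then show ?thesis using differential_in_tangent[OF p par(2) par(3)[OF y(1)]] by simp
qed

lemma lie_bracket_in_tangent_U:
  assumes "p \<in> U" "vector_field U X" "vector_field U Y"
  shows "lie_bracket U X Y p \<in> tangent_space U p"
proof -
  obtain W L \<Omega> \<phi> \<psi> where par: "local_parametrization U W L \<Omega> \<phi> \<psi>" "p \<in> W"
    "\<And>y. y \<in> L \<Longrightarrow> mat_i y \<in> L"
    "\<And>z y. z \<in> \<Omega> \<Longrightarrow> y \<in> tangent_space \<Omega> z \<Longrightarrow>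
      differential \<Omega> \<phi> z (mat_i y) = hodge_J n D (\<phi> z) (differential \<Omega> \<phi> z y)"
    by (rule slice_parametrization[OF assms(1)]) (rule that)
  show ?thesis by (rule local_parametrization.lie_bracket_in_tangent[OF par(1) assms(1) par(2) assms(2,3)])
qed

lemma smooth_on_hodge_proj:
  assumes "smooth_on S \<gamma>" "\<gamma> ` S \<subseteq> U"
  shows "smooth_on S (\<lambda>x. hodge_proj n (\<gamma> x))"
proof (rule smooth_on_cong[OF _ smooth_on_spectral_sum[OF assms(1)]])
  fix x assume "x \<in> S"
  then show "spectral_sum n (\<gamma> x) (indicator (plus_indices n)) = hodge_proj n (\<gamma> x)"
    using hodge_proj_eq[OF U_operator] assms(2) by auto
qed

lemma hodge_proj_along_curve:
  assumes c: "\<And>t. c t \<in> U" "(c has_vector_derivative v) (at (0::real))"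
  shows "((\<lambda>t. hodge_proj n (c t)) has_vector_derivative
    commutator (commutator v (c 0)) (hodge_proj n (c 0))) (at 0)"
proof (rule hodge_proj_derivative[OF U_operator[OF c(1)] refl c(2)])
  have "v \<in> tangent_space U (c 0)" using c by (auto simp: tangent_space_def curve_through_def)
  then show "adjacent_blocks n (c 0) v" by (rule tangent_U(3))
qed

lemma differential_hodge_proj:
  assumes "smooth_on S \<gamma>" "\<gamma> ` S \<subseteq> U" "v \<in> tangent_space S p"
  shows "differential S (\<lambda>x. hodge_proj n (\<gamma> x)) p v =
    commutator (commutator (differential S \<gamma> p v) (\<gamma> p)) (hodge_proj n (\<gamma> p))"
proof (rule differential_eqI[OF assms(3)])
  fix c assume c: "curve_through S p v c"
  then have c': "c 0 = p" "\<And>t. \<gamma> (c t) \<in> U" using assms(2) by (auto simp: curve_through_def)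
  show "((\<lambda>t. hodge_proj n (\<gamma> (c t))) has_vector_derivative
    commutator (commutator (differential S \<gamma> p v) (\<gamma> p)) (hodge_proj n (\<gamma> p))) (at 0)"
    using hodge_proj_along_curve[OF c'(2) differential_curve[OF assms(1) c]] by (simp add: c'(1))
qed

text \<open>The computation shared by harmonicity on curves and the identity for vector fields:
  \<gamma> is either a holomorphic curve with \<open>A\<close>, \<open>B\<close> its partial
  derivatives, or the identity of \<open>U\<close> with \<open>A = X\<close> and
  \<open>B = J X\<close>. The sections \<open>W1\<close> and \<open>W2\<close> are prescribed on
  \<open>S\<close> only, where \<open>differential\<close> has meaning.\<close>

lemma connection_sum:
  fixes \<gamma> :: "'a::euclidean_space \<Rightarrow> complex^'m^'m"
  assumes \<gamma>: "smooth_on S \<gamma>" "\<gamma> ` S \<subseteq> U" and f: "f = (\<lambda>x. hodge_proj n (\<gamma> x))"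
    and nabf: "pullback_connection S D1 f nab nabf"
    and A: "smooth_on S A" "\<And>x. x \<in> S \<Longrightarrow> A x \<in> tangent_space U (\<gamma> x)"
    and B: "\<And>x. x \<in> S \<Longrightarrow> B x = hodge_J n D (\<gamma> x) (A x)"
    and p: "p \<in> S" and u: "u \<in> tangent_space S p" "differential S \<gamma> p u = A p"
    and v: "v \<in> tangent_space S p" "differential S \<gamma> p v = B p"
    and W1: "\<And>x. x \<in> S \<Longrightarrow> W1 x = commutator (commutator (A x) (\<gamma> x)) (f x)"
    and W2: "\<And>x. x \<in> S \<Longrightarrow> W2 x = commutator (commutator (B x) (\<gamma> x)) (f x)"
  shows "nabf p u W1 + nabf p v W2 =
    cscale (- \<i>) (commutator (differential S B p u - differential S A p v) (f p))"
proof -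
  have f_smooth: "smooth_on S f" unfolding f by (rule smooth_on_hodge_proj[OF \<gamma>])
  have \<gamma>U: "\<gamma> x \<in> U" if "x \<in> S" for x using that \<gamma>(2) by blast
  have f_D1: "f ` S \<subseteq> D1" using \<gamma>U U_subset hodge_proj_in_D1 unfolding f by blast
  have B_eq: "B x = cscale \<i> (commutator (A x) (\<gamma> x))" if "x \<in> S" for x
    using B[OF that] tangent_U(5)[OF A(2)[OF that]] by simp
  have B_tangent: "B x \<in> tangent_space U (\<gamma> x)" if "x \<in> S" for x
    using B[OF that] hodge_J_in_tangent[OF A(2)[OF that]] by simp
  have B_smooth: "smooth_on S B"
  proof (rule smooth_on_cong)
    have "bounded_linear (cscale \<i>)" using linear_cscale linear_conv_bounded_linear by blast
    then show "smooth_on S (\<lambda>x. cscale \<i> (commutator (A x) (\<gamma> x)))"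
      by (rule smooth_on_linear_comp[OF _ smooth_on_commutator[OF A(1) \<gamma>(1)]])
  qed (simp add: B_eq)
  have is_section: "section_along S D1 f W"
    if V: "smooth_on S V" "\<And>x. x \<in> S \<Longrightarrow> V x \<in> tangent_space U (\<gamma> x)"
      and W: "\<And>x. x \<in> S \<Longrightarrow> W x = commutator (commutator (V x) (\<gamma> x)) (f x)" for V W
  proof -
    have "smooth_on S W"
      by (rule smooth_on_cong[OF _ smooth_on_commutator[OF smooth_on_commutator[OF V(1) \<gamma>(1)] f_smooth]])
        (simp add: W)
    moreover have "W x \<in> tangent_space D1 (f x)" if x: "x \<in> S" for x
      using commutator_in_tangent_D1[OF commutator_operator_type[OF U_operator[OF \<gamma>U[OF x]] tangent_U(4)[OF V(2)[OF x]]]]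
        f_D1 x by (auto simp: W[OF x])
    ultimately show ?thesis by (simp add: section_along_def)
  qed
  have W1_eq: "W1 x = cscale (- \<i>) (commutator (B x) (f x))" if "x \<in> S" for x
    by (simp add: W1[OF that] B_eq[OF that] cscale_commutator cscale_simps)
  have W2_eq: "W2 x = cscale \<i> (commutator (A x) (f x))" if "x \<in> S" for x
    using adjacent_commutator_twice[OF U_operator[OF \<gamma>U[OF that]] tangent_U(3)[OF A(2)[OF that]]]
    by (simp add: W2[OF that] B_eq[OF that] cscale_commutator)
  have derivative: "differential S W p w = cscale s (commutator (V p) (W' p) + commutator (differential S V p w) (f p))"
    if V: "smooth_on S V" and W: "\<And>x. x \<in> S \<Longrightarrow> W x = cscale s (commutator (V x) (f x))"
      and w: "w \<in> tangent_space S p"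
      and W': "W' p = commutator (commutator (differential S \<gamma> p w) (\<gamma> p)) (f p)" for V W W' w s
  proof (rule differential_eqI[OF w])
    fix c assume c: "curve_through S p w c"
    then have c': "c 0 = p" "\<And>t. c t \<in> S" by (auto simp: curve_through_def)
    have bl: "bounded_linear (cscale s)" using linear_cscale linear_conv_bounded_linear by blast
    have "((\<lambda>t. f (c t)) has_vector_derivative W' p) (at 0)"
      using differential_curve[OF f_smooth c] differential_hodge_proj[OF \<gamma> w] by (simp add: W' f)
    from commutator_has_vector_derivative[OF differential_curve[OF V c] this]
    have "((\<lambda>t. cscale s (commutator (V (c t)) (f (c t)))) has_vector_derivative
        cscale s (commutator (V p) (W' p) + commutator (differential S V p w) (f p))) (at 0)"
      using bounded_linear.has_vector_derivative[OF bl] by (fastforce simp: c'(1))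
    then show "((\<lambda>t. W (c t)) has_vector_derivative
        cscale s (commutator (V p) (W' p) + commutator (differential S V p w) (f p))) (at 0)"
      by (simp add: W c'(2))
  qed
  have fp: "f p \<in> D1" using f_D1 p by blast
  note E = U_operator[OF \<gamma>U[OF p]]
  have offA: "A p = f p ** A p + A p ** f p"
    unfolding f by (rule adjacent_off_diagonal[OF E tangent_U(3)[OF A(2)[OF p]]])
  have offB: "B p = f p ** B p + B p ** f p"
    unfolding f by (rule adjacent_off_diagonal[OF E tangent_U(3)[OF B_tangent[OF p]]])
  have "nabf p u W1 = proj (f p) (differential S W1 p u)"
    by (rule pullback_connection_formula[OF nabf f_smooth f_D1 is_section[OF A W1] p u(1)])
  \<comment> \<open>In the product rule the derivative of \<open>f\<close> along \<open>u\<close> is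
    \<open>W1 p\<close> itself, since \<open>u\<close> is mapped to \<open>A p\<close>.\<close>
  also have "differential S W1 p u = cscale (- \<i>) (commutator (B p) (W1 p) + commutator (differential S B p u) (f p))"
    by (rule derivative[OF B_smooth W1_eq u(1)]) (simp_all add: W1[OF p] u(2))
  finally have 1: "nabf p u W1 = proj (f p) (cscale (- \<i>)
      (commutator (B p) (cscale (- \<i>) (commutator (B p) (f p))) + commutator (differential S B p u) (f p)))"
    by (simp only: W1_eq[OF p])
  have "nabf p v W2 = proj (f p) (differential S W2 p v)"
    by (rule pullback_connection_formula[OF nabf f_smooth f_D1 is_section[OF B_smooth B_tangent W2] p v(1)])
  also have "differential S W2 p v = cscale \<i> (commutator (A p) (W2 p) + commutator (differential S A p v) (f p))"
    by (rule derivative[OF A(1) W2_eq v(1)]) (simp_all add: W2[OF p] v(2))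
  finally have 2: "nabf p v W2 = proj (f p) (cscale \<i>
      (commutator (A p) (cscale \<i> (commutator (A p) (f p))) + commutator (differential S A p v) (f p)))"
    by (simp only: W2_eq[OF p])
  show ?thesis unfolding 1 2 by (rule proj_sum[OF D1_idempotent(1)[OF fp] offA offB])
qed

section \<open>Immersion, harmonicity on curves, and the identity for vector fields\<close>

lemma differential_identity:
  assumes "v \<in> tangent_space S p"
  shows "differential S (\<lambda>x. x) p v = v"
  by (rule differential_eqI[OF assms]) (simp add: curve_through_def)

lemma differential_hodge_proj_U:
  assumes "v \<in> tangent_space U p"
  shows "differential U (hodge_proj n) p v = commutator (commutator v p) (hodge_proj n p)"
  using differential_hodge_proj[OF smooth_on_id _ assms] differential_identity[OF assms] by simp

lemma immersion_hodge_proj: "immersion U D1 (hodge_proj n)"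
  unfolding immersion_def
proof (intro conjI ballI)
  show "hodge_proj n ` U \<subseteq> D1" using U_subset hodge_proj_in_D1 by blast
  show "smooth_on U (hodge_proj n)" using smooth_on_hodge_proj[OF smooth_on_id] by simp
  fix p assume p: "p \<in> U"
  show "inj_on (differential U (hodge_proj n) p) (tangent_space U p)"
  proof (rule inj_onI)
    fix v w assume v: "v \<in> tangent_space U p" and w: "w \<in> tangent_space U p"
      and eq: "differential U (hodge_proj n) p v = differential U (hodge_proj n) p w"
    then show "v = w"
      using adjacent_hodge_proj_injective[OF U_operator[OF p] tangent_U(3)[OF v] tangent_U(3)[OF w]]
      by (simp add: differential_hodge_proj_U)
  qed
qed

text \<open>Holomorphy makes the derivative in direction i equal to \<open>J\<close> of the
  derivative in direction 1. The sum of covariant derivatives is then a multiple of a commutator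
  with the difference of the mixed second derivatives, which is 0.\<close>

lemma harmonic_on_curve_hodge_proj:
  assumes \<Omega>: "open \<Omega>" and \<gamma>: "holomorphic_into n D ((*) \<i>) \<Omega> \<gamma>" "\<gamma> ` \<Omega> \<subseteq> U"
  shows "harmonic_on_curve \<Omega> D1 nab (hodge_proj n \<circ> \<gamma>)"
  unfolding harmonic_on_curve_def
proof (intro conjI allI impI ballI)
  have sm: "smooth_on \<Omega> \<gamma>" using \<gamma>(1) by (simp add: holomorphic_into_def)
  show "smooth_on \<Omega> (hodge_proj n \<circ> \<gamma>)" using smooth_on_hodge_proj[OF sm \<gamma>(2)] by (simp add: o_def)
  show "(hodge_proj n \<circ> \<gamma>) ` \<Omega> \<subseteq> D1" using \<gamma>(2) U_subset hodge_proj_in_D1 by fastforce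
  fix nabf z assume nabf: "pullback_connection \<Omega> D1 (hodge_proj n \<circ> \<gamma>) nab nabf" and z: "z \<in> \<Omega>"
  have T: "v \<in> tangent_space \<Omega> x" if "x \<in> \<Omega>" for v x using tangent_space_open[OF \<Omega> that] by simp
  let ?A = "\<lambda>x. differential \<Omega> \<gamma> x 1" and ?B = "\<lambda>x. differential \<Omega> \<gamma> x \<i>"
  have "nabf z 1 (\<lambda>w. differential \<Omega> (hodge_proj n \<circ> \<gamma>) w 1) +
      nabf z \<i> (\<lambda>w. differential \<Omega> (hodge_proj n \<circ> \<gamma>) w \<i>) =
    cscale (- \<i>) (commutator (differential \<Omega> ?B z 1 - differential \<Omega> ?A z \<i>) ((hodge_proj n \<circ> \<gamma>) z))"
  proof (rule connection_sum[OF sm \<gamma>(2) _ nabf])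
    show "smooth_on \<Omega> ?A" by (rule smooth_on_differential[OF \<Omega> sm])
    show "?A x \<in> tangent_space U (\<gamma> x)" if "x \<in> \<Omega>" for x
      by (rule differential_tangent[OF sm \<gamma>(2) T[OF that]])
    show "?B x = hodge_J n D (\<gamma> x) (?A x)" if "x \<in> \<Omega>" for x
      using \<gamma>(1) T[OF that] that unfolding holomorphic_into_def by (metis mult.right_neutral)
    show "differential \<Omega> (hodge_proj n \<circ> \<gamma>) x 1 =
        commutator (commutator (?A x) (\<gamma> x)) ((hodge_proj n \<circ> \<gamma>) x)" if "x \<in> \<Omega>" for x
      using differential_hodge_proj[OF sm \<gamma>(2) T[OF that]] by (simp add: o_def)
    show "differential \<Omega> (hodge_proj n \<circ> \<gamma>) x \<i> =
        commutator (commutator (?B x) (\<gamma> x)) ((hodge_proj n \<circ> \<gamma>) x)" if "x \<in> \<Omega>" for x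
      using differential_hodge_proj[OF sm \<gamma>(2) T[OF that]] by (simp add: o_def)
  qed (use z T in \<open>auto simp: o_def\<close>)
  also have "differential \<Omega> ?B z 1 = differential \<Omega> ?A z \<i>"
    by (rule differential_symmetric[OF \<Omega> sm z])
  finally show "nabf z 1 (\<lambda>w. differential \<Omega> (hodge_proj n \<circ> \<gamma>) w 1) +
      nabf z \<i> (\<lambda>w. differential \<Omega> (hodge_proj n \<circ> \<gamma>) w \<i>) = 0"
    by (simp only: diff_self commutator_zero_left cscale_simps)
qed

lemma pluriharmonic_hodge_proj:
  assumes nabU: "pullback_connection U D1 (hodge_proj n) nab nabU" and X: "vector_field U X"
    and JX: "\<And>p. JX p = hodge_J n D p (X p)" and p: "p \<in> U"
  shows "nabU p (X p) (\<lambda>q. differential U (hodge_proj n) q (X q)) +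
    nabU p (JX p) (\<lambda>q. differential U (hodge_proj n) q (JX q)) +
    differential U (hodge_proj n) p (hodge_J n D p (lie_bracket U X JX p)) = 0"
proof -
  have X': "smooth_on U X" "\<And>q. q \<in> U \<Longrightarrow> X q \<in> tangent_space U q"
    using X by (auto simp: section_along_def)
  have JX_tangent: "JX q \<in> tangent_space U q" if "q \<in> U" for q
    using hodge_J_in_tangent[OF X'(2)[OF that]] by (simp add: JX)
  have JX_eq: "JX q = cscale \<i> (commutator (X q) q)" if "q \<in> U" for q
    using tangent_U(5)[OF X'(2)[OF that]] by (simp add: JX)
  have "smooth_on U JX"
  proof (rule smooth_on_cong)
    have "bounded_linear (cscale \<i>)" using linear_cscale linear_conv_bounded_linear by blast
    then show "smooth_on U (\<lambda>x. cscale \<i> (commutator (X x) x))"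
      by (rule smooth_on_linear_comp[OF _ smooth_on_commutator[OF X'(1) smooth_on_id]])
  qed (simp add: JX_eq)
  then have JX_field: "vector_field U JX" using JX_tangent by (simp add: section_along_def)
  let ?Z = "lie_bracket U X JX p"
  \<comment> \<open>The formulas for \<open>hodge_J\<close> and d pi hold for horizontal vectors, so
    the bracket must first be known to be tangent to the slice.\<close>
  have Z: "?Z \<in> tangent_space U p" by (rule lie_bracket_in_tangent_U[OF p X JX_field])
  have "nabU p (X p) (\<lambda>q. differential U (hodge_proj n) q (X q)) +
      nabU p (JX p) (\<lambda>q. differential U (hodge_proj n) q (JX q)) =
    cscale (- \<i>) (commutator (differential U JX p (X p) - differential U X p (JX p)) (hodge_proj n p))"
    using X' JX JX_tangent p
    by (intro connection_sum[OF smooth_on_id _ refl nabU])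
      (auto simp: differential_identity differential_hodge_proj_U)
  also have "\<dots> = cscale (- \<i>) (commutator ?Z (hodge_proj n p))" by (simp add: lie_bracket_def)
  also have "differential U (hodge_proj n) p (hodge_J n D p ?Z) = cscale \<i> (commutator ?Z (hodge_proj n p))"
    using differential_hodge_proj_U[OF hodge_J_in_tangent[OF Z]] tangent_U(5)[OF Z]
      adjacent_commutator_twice[OF U_operator[OF p] tangent_U(3)[OF Z]]
    by (simp add: cscale_commutator)
  ultimately show ?thesis by (simp add: cscale_simps)
qed

end

theorem theorem1p1:
  fixes n :: nat and h :: "nat \<Rightarrow> nat" and Q :: "int^'m^'m"
    and G V K :: "(real^'m^'m) set"
    and E0 :: "complex^'m^'m" and D D1 U :: "(complex^'m^'m) set"
    and met :: "complex^'m^'m \<Rightarrow> complex^'m^'m \<Rightarrow> complex^'m^'m \<Rightarrow> real"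
    and nab :: "complex^'m^'m \<Rightarrow> complex^'m^'m \<Rightarrow> (complex^'m^'m \<Rightarrow> complex^'m^'m) \<Rightarrow> complex^'m^'m"
  assumes "n \<ge> 1"
    and "nondegenerate Q"
    and "\<And>x y :: int^'m. bil Q y x = (-1) ^ n * bil Q x y"
    and "G = aut_real Q \<or> G = connected_component_set (aut_real Q) (mat 1)"
    and "E0 \<in> hodge_decompositions n Q h"
    and "V = {g \<in> G. \<forall>r\<le>n. (*v) (cplx_mat g) ` hcomp E0 r = hcomp E0 r}"
    and "K = {g \<in> G. (*v) (cplx_mat g) ` hplus n E0 = hplus n E0}"
    and "semisimple (lie_algebra G)" and "no_compact_factors (lie_algebra G)"
    and "connected V" and "compact V"
    and "maximal_connected_compact K G"
    and "D = (\<lambda>g. act g E0) ` G"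
    and "D1 = (\<lambda>g. act g (hodge_proj n E0)) ` G"
    and "invariant_metric G K D1 (hodge_proj n E0) met"
    and "levi_civita D1 met nab"
    and "horizontal_slice n D U"
  shows "immersion U D1 (hodge_proj n) \<and>
    (\<forall>\<Omega> \<gamma>. open \<Omega> \<and> holomorphic_into n D ((*) \<i>) \<Omega> \<gamma> \<and> \<gamma> ` \<Omega> \<subseteq> U \<longrightarrow>
       harmonic_on_curve \<Omega> D1 nab (hodge_proj n \<circ> \<gamma>)) \<and>
    (\<forall>nabU X. pullback_connection U D1 (hodge_proj n) nab nabU \<and> vector_field U X \<longrightarrow>
       (let J = hodge_J n D;
            dpi = differential U (hodge_proj n);
            JX = (\<lambda>p. J p (X p))
        in \<forall>p\<in>U.
             nabU p (X p) (\<lambda>q. dpi q (X q)) +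
             nabU p (JX p) (\<lambda>q. dpi q (JX q)) +
             dpi p (J p (lie_bracket U X JX p)) = 0))"
proof -
  have G: "isometry_group Q G" using assms(4) by (simp add: isometry_group_def)
  interpret orbit: hodge_orbit n Q G E0
    by unfold_locales (use G hodge_decomposition_operator[OF assms(5)] gram_mult_eq_0[OF assms(5)] in auto)
  have D: "D = orbit.D" and D1: "D1 = orbit.D1"
    using assms(13,14) by (simp_all add: orbit.D_def orbit.D1_def)
  \<comment> \<open>Here \<open>K\<close> enters: it determines the Cartan complement on which the
    metric is normalized, and \<open>k\<close> is the positive factor in front of the Killing
    form.\<close>
  obtain k where k: "k > 0" "\<And>P X Y. X \<in> tangent_space orbit.D1 P \<Longrightarrow> Y \<in> tangent_space orbit.D1 P \<Longrightarrow>
    met P X Y = k * killing_form (isometry_algebra Q) (re_mat (commutator X P)) (re_mat (commutator Y P))"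
    using orbit.invariant_metric_formula[OF assms(7) assms(15)[unfolded D1]] by metis
  interpret horizontal_slice_in_orbit n Q G E0 met nab k U
    using assms(8,16,17) k by unfold_locales (simp_all add: lie_algebra_isometry_group[OF G] D D1)
  show ?thesis
    unfolding D D1 Let_def
  proof (intro conjI allI impI ballI)
    show "immersion U orbit.D1 (hodge_proj n)" by (rule immersion_hodge_proj)
    fix \<Omega> \<gamma> assume "open \<Omega> \<and> holomorphic_into n orbit.D ((*) \<i>) \<Omega> \<gamma> \<and> \<gamma> ` \<Omega> \<subseteq> U"
    then show "harmonic_on_curve \<Omega> orbit.D1 nab (hodge_proj n \<circ> \<gamma>)"
      by (intro harmonic_on_curve_hodge_proj) auto
  next
    fix nabU X p
    assume "pullback_connection U orbit.D1 (hodge_proj n) nab nabU \<and> vector_field U X" and p: "p \<in> U"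
    then show "nabU p (X p) (\<lambda>q. differential U (hodge_proj n) q (X q)) +
        nabU p (hodge_J n orbit.D p (X p)) (\<lambda>q. differential U (hodge_proj n) q (hodge_J n orbit.D q (X q))) +
        differential U (hodge_proj n) p
          (hodge_J n orbit.D p (lie_bracket U X (\<lambda>p. hodge_J n orbit.D p (X p)) p)) = 0"
      by (intro pluriharmonic_hodge_proj[OF _ _ refl p]) auto
  qed
qed

end
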